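(* Let $G$ be a countable group which acts by isometries on a separable Gromov hyperbolic space $X$ with basepoint $x_0$, and let $\mu$ be a non-elementary probability distribution on $G$ with finite first moment, i.e. $\int_G d_X(x_0,gx_0)\,d\mu(g)<\infty$. Then for almost every sample path $(w_nx_0)_{n\in\mathbb{N}}$ there is a quasigeodesic ray $\gamma$ which tracks the sample path sublinearly, i.e. $$\lim_{n\to\infty}\frac{d_X(w_nx_0,\gamma)}{n}=0,\quad\text{almost surely.}$$ If the support of $\mu$ is bounded in $X$ (i.e. $\{gx_0:\mu(g)>0\}$ is a bounded subset of $X$), then in fact the tracking is logarithmic, i.e. $$\limsup_{n\to\infty}\frac{d_X(w_nx_0,\gamma)}{\log n}<\infty,\quad\text{almost surely.}$$
   Context: A Gromov hyperbolic space is a geodesic metric space $X$ for which there is $\delta\ge 0$ such that in every geodesic triangle each side is contained in a $\delta$-neighbourhood of the other two sides; $X$ is not assumed proper or locally compact. Its Gromov boundary $\partial X$ is the set of equivalence classes of sequences $(x_n)$ in $X$ with $(x_m\cdot x_n)_{x_0}\to\infty$ as $\min\{m,n\}\to\infty$, where $(x\cdot y)_{x_0}=\frac12(d_X(x_0,x)+d_X(x_0,y)-d_X(x,y))$ and $(x_n)\sim(y_n)$ if $(x_n\cdot y_n)_{x_0}\to\infty$. The action of a group on $X$ is non-elementary if the group contains a pair of elements acting as hyperbolic (loxodromic) isometries with disjoint fixed point sets in $\partial X$. A probability measure $\mu$ on $G$ is non-elementary if the semigroup generated by its support is a non-elementary subgroup of $G$. The random walk is $w_n=g_1g_2\cdots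 g_n$, where the $g_i$ are independent elements of $G$ with distribution $\mu$. A $(Q,c)$-quasigeodesic is a (not necessarily continuous) map $\gamma:I\to X$, $I\subseteq\mathbb{R}$ connected, such that $\frac1Q|t-s|-c\le d_X(\gamma(s),\gamma(t))\le Q|t-s|+c$ for all $s,t\in I$; it is a quasigeodesic ray if $I=[0,\infty)$. $d_X(y,\gamma)$ denotes the distance from $y$ to the image of $\gamma$. *)

theory Defs
  imports "HOL-Probability.Probability" "HOL-Algebra.Group_Action"
begin

section \<open>Gromov hyperbolic spaces\<close>

definition geodesic_segment :: "'x::metric_space \<Rightarrow> 'x \<Rightarrow> 'x set \<Rightarrow> bool" where
  "geodesic_segment x y S \<longleftrightarrow>
     (\<exists>c :: real \<Rightarrow> 'x. c 0 = x \<and> c (dist x y) = y \<and>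
        (\<forall>s\<in>{0..dist x y}. \<forall>t\<in>{0..dist x y}. dist (c s) (c t) = \<bar>s - t\<bar>) \<and>
        S = c ` {0..dist x y})"

definition geodesic_space :: "'x::metric_space itself \<Rightarrow> bool" where
  "geodesic_space _ \<longleftrightarrow> (\<forall>x y :: 'x. \<exists>S. geodesic_segment x y S)"

definition in_neighbourhood :: "real \<Rightarrow> 'x::metric_space set \<Rightarrow> 'x set \<Rightarrow> bool" where
  "in_neighbourhood \<delta> A B \<longleftrightarrow> (\<forall>p\<in>A. \<exists>q\<in>B. dist p q \<le> \<delta>)"

definition slim_triangles :: "'x::metric_space itself \<Rightarrow> real \<Rightarrow> bool" where
  "slim_triangles _ \<delta> \<longleftrightarrow>
     (\<forall>(x::'x) y z A B C.
        geodesic_segment x y A \<and> geodesic_segment y z B \<and> geodesic_segment z x C \<longrightarrow>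
        in_neighbourhood \<delta> A (B \<union> C) \<and> in_neighbourhood \<delta> B (C \<union> A) \<and>
        in_neighbourhood \<delta> C (A \<union> B))"

definition gromov_hyperbolic :: "'x::metric_space itself \<Rightarrow> bool" where
  "gromov_hyperbolic T \<longleftrightarrow> geodesic_space T \<and> (\<exists>\<delta>\<ge>0. slim_triangles T \<delta>)"

section \<open>The Gromov boundary\<close>

definition gromov_product :: "'x::metric_space \<Rightarrow> 'x \<Rightarrow> 'x \<Rightarrow> real" where
  "gromov_product x0 x y = (dist x0 x + dist x0 y - dist x y) / 2"

definition gromov_sequences :: "'x::metric_space \<Rightarrow> (nat \<Rightarrow> 'x) set" where
  "gromov_sequences x0 =
     {s. \<forall>K. \<exists>N. \<forall>m n. min m n \<ge> N \<longrightarrow> gromov_product x0 (s m) (s n) \<ge> K}"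

definition gromov_equiv :: "'x::metric_space \<Rightarrow> ((nat \<Rightarrow> 'x) \<times> (nat \<Rightarrow> 'x)) set" where
  "gromov_equiv x0 =
     {(s, t). s \<in> gromov_sequences x0 \<and> t \<in> gromov_sequences x0 \<and>
        filterlim (\<lambda>n. gromov_product x0 (s n) (t n)) at_top sequentially}"

definition gromov_boundary :: "'x::metric_space \<Rightarrow> (nat \<Rightarrow> 'x) set set" where
  "gromov_boundary x0 = gromov_sequences x0 // gromov_equiv x0"

text \<open>
  A bijective isometry acts on boundary points, which are equivalence classes of sequences, by
  applying it termwise to all the sequences of the class.
\<close>

definition boundary_map :: "('x \<Rightarrow> 'x) \<Rightarrow> (nat \<Rightarrow> 'x) set \<Rightarrow> (nat \<Rightarrow> 'x) set" where
  "boundary_map f \<xi> = (\<lambda>s. f \<circ> s) ` \<xi>"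

definition boundary_fixed_points :: "'x::metric_space \<Rightarrow> ('x \<Rightarrow> 'x) \<Rightarrow> (nat \<Rightarrow> 'x) set set" where
  "boundary_fixed_points x0 f = {\<xi> \<in> gromov_boundary x0. boundary_map f \<xi> = \<xi>}"

section \<open>Non-elementary actions and measures\<close>

text \<open>
  A loxodromic isometry is one with positive translation length. For an isometry the limit
  defining the translation length exists and does not depend on the point \<open>x\<close>.
\<close>

definition loxodromic :: "('x::metric_space \<Rightarrow> 'x) \<Rightarrow> bool" where
  "loxodromic f \<longleftrightarrow>
     (\<exists>\<tau>>0. \<forall>x. (\<lambda>n. dist x ((f ^^ n) x) / real n) \<longlonglongrightarrow> \<tau>)"

definition isometric_action ::
  "('g, 'b) monoid_scheme \<Rightarrow> ('g \<Rightarrow> 'x \<Rightarrow> 'x::metric_space) \<Rightarrow> bool" where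
  "isometric_action G \<phi> \<longleftrightarrow> group_action G UNIV \<phi> \<and>
     (\<forall>g\<in>carrier G. \<forall>x y. dist (\<phi> g x) (\<phi> g y) = dist x y)"

definition non_elementary_action ::
  "('g, 'b) monoid_scheme \<Rightarrow> ('g \<Rightarrow> 'x \<Rightarrow> 'x::metric_space) \<Rightarrow> 'x \<Rightarrow> bool" where
  "non_elementary_action G \<phi> x0 \<longleftrightarrow>
     (\<exists>g\<in>carrier G. \<exists>h\<in>carrier G. loxodromic (\<phi> g) \<and> loxodromic (\<phi> h) \<and>
        boundary_fixed_points x0 (\<phi> g) \<inter> boundary_fixed_points x0 (\<phi> h) = {})"

inductive_set generated_semigroup :: "('g, 'b) monoid_scheme \<Rightarrow> 'g set \<Rightarrow> 'g set"
  for G :: "('g, 'b) monoid_scheme" and S :: "'g set" where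
  incl: "s \<in> S \<Longrightarrow> s \<in> generated_semigroup G S"
| mult: "a \<in> generated_semigroup G S \<Longrightarrow> b \<in> generated_semigroup G S \<Longrightarrow>
         a \<otimes>\<^bsub>G\<^esub> b \<in> generated_semigroup G S"

definition non_elementary_measure ::
  "('g, 'b) monoid_scheme \<Rightarrow> ('g \<Rightarrow> 'x \<Rightarrow> 'x::metric_space) \<Rightarrow> 'x \<Rightarrow> 'g pmf \<Rightarrow> bool" where
  "non_elementary_measure G \<phi> x0 \<mu> \<longleftrightarrow>
     (let \<Gamma> = generated_semigroup G (set_pmf \<mu>)
      in subgroup \<Gamma> G \<and> non_elementary_action (G\<lparr>carrier := \<Gamma>\<rparr>) \<phi> x0)"

section \<open>Random walks and quasigeodesics\<close>

text \<open>The increments are indexed from 1; the value \<open>g 0\<close> is not used.\<close>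

primrec walk :: "('g, 'b) monoid_scheme \<Rightarrow> (nat \<Rightarrow> 'g) \<Rightarrow> nat \<Rightarrow> 'g" where
  "walk G g 0 = \<one>\<^bsub>G\<^esub>"
| "walk G g (Suc n) = walk G g n \<otimes>\<^bsub>G\<^esub> g (Suc n)"

text \<open>
  The bounds \<open>Q \<ge> 1\<close> and \<open>c \<ge> 0\<close> are needed: since \<open>1 / 0 = 0\<close>, without them every bounded map
  would be a quasigeodesic with \<open>Q = 0\<close>.
\<close>

definition quasigeodesic :: "real \<Rightarrow> real \<Rightarrow> real set \<Rightarrow> (real \<Rightarrow> 'x::metric_space) \<Rightarrow> bool" where
  "quasigeodesic Q c I \<gamma> \<longleftrightarrow> Q \<ge> 1 \<and> c \<ge> 0 \<and> connected I \<and>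
     (\<forall>s\<in>I. \<forall>t\<in>I. 1 / Q * \<bar>t - s\<bar> - c \<le> dist (\<gamma> s) (\<gamma> t) \<and>
                     dist (\<gamma> s) (\<gamma> t) \<le> Q * \<bar>t - s\<bar> + c)"

definition quasigeodesic_ray :: "(real \<Rightarrow> 'x::metric_space) \<Rightarrow> bool" where
  "quasigeodesic_ray \<gamma> \<longleftrightarrow> (\<exists>Q c. quasigeodesic Q c {0..} \<gamma>)"

end

theory Submission imports Defs
begin

text \<open>
  The core is an exponential escape estimate that needs no moment assumption. For points
  \<open>y\<^sub>i\<close> let the energy be the sum of \<open>exp (- d(y\<^sub>i, y\<^sub>j))\<close> over all pairs; it is invariant under
  isometries. Although the kernel need not be positive definite, hyperbolicity yields a
  Cauchy-Schwarz inequality up to a constant. The ping-pong estimate that bounds the norm of the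
  average of \<open>M\<close> free generators on \<open>l\<^sup>2\<close> by \<open>2 / sqrt M\<close> then shows that averaging over a large
  Schottky family at least halves the square root of the energy. The remaining steps of the
  walk, being isometries, do not change it. Since a convolution power of \<open>\<mu>\<close> charges a Schottky family, the
  probability that \<open>d(x\<^sub>0, w\<^sub>n x\<^sub>0) \<le> R\<close> is at most \<open>C exp (R - b n)\<close>.

  By Borel-Cantelli, almost surely \<open>d(w\<^sub>i x\<^sub>0, w\<^sub>j x\<^sub>0) \<ge> c (j - i)\<close> as soon as
  \<open>j - i \<ge> K ln j\<close> and \<open>j\<close> is large. If \<open>w\<^sub>n x\<^sub>0\<close> were far from the geodesic joining \<open>x\<^sub>0\<close> to
  \<open>w\<^sub>m x\<^sub>0\<close>, then the path, which stays logarithmically close (up to the length of its jumps) to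
  the geodesics from \<open>w\<^sub>n x\<^sub>0\<close> to its two ends, would contain points \<open>w\<^sub>i x\<^sub>0\<close> and
  \<open>w\<^sub>j x\<^sub>0\<close> close to each other with \<open>i < n \<le> j\<close> and \<open>j - i\<close> large. With finite first moment, a
  strong law of large numbers makes the jumps and the increments over short windows sublinear.
\<close>

section \<open>Hyperbolic spaces\<close>

text \<open>The action need not be proper, so orbit points may accumulate and a norm on
  \<open>l\<^sup>2\<close> of the group would not see distances in the space. The kernel exp(-d)
  sees them at unit scale, and a small energy still limits how many points lie in a ball.
  Hyperbolicity alone bounds the energy of \<open>M\<close> translated copies of a family only by a
  constant times M^2; the Schottky family is taken large and long enough to reach (M/2)^2, so that
  the square root, divided by the number of copies, is halved. The induction follows whole families
  of starting points because such a step turns one family into \<open>M\<close> copies of it. It is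
  uniform in the family because the increments outside the Schottky family are controlled only
  through isometry invariance. In the escape estimate the exponent R - b n is linear in both
  variables, so the failure probability of a window of length K ln j is a negative power of j; this
  is why logarithmic windows suffice.\<close>

lemma gromov_product_commute: "gromov_product w x y = gromov_product w y x"
  by (simp add: gromov_product_def dist_commute)

lemma gromov_product_nonneg: "0 \<le> gromov_product w x y"
  unfolding gromov_product_def using dist_triangle[of x y w] by (simp add: dist_commute)

lemma gromov_product_le: "gromov_product w x y \<le> dist w x" "gromov_product w x y \<le> dist w y"
  unfolding gromov_product_def
  using dist_triangle[of w y x] dist_triangle[of w x y] by (simp_all add: dist_commute)

lemma gromov_product_ge_diff: "dist w x - dist x y \<le> gromov_product w x y"
  unfolding gromov_product_def using dist_triangle[of w x y] by (simp add: dist_commute)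

lemma gromov_product_base_change: "gromov_product w x y \<le> gromov_product v x y + dist w v"
  unfolding gromov_product_def
  using dist_triangle[of w x v] dist_triangle[of w y v] by (simp add: dist_commute field_simps)

lemma gromov_product_rotate: "gromov_product v w y = dist w v - gromov_product w v y"
  unfolding gromov_product_def by (simp add: dist_commute field_simps)

lemma geodesic_segment_parametrization:
  assumes "geodesic_segment x y S"
  obtains c where "c 0 = x" "c (dist x y) = y" "S = c ` {0..dist x y}"
    "\<forall>s\<in>{0..dist x y}. \<forall>t\<in>{0..dist x y}. dist (c s) (c t) = \<bar>s - t\<bar>"
    "continuous_on {0..dist x y} c"
proof -
  from assms obtain c where c: "c 0 = x" "c (dist x y) = y" "S = c ` {0..dist x y}"
    "\<forall>s\<in>{0..dist x y}. \<forall>t\<in>{0..dist x y}. dist (c s) (c t) = \<bar>s - t\<bar>"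
    unfolding geodesic_segment_def by blast
  have "continuous_on {0..dist x y} c"
    unfolding continuous_on_iff using c(4) by (metis dist_real_def)
  with c show ?thesis using that by blast
qed

lemma geodesic_segment_between:
  assumes "geodesic_segment x y S" "p \<in> S"
  shows "dist x p + dist p y = dist x y"
proof -
  obtain c where c: "c 0 = x" "c (dist x y) = y" "S = c ` {0..dist x y}"
    "\<forall>s\<in>{0..dist x y}. \<forall>t\<in>{0..dist x y}. dist (c s) (c t) = \<bar>s - t\<bar>"
    "continuous_on {0..dist x y} c"
    by (rule geodesic_segment_parametrization[OF assms(1)])
  obtain t where t: "t \<in> {0..dist x y}" "p = c t" using assms(2) c(3) by blast
  have "dist x p = t" using c(4)[rule_format, of 0 t] t c(1) by auto
  moreover have "dist p y = dist x y - t" using c(4)[rule_format, of t "dist x y"] t c(2) by auto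
  ultimately show ?thesis by simp
qed

lemma compact_geodesic_segment:
  assumes "geodesic_segment x y S" shows "compact S"
proof -
  obtain c where c: "S = c ` {0..dist x y}" "continuous_on {0..dist x y} c"
    by (rule geodesic_segment_parametrization[OF assms])
  then show ?thesis using compact_continuous_image[OF c(2) compact_Icc] by simp
qed

lemma geodesic_segment_ends:
  assumes "geodesic_segment x y S" shows "x \<in> S" "y \<in> S"
proof -
  obtain c where c: "c 0 = x" "c (dist x y) = y" "S = c ` {0..dist x y}"
    by (rule geodesic_segment_parametrization[OF assms])
  have "c 0 \<in> S" "c (dist x y) \<in> S" unfolding c(3) by (simp_all del: c)
  then show "x \<in> S" "y \<in> S" using c by simp_all
qed

text \<open>The points of \<open>A\<close> within \<open>\<delta>\<close> of \<open>B\<close> and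
  those within \<open>\<delta>\<close> of \<open>C\<close> form two nonempty closed sets covering
  \<open>A\<close>; as \<open>A\<close> is connected, they intersect.\<close>

lemma slim_connecting_point:
  fixes w x y :: "'x::metric_space"
  assumes slim: "slim_triangles TYPE('x) \<delta>"
    and A: "geodesic_segment x y A" and B: "geodesic_segment y w B" and C: "geodesic_segment w x C"
  obtains p q r where "p \<in> A" "q \<in> B" "r \<in> C" "dist p q \<le> \<delta>" "dist p r \<le> \<delta>"
proof -
  have nb: "in_neighbourhood \<delta> A (B \<union> C)"
    using slim A B C unfolding slim_triangles_def by blast
  obtain c where c: "c 0 = x" "c (dist x y) = y" "A = c ` {0..dist x y}" "continuous_on {0..dist x y} c"
    by (rule geodesic_segment_parametrization[OF A])
  have conn: "connected A"
    unfolding c(3) by (intro connected_continuous_image c connected_Icc)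
  \<comment> \<open>Phrased with \<open>infdist\<close>, the neighbourhoods are closed at once;
    compactness of the sides turns the infimum back into an actual point
    (\<open>attained\<close>).\<close>
  define near where "near S = {p. infdist p S \<le> \<delta>}" for S :: "'x set"
  have closed: "closed (near S)" for S
    unfolding near_def by (intro closed_Collect_le continuous_intros)
  have attained: "\<exists>q\<in>S. dist p q \<le> \<delta>" if S: "p \<in> near S" "compact S" "S \<noteq> {}" for p S
  proof -
    have "continuous_on S (dist p)" by (intro continuous_intros)
    then obtain q where q: "q \<in> S" "\<And>r. r \<in> S \<Longrightarrow> dist p q \<le> dist p r"
      using continuous_attains_inf[OF S(2,3)] by blast
    have "dist p q \<le> infdist p S"
      unfolding infdist_notempty[OF S(3)] by (intro cINF_greatest S q)
    then show ?thesis using q S unfolding near_def by (intro bexI[of _ q]) auto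
  qed
  have near: "p \<in> near S" if "q \<in> S" "dist p q \<le> \<delta>" for p q S
    using infdist_le2[OF that] unfolding near_def by simp
  have delta: "0 \<le> \<delta>"
    using nb geodesic_segment_ends[OF A] unfolding in_neighbourhood_def
    by (meson zero_le_dist order_trans)
  have "A \<inter> near B \<inter> near C \<noteq> {}"
  proof
    assume e: "A \<inter> near B \<inter> near C = {}"
    have "A \<subseteq> near B \<union> near C"
      using nb near unfolding in_neighbourhood_def by blast
    moreover have "near B \<inter> A \<noteq> {}"
      using near[of y B y] geodesic_segment_ends[OF A] geodesic_segment_ends[OF B] delta by auto
    moreover have "near C \<inter> A \<noteq> {}"
      using near[of x C x] geodesic_segment_ends[OF A] geodesic_segment_ends[OF C] delta by auto
    ultimately show False
      using connected_closedD[OF conn _ _ closed closed, of B C] e by blast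
  qed
  then obtain p where p: "p \<in> A" "p \<in> near B" "p \<in> near C" by blast
  with attained[OF p(2) compact_geodesic_segment[OF B]] attained[OF p(3) compact_geodesic_segment[OF C]]
    geodesic_segment_ends[OF B] geodesic_segment_ends[OF C] that show ?thesis
    by blast
qed

lemma gromov_product_le_dist_segment:
  assumes "geodesic_segment x y S" "p \<in> S"
  shows "gromov_product w x y \<le> dist w p"
  using geodesic_segment_between[OF assms] dist_triangle[of w x p] dist_triangle[of w y p]
  unfolding gromov_product_def by (simp add: dist_commute)

text \<open>Both sides at \<open>w\<close> pass within \<open>\<delta>\<close> of the connecting
  point \<open>p\<close>. Adding the two resulting bounds on d(w, p) costs 2
  \<open>\<delta>\<close>, comparing d(x, p) and d(p, y) with the remaining pieces of these sides
  another 2 \<open>\<delta>\<close>, and the sum is halved.\<close>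

lemma dist_segment_le_gromov_product:
  fixes w x y :: "'x::metric_space"
  assumes geo: "geodesic_space TYPE('x)" and slim: "slim_triangles TYPE('x) \<delta>"
    and S: "geodesic_segment x y S"
  obtains p where "p \<in> S" "dist w p \<le> gromov_product w x y + 2 * \<delta>"
proof -
  obtain B where B: "geodesic_segment y w B" using geo unfolding geodesic_space_def by blast
  obtain C where C: "geodesic_segment w x C" using geo unfolding geodesic_space_def by blast
  obtain p q r where p: "p \<in> S" "q \<in> B" "r \<in> C" "dist p q \<le> \<delta>" "dist p r \<le> \<delta>"
    using slim_connecting_point[OF slim S B C] by metis
  have "dist y q + dist q w = dist y w" "dist w r + dist r x = dist w x" "dist x p + dist p y = dist x y"
    using geodesic_segment_between B C S p by blast+
  moreover have "dist w p \<le> dist w q + dist p q" "dist w p \<le> dist w r + dist p r"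
    "dist p y \<le> dist y q + dist p q" "dist x p \<le> dist r x + dist p r"
    using dist_triangle[of w p q] dist_triangle[of w p r] dist_triangle[of p y q] dist_triangle[of x p r]
    by (simp_all add: dist_commute)
  ultimately have "dist w p \<le> gromov_product w x y + 2 * \<delta>"
    using p unfolding gromov_product_def by (simp add: dist_commute field_simps)
  with p that show ?thesis by blast
qed

text \<open>
  The basepoint \<open>x0\<close> is only a parameter: the four-point inequality is assumed at every basepoint.
\<close>

locale hyperbolic_space =
  fixes D :: real and x0 :: "'x::metric_space"
  assumes D_nonneg: "0 \<le> D"
    and four_point: "\<And>w x y z :: 'x.
      min (gromov_product w x y) (gromov_product w y z) - D \<le> gromov_product w x z"
    and point_between: "\<And>(x::'x) y t. 0 \<le> t \<Longrightarrow> t \<le> dist x y \<Longrightarrow>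
      \<exists>p. dist x p = t \<and> dist p y = dist x y - t"

text \<open>Some point of the side from \<open>z\<close> to \<open>x\<close> realises the product at
  \<open>w\<close> up to 2 \<open>\<delta>\<close>. It is \<open>\<delta>\<close>-close to one of
  the other sides, all of whose points are at least as far from \<open>w\<close> as the
  corresponding product; hence 3 \<open>\<delta>\<close>.\<close>

lemma gromov_hyperbolic_imp_hyperbolic_space:
  assumes "gromov_hyperbolic TYPE('x::metric_space)"
  obtains D where "hyperbolic_space TYPE('x) D"
proof -
  obtain \<delta> where d: "\<delta> \<ge> 0" and geo: "geodesic_space TYPE('x)" and slim: "slim_triangles TYPE('x) \<delta>"
    using assms unfolding gromov_hyperbolic_def by blast
  have "hyperbolic_space TYPE('x) (3 * \<delta>)"
  proof
    fix w x y z :: 'x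
    obtain A where A: "geodesic_segment x y A" using geo unfolding geodesic_space_def by blast
    obtain B where B: "geodesic_segment y z B" using geo unfolding geodesic_space_def by blast
    obtain C where C: "geodesic_segment z x C" using geo unfolding geodesic_space_def by blast
    obtain p where p: "p \<in> C" "dist w p \<le> gromov_product w z x + 2 * \<delta>"
      using dist_segment_le_gromov_product[OF geo slim C] by metis
    have "in_neighbourhood \<delta> C (A \<union> B)"
      using slim A B C unfolding slim_triangles_def by blast
    then obtain q where q: "q \<in> A \<union> B" "dist p q \<le> \<delta>" using p unfolding in_neighbourhood_def by blast
    have "min (gromov_product w x y) (gromov_product w y z) \<le> dist w q"
      using q gromov_product_le_dist_segment[OF A, of q w] gromov_product_le_dist_segment[OF B, of q w]
      by auto
    then show "min (gromov_product w x y) (gromov_product w y z) - 3 * \<delta> \<le> gromov_product w x z"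
      using p q dist_triangle[of w q p] by (simp add: gromov_product_commute)
  next
    fix x y :: 'x and t :: real
    assume t: "0 \<le> t" "t \<le> dist x y"
    obtain A where A: "geodesic_segment x y A" using geo unfolding geodesic_space_def by blast
    obtain c where c: "c 0 = x" "c (dist x y) = y" "A = c ` {0..dist x y}"
      "\<forall>s\<in>{0..dist x y}. \<forall>t\<in>{0..dist x y}. dist (c s) (c t) = \<bar>s - t\<bar>"
      "continuous_on {0..dist x y} c"
      by (rule geodesic_segment_parametrization[OF A])
    show "\<exists>p. dist x p = t \<and> dist p y = dist x y - t"
      using c(4)[rule_format, of 0 t] c(4)[rule_format, of t "dist x y"] c(1,2) t by (intro exI[of _ "c t"]) auto
  qed (use d in simp)
  with that show ?thesis by blast
qed

context hyperbolic_space
begin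

lemma four_point2:
  fixes w x y z u :: 'x
  shows "min (gromov_product w x y) (min (gromov_product w y z) (gromov_product w z u)) - 2 * D
    \<le> gromov_product w x u"
  using four_point[of w x y u] four_point[of w y z u] D_nonneg by linarith

text \<open>Bisecting the chain applies the four-point inequality once per level, so 2^k links lose
  k D rather than a multiple of 2^k. This is one source of the logarithm in the tracking
  estimate.\<close>

lemma chain_gromov_product:
  fixes x :: "nat \<Rightarrow> 'x"
  assumes "m < n" "n - m \<le> 2 ^ k"
  shows "\<exists>i\<in>{m..<n}. gromov_product w (x i) (x (Suc i)) - real k * D \<le> gromov_product w (x m) (x n)"
  using assms
proof (induction k arbitrary: m n)
  case 0
  then have "n = Suc m" by simp
  then show ?case by auto
next
  case (Suc k)
  show ?case
  proof (cases "n - m = 1")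
    case True
    with Suc.prems have "n = Suc m" by simp
    then show ?thesis using D_nonneg by (intro bexI[of _ m]) auto
  next
    case False
    define l where "l = m + (n - m) div 2"
    have l: "m < l" "l < n" "l - m \<le> 2 ^ k" "n - l \<le> 2 ^ k"
      using False Suc.prems unfolding l_def by auto
    obtain i where i: "i \<in> {m..<l}" "gromov_product w (x i) (x (Suc i)) - real k * D \<le> gromov_product w (x m) (x l)"
      using Suc.IH[OF l(1,3)] by blast
    obtain j where j: "j \<in> {l..<n}" "gromov_product w (x j) (x (Suc j)) - real k * D \<le> gromov_product w (x l) (x n)"
      using Suc.IH[OF l(2,4)] by blast
    have "min (gromov_product w (x m) (x l)) (gromov_product w (x l) (x n)) - D \<le> gromov_product w (x m) (x n)"
      by (rule four_point)
    then show ?thesis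
    proof (cases "gromov_product w (x m) (x l) \<le> gromov_product w (x l) (x n)")
      case True
      then show ?thesis using i l four_point[of w "x m" "x l" "x n"]
        by (intro bexI[of _ i]) (auto simp: algebra_simps)
    next
      case False
      then show ?thesis using j l four_point[of w "x m" "x l" "x n"]
        by (intro bexI[of _ j]) (auto simp: algebra_simps)
    qed
  qed
qed

end

section \<open>Loxodromic isometries\<close>

context hyperbolic_space
begin

abbreviation gp :: "'x \<Rightarrow> 'x \<Rightarrow> real" where "gp \<equiv> gromov_product x0"

lemma gp_four_point: "min (gp x y) (gp y z) - D \<le> gp x z"
  by (rule four_point)

lemma gp_four_point2: "min (gp x y) (min (gp y z) (gp z u)) - 2 * D \<le> gp x u"
  by (rule four_point2)

text \<open>
  For \<open>m \<le> (1 + \<theta>) n\<close> the product of the \<open>n\<close>-th and \<open>m\<close>-th orbit point is at least \<open>n \<tau> / 2\<close>. A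
  geometric chain of such indices loses a constant at each link while the bound grows geometrically.
\<close>

lemma orbit_gromov_product:
  fixes s :: "nat \<Rightarrow> 'x" and a :: "nat \<Rightarrow> real"
  assumes s0: "s 0 = x0" and a: "\<And>m n. m \<le> n \<Longrightarrow> dist (s m) (s n) = a (n - m)"
    and \<tau>: "0 < \<tau>" and lower: "\<And>n. real n * \<tau> \<le> a n"
  obtains n0 where "\<And>n m. n0 \<le> n \<Longrightarrow> n \<le> m \<Longrightarrow> real n * \<tau> / 2 - D \<le> gp (s n) (s m)"
proof -
  have upper: "a n \<le> real n * a 1" for n
  proof (induction n)
    case 0
    then show ?case using a[of 0 0] by simp
  next
    case (Suc n)
    have "a (Suc n) = dist (s 0) (s (Suc n))" using a[of 0 "Suc n"] by simp
    also have "\<dots> \<le> dist (s 0) (s n) + dist (s n) (s (Suc n))" by (rule dist_triangle)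
    also have "\<dots> = a n + a 1" using a[of 0 n] a[of n "Suc n"] by simp
    finally show ?case using Suc by (simp add: algebra_simps)
  qed
  have a1: "\<tau> \<le> a 1" using lower[of 1] by simp
  \<comment> \<open>With this choice the step from \<open>n\<close> to at most (1 +
    \<open>\<theta>\<close>) n covers at most half of the distance n \<open>\<tau>\<close> that is
    guaranteed at time \<open>n\<close>.\<close>
  define \<theta> where "\<theta> = \<tau> / (2 * a 1)"
  have \<theta>: "0 < \<theta>" "\<theta> * a 1 = \<tau> / 2" using \<tau> a1 unfolding \<theta>_def by auto
  have gp_eq: "gp (s n) (s m) = (a n + a m - a (m - n)) / 2" if "n \<le> m" for n m
    using a[of 0 n] a[of 0 m] a[OF that] s0 unfolding gromov_product_def by simp
  have near: "real n * \<tau> / 2 \<le> gp (s n) (s m)" if "n \<le> m" "real m \<le> (1 + \<theta>) * real n" for n m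
  proof -
    have "a (m - n) \<le> real (m - n) * a 1" by (rule upper)
    also have "\<dots> \<le> (\<theta> * real n) * a 1"
      using that a1 \<tau> by (intro mult_right_mono) (auto simp: algebra_simps of_nat_diff)
    also have "\<dots> = real n * (\<theta> * a 1)" by simp
    also have "\<dots> = real n * \<tau> / 2" unfolding \<theta>(2) by simp
    finally have "a (m - n) \<le> real n * \<tau> / 2" .
    moreover have "real n * \<tau> \<le> real m * \<tau>" using that \<tau> by (intro mult_right_mono) auto
    moreover have "0 \<le> real n * \<tau>" using \<tau> by simp
    ultimately show ?thesis
      using lower[of n] lower[of m] unfolding gp_eq[OF that(1)]
      by (simp add: field_simps del: of_nat_diff)
  qed
  \<comment> \<open>From \<open>n0\<close> on, one link gains at least 1 + 2 D /
    \<open>\<tau>\<close> indices after rounding: the 1 gives strict progress, the rest raises n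
    \<open>\<tau>\<close> / 2 by \<open>D\<close> and so pays for the four-point inequality.\<close>
  define n0 where "n0 = nat \<lceil>(2 + 2 * D / \<tau>) / \<theta>\<rceil>"
  have main: "real n * \<tau> / 2 - D \<le> gp (s n) (s m)" if "n0 \<le> n" "n \<le> m" for n m
    using that
  proof (induction "m - n" arbitrary: n rule: less_induct)
    case less
    show ?case
    proof (cases "real m \<le> (1 + \<theta>) * real n")
      case True
      then show ?thesis using near[of n m] less.prems D_nonneg by linarith
    next
      case False
      define n' where "n' = nat \<lfloor>(1 + \<theta>) * real n\<rfloor>"
      have "(2 + 2 * D / \<tau>) / \<theta> \<le> real n"
        using less.prems(1) unfolding n0_def by linarith
      then have big: "2 + 2 * D / \<tau> \<le> \<theta> * real n" using \<theta> by (simp add: field_simps)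
      have "0 \<le> (1 + \<theta>) * real n" using \<theta> by simp
      then have n': "real n' \<le> (1 + \<theta>) * real n" "(1 + \<theta>) * real n - 1 < real n'"
        unfolding n'_def by linarith+
      have step: "real n + 1 + 2 * D / \<tau> \<le> real n'"
        using n'(2) big by (simp add: algebra_simps)
      moreover have "0 \<le> 2 * D / \<tau>" using D_nonneg \<tau> by simp
      ultimately have "n < n'" by linarith
      moreover have "n' \<le> m" using False n' by linarith
      ultimately have IH: "real n' * \<tau> / 2 - D \<le> gp (s n') (s m)"
        using less.prems by (intro less.hyps) auto
      have "(real n + 2 * D / \<tau>) * \<tau> \<le> real n' * \<tau>"
        using step \<tau> by (intro mult_right_mono) auto
      moreover have "(real n + 2 * D / \<tau>) * \<tau> = real n * \<tau> + 2 * D"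
        using \<tau> by (simp add: distrib_right)
      ultimately have "real n * \<tau> / 2 \<le> real n' * \<tau> / 2 - D" by simp
      moreover have "real n * \<tau> / 2 \<le> gp (s n) (s n')"
        using near[of n n'] \<open>n < n'\<close> n' by simp
      ultimately show ?thesis using IH gp_four_point[of "s n" "s n'" "s m"] by linarith
    qed
  qed
  show ?thesis using that main by blast
qed

lemma orbit_gromov_sequence:
  fixes s :: "nat \<Rightarrow> 'x" and a :: "nat \<Rightarrow> real"
  assumes s0: "s 0 = x0" and a: "\<And>m n. m \<le> n \<Longrightarrow> dist (s m) (s n) = a (n - m)"
    and \<tau>: "0 < \<tau>" and lower: "\<And>n. real n * \<tau> \<le> a n"
  shows "s \<in> gromov_sequences x0"
proof -
  obtain n0 where n0: "\<And>n m. n0 \<le> n \<Longrightarrow> n \<le> m \<Longrightarrow> real n * \<tau> / 2 - D \<le> gp (s n) (s m)"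
    using orbit_gromov_product[OF assms] by blast
  have "\<exists>N. \<forall>m n. min m n \<ge> N \<longrightarrow> gp (s m) (s n) \<ge> K" for K
  proof (intro exI allI impI)
    fix m n assume mn: "min m n \<ge> max n0 (nat \<lceil>2 * (K + D) / \<tau>\<rceil>)"
    define l where "l = min m n"
    have "2 * (K + D) / \<tau> \<le> real l" "n0 \<le> l" using mn unfolding l_def by linarith+
    then have "K \<le> real l * \<tau> / 2 - D" using \<tau> by (simp add: field_simps)
    also have "\<dots> \<le> gp (s (min m n)) (s (max m n))"
      using \<open>n0 \<le> l\<close> unfolding l_def by (intro n0) auto
    also have "\<dots> = gp (s m) (s n)"
      by (cases "m \<le> n") (auto simp: min_def max_def gromov_product_commute)
    finally show "gp (s m) (s n) \<ge> K" .
  qed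
  then show ?thesis unfolding gromov_sequences_def by blast
qed

section \<open>Equivalence of Gromov sequences and the action of isometries on them\<close>

lemma gromov_equiv_sym: "(s, t) \<in> gromov_equiv x0 \<Longrightarrow> (t, s) \<in> gromov_equiv x0"
  unfolding gromov_equiv_def by (simp add: gromov_product_commute)

lemma gromov_equiv_trans:
  assumes "(s, t) \<in> gromov_equiv x0" "(t, u) \<in> gromov_equiv x0"
  shows "(s, u) \<in> gromov_equiv x0"
proof -
  have "filterlim (\<lambda>n. gp (s n) (u n)) at_top sequentially"
    unfolding filterlim_at_top
  proof
    fix Z :: real
    have "\<forall>\<^sub>F n in sequentially. Z + D \<le> gp (s n) (t n)" "\<forall>\<^sub>F n in sequentially. Z + D \<le> gp (t n) (u n)"
      using assms unfolding gromov_equiv_def filterlim_at_top by blast+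
    then show "\<forall>\<^sub>F n in sequentially. Z \<le> gp (s n) (u n)"
    proof eventually_elim
      case (elim n)
      then show ?case using gp_four_point[of "s n" "t n" "u n"] by linarith
    qed
  qed
  then show ?thesis using assms unfolding gromov_equiv_def by blast
qed

text \<open>Inequivalent Gromov sequences have bounded products over all pairs of indices, not only
  along the diagonal: a single large product between far members spreads to the tails, since far
  members of one sequence have large products with each other.\<close>

lemma gromov_equiv_if_unbounded:
  assumes s: "s \<in> gromov_sequences x0" and t: "t \<in> gromov_sequences x0"
    and unb: "\<And>K. \<exists>m n. K < gp (s m) (t n)"
  shows "(s, t) \<in> gromov_equiv x0"
proof -
  have "filterlim (\<lambda>n. gp (s n) (t n)) at_top sequentially"
    unfolding filterlim_at_top eventually_sequentially
  proof
    fix Z :: real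
    obtain N1 where N1: "\<And>m n. min m n \<ge> N1 \<Longrightarrow> gp (s m) (s n) \<ge> Z + 2 * D"
      using s unfolding gromov_sequences_def by blast
    obtain N2 where N2: "\<And>m n. min m n \<ge> N2 \<Longrightarrow> gp (t m) (t n) \<ge> Z + 2 * D"
      using t unfolding gromov_sequences_def by blast
    \<comment> \<open>A product is at most the distance of either point from \<open>x0\<close>, so
      exceeding this maximum forces both indices past \<open>N1\<close> and
      \<open>N2\<close>.\<close>
    define K where "K = Max ((\<lambda>m. dist x0 (s m)) ` {..N1} \<union> (\<lambda>n. dist x0 (t n)) ` {..N2} \<union> {Z + 2 * D})"
    have K: "dist x0 (s m) \<le> K" if "m \<le> N1" for m
      unfolding K_def using that by (intro Max_ge) auto
    have K': "dist x0 (t m) \<le> K" if "m \<le> N2" for m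
      unfolding K_def using that by (intro Max_ge) auto
    have K'': "Z + 2 * D \<le> K"
      unfolding K_def by (intro Max_ge) auto
    obtain m n where mn: "K < gp (s m) (t n)" using unb by blast
    have "m > N1" using K[of m] mn gromov_product_le(1)[of x0 "s m" "t n"] by (meson not_le order_trans)
    have "n > N2" using K'[of n] mn gromov_product_le(2)[of x0 "s m" "t n"] by (meson not_le order_trans)
    show "\<exists>N. \<forall>k\<ge>N. Z \<le> gp (s k) (t k)"
    proof (intro exI allI impI)
      fix k assume "k \<ge> max N1 N2"
      then have "Z + 2 * D \<le> gp (s k) (s m)" "Z + 2 * D \<le> gp (t n) (t k)"
        using N1[of k m] N2[of n k] \<open>m > N1\<close> \<open>n > N2\<close> by auto
      then show "Z \<le> gp (s k) (t k)"
        using gp_four_point2[of "s k" "s m" "t n" "t k"] mn K'' by linarith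
    qed
  qed
  then show ?thesis using s t unfolding gromov_equiv_def by blast
qed

lemma isometry_gromov_product:
  fixes f :: "'x \<Rightarrow> 'x"
  assumes "\<And>x y. dist (f x) (f y) = dist x y"
  shows "gp x y - dist x0 (f x0) \<le> gp (f x) (f y)"
proof -
  have "gp x y = gromov_product (f x0) (f x) (f y)"
    using assms unfolding gromov_product_def by simp
  also have "\<dots> \<le> gp (f x) (f y) + dist x0 (f x0)"
    using gromov_product_base_change[of "f x0" "f x" "f y" x0] by (simp add: dist_commute)
  finally show ?thesis by simp
qed

lemma isometry_gromov_sequences:
  fixes f :: "'x \<Rightarrow> 'x"
  assumes "\<And>x y. dist (f x) (f y) = dist x y" and "s \<in> gromov_sequences x0"
  shows "f \<circ> s \<in> gromov_sequences x0"
proof -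
  have "\<exists>N. \<forall>m n. min m n \<ge> N \<longrightarrow> gp ((f \<circ> s) m) ((f \<circ> s) n) \<ge> K" for K
  proof -
    obtain N where N: "\<And>m n. min m n \<ge> N \<Longrightarrow> gp (s m) (s n) \<ge> K + dist x0 (f x0)"
      using assms(2) unfolding gromov_sequences_def by blast
    have "gp ((f \<circ> s) m) ((f \<circ> s) n) \<ge> K" if "min m n \<ge> N" for m n
      using N[OF that] isometry_gromov_product[of f "s m" "s n", OF assms(1)] by simp
    then show ?thesis by blast
  qed
  then show ?thesis unfolding gromov_sequences_def by blast
qed

lemma isometry_gromov_equiv:
  fixes f :: "'x \<Rightarrow> 'x"
  assumes iso: "\<And>x y. dist (f x) (f y) = dist x y" and st: "(s, t) \<in> gromov_equiv x0"
  shows "(f \<circ> s, f \<circ> t) \<in> gromov_equiv x0"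
proof -
  have "filterlim (\<lambda>n. gp ((f \<circ> s) n) ((f \<circ> t) n)) at_top sequentially"
    unfolding filterlim_at_top
  proof
    fix Z :: real
    have "\<forall>\<^sub>F n in sequentially. Z + dist x0 (f x0) \<le> gp (s n) (t n)"
      using st unfolding gromov_equiv_def filterlim_at_top by blast
    then show "\<forall>\<^sub>F n in sequentially. Z \<le> gp ((f \<circ> s) n) ((f \<circ> t) n)"
    proof eventually_elim
      case (elim n)
      then show ?case using isometry_gromov_product[of f "s n" "t n", OF iso] by simp
    qed
  qed
  then show ?thesis
    using st isometry_gromov_sequences[OF iso] unfolding gromov_equiv_def by blast
qed

text \<open>\<open>boundary_map\<close> is the literal image of a class, so two inclusions are
  required; the inverse \<open>f'\<close>, again an isometry, supplies the preimages.\<close>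

lemma boundary_fixed_point_if_equiv:
  fixes f f' :: "'x \<Rightarrow> 'x"
  assumes iso: "\<And>x y. dist (f x) (f y) = dist x y" and inv: "\<And>x. f (f' x) = x"
    and s: "s \<in> gromov_sequences x0" and fs: "(f \<circ> s, s) \<in> gromov_equiv x0"
  shows "gromov_equiv x0 `` {s} \<in> boundary_fixed_points x0 f"
proof -
  have inv': "f' (f x) = x" for x
    using iso[of "f' (f x)" x] inv[of "f x"] by simp
  have iso': "dist (f' x) (f' y) = dist x y" for x y
    using iso[of "f' x" "f' y"] inv by simp
  have f's: "(s, f' \<circ> s) \<in> gromov_equiv x0"
    using isometry_gromov_equiv[OF iso' fs] inv' by (simp add: comp_def)
  have "boundary_map f (gromov_equiv x0 `` {s}) = gromov_equiv x0 `` {s}"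
  proof (intro equalityI subsetI)
    fix t assume "t \<in> boundary_map f (gromov_equiv x0 `` {s})"
    then obtain r where "(s, r) \<in> gromov_equiv x0" "t = f \<circ> r"
      unfolding boundary_map_def by blast
    then show "t \<in> gromov_equiv x0 `` {s}"
      using gromov_equiv_trans[OF gromov_equiv_sym[OF fs] isometry_gromov_equiv[OF iso]] by blast
  next
    fix t assume "t \<in> gromov_equiv x0 `` {s}"
    then have "(s, f' \<circ> t) \<in> gromov_equiv x0"
      using gromov_equiv_trans[OF f's isometry_gromov_equiv[OF iso']] by blast
    moreover have "t = f \<circ> (f' \<circ> t)" using inv by (simp add: fun_eq_iff)
    ultimately show "t \<in> boundary_map f (gromov_equiv x0 `` {s})"
      unfolding boundary_map_def by blast
  qed
  then show ?thesis
    using s unfolding boundary_fixed_points_def gromov_boundary_def by (auto intro: quotientI)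
qed

lemma gromov_equiv_if_bounded_dist:
  assumes s: "s \<in> gromov_sequences x0" and t: "t \<in> gromov_sequences x0"
    and bd: "\<And>n. dist (s n) (t n) \<le> C"
  shows "(s, t) \<in> gromov_equiv x0"
proof -
  have "filterlim (\<lambda>n. gp (s n) (t n)) at_top sequentially"
    unfolding filterlim_at_top eventually_sequentially
  proof
    fix Z :: real
    obtain N where N: "\<And>m n. min m n \<ge> N \<Longrightarrow> gp (s m) (s n) \<ge> Z + C"
      using s unfolding gromov_sequences_def by blast
    have "Z \<le> gp (s n) (t n)" if "n \<ge> N" for n
      using N[of n n] that bd[of n] gromov_product_ge_diff[of x0 "s n" "t n"]
        gromov_product_le(1)[of x0 "s n" "s n"] by simp
    then show "\<exists>N. \<forall>n\<ge>N. Z \<le> gp (s n) (t n)" by blast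
  qed
  then show ?thesis using s t unfolding gromov_equiv_def by blast
qed

end

text \<open>Displacement is subadditive in the exponent, so along the multiples of \<open>n\<close>
  the averages never exceed the one at \<open>n\<close>, while they converge to
  \<open>\<tau>\<close>.\<close>

lemma translation_length_le:
  fixes f :: "'x::metric_space \<Rightarrow> 'x"
  assumes iso: "\<And>x y. dist (f x) (f y) = dist x y"
    and lim: "(\<lambda>n. dist x ((f ^^ n) x) / real n) \<longlonglongrightarrow> \<tau>"
  shows "real n * \<tau> \<le> dist x ((f ^^ n) x)"
proof (cases "n = 0")
  case False
  have iso_pow: "dist ((f ^^ k) y) ((f ^^ k) z) = dist y z" for k y z
    by (induction k) (auto simp: iso)
  have mult: "dist x ((f ^^ (k * n)) x) \<le> real k * dist x ((f ^^ n) x)" for k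
  proof (induction k)
    case (Suc k)
    have "dist x ((f ^^ (Suc k * n)) x) \<le> dist x ((f ^^ n) x) + dist ((f ^^ n) x) ((f ^^ (Suc k * n)) x)"
      by (rule dist_triangle)
    also have "dist ((f ^^ n) x) ((f ^^ (Suc k * n)) x) = dist x ((f ^^ (k * n)) x)"
      using iso_pow by (simp add: funpow_add)
    finally show ?case using Suc by (simp add: algebra_simps)
  qed simp
  have "filterlim (\<lambda>k. Suc k * n) at_top sequentially"
    using False by (intro filterlim_subseq) (auto simp: strict_mono_def)
  from filterlim_compose[OF lim this]
  have "(\<lambda>k. dist x ((f ^^ (Suc k * n)) x) / real (Suc k * n)) \<longlonglongrightarrow> \<tau>" .
  moreover have "dist x ((f ^^ (Suc k * n)) x) / real (Suc k * n) \<le> dist x ((f ^^ n) x) / real n" for k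
  proof -
    have "dist x ((f ^^ (Suc k * n)) x) / real (Suc k * n)
      \<le> (real (Suc k) * dist x ((f ^^ n) x)) / (real (Suc k) * real n)"
      using divide_right_mono[OF mult[of "Suc k"], of "real (Suc k * n)"] unfolding of_nat_mult by simp
    also have "\<dots> = dist x ((f ^^ n) x) / real n"
      by (rule mult_divide_mult_cancel_left) simp
    finally show ?thesis .
  qed
  ultimately have "\<tau> \<le> dist x ((f ^^ n) x) / real n"
    by (intro LIMSEQ_le_const2) auto
  then show ?thesis using False by (simp add: field_simps)
qed simp

section \<open>Isometric actions and orbits of loxodromic elements\<close>

locale hyperbolic_action = hyperbolic_space D x0 + group G
  for D :: real and x0 :: "'x::metric_space" and G :: "('g, 'b) monoid_scheme" (structure) +
  fixes \<phi> :: "'g \<Rightarrow> 'x \<Rightarrow> 'x"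
  assumes isometric: "isometric_action G \<phi>"
begin

lemma act: "group_action G UNIV \<phi>"
  using isometric unfolding isometric_action_def by blast

lemma act_isometry: "g \<in> carrier G \<Longrightarrow> dist (\<phi> g x) (\<phi> g y) = dist x y"
  using isometric unfolding isometric_action_def by blast

lemma act_mult: "g \<in> carrier G \<Longrightarrow> h \<in> carrier G \<Longrightarrow> \<phi> (g \<otimes> h) x = \<phi> g (\<phi> h x)"
  using group_action.composition_rule[OF act, of x g h] by simp

lemma act_one: "\<phi> \<one> x = x"
  using fun_cong[OF group_action.id_eq_one[OF act], of x] by simp

lemma act_inv: "g \<in> carrier G \<Longrightarrow> \<phi> g (\<phi> (inv g) x) = x" "g \<in> carrier G \<Longrightarrow> \<phi> (inv g) (\<phi> g x) = x"
  using act_mult[of g "inv g" x] act_mult[of "inv g" g x] act_one by simp_all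

lemma act_dist_left: "g \<in> carrier G \<Longrightarrow> dist (\<phi> g x) y = dist x (\<phi> (inv g) y)"
  using act_isometry[of g x "\<phi> (inv g) y"] act_inv by simp

lemma act_funpow: "g \<in> carrier G \<Longrightarrow> (\<phi> g ^^ n) x = \<phi> (g [^] int n) x"
proof (induction n)
  case 0
  then show ?case by (simp add: act_one)
next
  case (Suc n)
  have "g [^] int (Suc n) = g \<otimes> g [^] int n"
    using Suc.prems by (metis int_pow_int nat_pow_Suc2)
  then show ?case using Suc by (simp add: act_mult)
qed

text \<open>Integer exponents treat the forward and the backward end of a loxodromic element
  alike.\<close>

definition orbit_pt :: "'g \<Rightarrow> int \<Rightarrow> 'x" where
  "orbit_pt g a = \<phi> (g [^] a) x0"

lemma orbit_pt_0: "g \<in> carrier G \<Longrightarrow> orbit_pt g 0 = x0"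
  unfolding orbit_pt_def by (simp add: act_one)

lemma act_orbit_pt: "g \<in> carrier G \<Longrightarrow> \<phi> (g [^] a) (orbit_pt g b) = orbit_pt g (a + b)"
  unfolding orbit_pt_def by (simp add: act_mult int_pow_mult)

lemma dist_orbit_pt:
  assumes "g \<in> carrier G"
  shows "dist (orbit_pt g a) (orbit_pt g b) = dist x0 (orbit_pt g \<bar>b - a\<bar>)"
proof -
  have *: "dist (orbit_pt g a) (orbit_pt g b) = dist x0 (orbit_pt g (b - a))" for a b
    using act_isometry[of "g [^] a" x0 "orbit_pt g (b - a)"] assms act_orbit_pt[of g a "b - a"]
    by (simp add: orbit_pt_def)
  show ?thesis
  proof (cases "b \<ge> a")
    case False
    then show ?thesis using *[of b a] by (simp add: dist_commute)
  qed (use *[of a b] in simp)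
qed

lemma loxodromic_orbit_pt_lower:
  assumes g: "g \<in> carrier G" and "loxodromic (\<phi> g)"
  obtains \<tau> where "0 < \<tau>" "\<And>n::int. real_of_int \<bar>n\<bar> * \<tau> \<le> dist x0 (orbit_pt g n)"
proof -
  obtain \<tau> where \<tau>: "0 < \<tau>" "\<And>x. (\<lambda>n. dist x ((\<phi> g ^^ n) x) / real n) \<longlonglongrightarrow> \<tau>"
    using assms(2) unfolding loxodromic_def by blast
  have "real_of_int \<bar>n\<bar> * \<tau> \<le> dist x0 (orbit_pt g n)" for n :: int
  proof -
    have "real (nat \<bar>n\<bar>) * \<tau> \<le> dist x0 ((\<phi> g ^^ nat \<bar>n\<bar>) x0)"
      by (rule translation_length_le[OF act_isometry[OF g] \<tau>(2)])
    also have "(\<phi> g ^^ nat \<bar>n\<bar>) x0 = orbit_pt g \<bar>n\<bar>"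
      using act_funpow[OF g] unfolding orbit_pt_def by simp
    also have "dist x0 (orbit_pt g \<bar>n\<bar>) = dist x0 (orbit_pt g n)"
      using dist_orbit_pt[OF g, of 0 n] orbit_pt_0[OF g] by simp
    finally show ?thesis by simp
  qed
  with \<tau>(1) show ?thesis using that by blast
qed

text \<open>The sign \<open>e\<close> selects the end. Applying \<open>g\<close> shifts the orbit by
  one exponent, hence moves all its points by the same distance, and a bounded displacement does not
  change the class.\<close>

lemma loxodromic_end_fixed:
  assumes g: "g \<in> carrier G" and lox: "loxodromic (\<phi> g)" and e: "\<bar>e\<bar> = (1::int)"
  shows "(\<lambda>n. orbit_pt g (e * int n)) \<in> gromov_sequences x0"
    and "gromov_equiv x0 `` {\<lambda>n. orbit_pt g (e * int n)} \<in> boundary_fixed_points x0 (\<phi> g)"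
proof -
  let ?s = "\<lambda>n. orbit_pt g (e * int n)"
  obtain \<tau> where \<tau>: "0 < \<tau>" "\<And>n::int. real_of_int \<bar>n\<bar> * \<tau> \<le> dist x0 (orbit_pt g n)"
    using loxodromic_orbit_pt_lower[OF g lox] by blast
  show s: "?s \<in> gromov_sequences x0"
  proof (rule orbit_gromov_sequence[of _ "\<lambda>n. dist x0 (orbit_pt g (int n))"])
    show "?s 0 = x0" using g by (simp add: orbit_pt_0)
    show "dist (?s m) (?s n) = dist x0 (orbit_pt g (int (n - m)))" if "m \<le> n" for m n
    proof -
      have "\<bar>e * int n - e * int m\<bar> = \<bar>e\<bar> * \<bar>int n - int m\<bar>"
        by (metis abs_mult right_diff_distrib)
      then show ?thesis using dist_orbit_pt[OF g] e that by (simp add: of_nat_diff)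
    qed
    show "real n * \<tau> \<le> dist x0 (orbit_pt g (int n))" for n
      using \<tau>(2)[of "int n"] by simp
  qed (use \<tau> in simp)
  have "dist ((\<phi> g \<circ> ?s) n) (?s n) \<le> dist x0 (orbit_pt g 1)" for n
  proof -
    have "\<phi> g (?s n) = orbit_pt g (1 + e * int n)"
      using act_orbit_pt[OF g, of 1 "e * int n"] g by simp
    then show ?thesis using dist_orbit_pt[OF g, of "1 + e * int n" "e * int n"] by simp
  qed
  then have "(\<phi> g \<circ> ?s, ?s) \<in> gromov_equiv x0"
    using gromov_equiv_if_bounded_dist isometry_gromov_sequences[OF act_isometry[OF g] s] s by blast
  then show "gromov_equiv x0 `` {?s} \<in> boundary_fixed_points x0 (\<phi> g)"
    using boundary_fixed_point_if_equiv[OF act_isometry[OF g] act_inv(1)[OF g] s] by blast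
qed

text \<open>Unbounded products between two half-orbits would make their ends equal, giving a common
  boundary fixed point. The four choices of signs cover all pairs of exponents.\<close>

lemma loxodromic_independent:
  assumes g: "g \<in> carrier G" "loxodromic (\<phi> g)" and h: "h \<in> carrier G" "loxodromic (\<phi> h)"
    and disj: "boundary_fixed_points x0 (\<phi> g) \<inter> boundary_fixed_points x0 (\<phi> h) = {}"
  obtains C where "\<And>a b. gp (orbit_pt g a) (orbit_pt h b) \<le> C"
proof -
  have "\<exists>C. \<forall>m n. gp (orbit_pt g (d * int m)) (orbit_pt h (e * int n)) \<le> C"
    if "\<bar>d\<bar> = 1" "\<bar>e\<bar> = 1" for d e :: int
  proof (rule ccontr)
    let ?s = "\<lambda>n. orbit_pt g (d * int n)" and ?t = "\<lambda>n. orbit_pt h (e * int n)"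
    assume "\<not> ?thesis"
    then have "\<And>K. \<exists>m n. K < gp (?s m) (?t n)" by (meson not_le)
    with gromov_equiv_if_unbounded loxodromic_end_fixed(1)[OF g that(1)] loxodromic_end_fixed(1)[OF h that(2)]
    have eq: "(?s, ?t) \<in> gromov_equiv x0" by blast
    then have "gromov_equiv x0 `` {?s} = gromov_equiv x0 `` {?t}"
      using gromov_equiv_trans gromov_equiv_sym by blast
    then show False
      using disj loxodromic_end_fixed(2)[OF g that(1)] loxodromic_end_fixed(2)[OF h that(2)] by auto
  qed
  then obtain C where C: "\<And>d e m n. \<bar>d\<bar> = 1 \<Longrightarrow> \<bar>e\<bar> = 1 \<Longrightarrow>
      gp (orbit_pt g (d * int m)) (orbit_pt h (e * int n)) \<le> C d e"
    by metis
  have "gp (orbit_pt g a) (orbit_pt h b) \<le> max (max (C 1 1) (C 1 (-1))) (max (C (-1) 1) (C (-1) (-1)))" for a b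
  proof -
    define d e where "d = (if a \<ge> 0 then 1 else - 1 :: int)" and "e = (if b \<ge> 0 then 1 else - 1 :: int)"
    have "a = d * int (nat \<bar>a\<bar>)" "b = e * int (nat \<bar>b\<bar>)" "\<bar>d\<bar> = 1" "\<bar>e\<bar> = 1"
      unfolding d_def e_def by auto
    then have "gp (orbit_pt g a) (orbit_pt h b) \<le> C d e" using C by metis
    then show ?thesis unfolding d_def e_def by (auto split: if_splits)
  qed
  then show ?thesis using that by blast
qed

end

section \<open>The energy form\<close>

text \<open>
  If \<open>i\<close> and \<open>j\<close> are related and \<open>f i \<le> h j\<close>, then the mass \<open>f i\<close> of all partners of \<open>i\<close> is
  bounded by the mass \<open>h j\<close>, which consists of points at two steps from \<open>i\<close>.
\<close>

lemma relation_sum_le_half: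
  fixes a :: "'i \<Rightarrow> real" and b :: "'j \<Rightarrow> real"
  assumes a: "\<And>i. 0 \<le> a i" and b: "\<And>j. 0 \<le> b j"
    and f: "f = (\<lambda>i. \<Sum>j\<in>J. if A i j then b j else 0)"
    and h: "h = (\<lambda>j. \<Sum>i\<in>I. if A i j then a i else 0)"
  shows "(\<Sum>i\<in>I. \<Sum>j\<in>J. if A i j \<and> f i \<le> h j then a i * b j else 0)
    \<le> (\<Sum>i\<in>I. \<Sum>k\<in>I. if \<exists>j\<in>J. A i j \<and> A k j then a i * a k else 0)"
proof (rule sum_mono)
  fix i assume i: "i \<in> I"
  have nn: "0 \<le> (\<Sum>k\<in>I. if \<exists>j\<in>J. A i j \<and> A k j then a i * a k else 0)"
    using a by (intro sum_nonneg) auto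
  show "(\<Sum>j\<in>J. if A i j \<and> f i \<le> h j then a i * b j else 0)
    \<le> (\<Sum>k\<in>I. if \<exists>j\<in>J. A i j \<and> A k j then a i * a k else 0)"
  proof (cases "\<exists>j\<in>J. A i j \<and> f i \<le> h j")
    case True
    then obtain j where j: "j \<in> J" "A i j" "f i \<le> h j" by blast
    have "(\<Sum>j\<in>J. if A i j \<and> f i \<le> h j then a i * b j else 0)
      \<le> (\<Sum>j\<in>J. a i * (if A i j then b j else 0))"
      using a b by (intro sum_mono) auto
    also have "\<dots> = a i * f i" unfolding f by (simp add: sum_distrib_left)
    also have "\<dots> \<le> a i * h j" using j a by (intro mult_left_mono) auto
    also have "\<dots> = (\<Sum>k\<in>I. a i * (if A k j then a k else 0))"
      unfolding h by (simp add: sum_distrib_left)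
    also have "\<dots> \<le> (\<Sum>k\<in>I. if \<exists>j\<in>J. A i j \<and> A k j then a i * a k else 0)"
      using j a by (intro sum_mono) auto
    finally show ?thesis .
  next
    case False
    then have "(\<Sum>j\<in>J. if A i j \<and> f i \<le> h j then a i * b j else 0) = 0"
      by (intro sum.neutral) auto
    with nn show ?thesis by simp
  qed
qed

text \<open>For every related pair, \<open>f i \<le> h j\<close> or \<open>h j \<le> f i\<close>.
  Pairs of the first kind are paid for inside \<open>I\<close>, those of the second inside
  \<open>J\<close>, by the same estimate with the relation transposed.\<close>

lemma relation_sum_le:
  fixes a :: "'i \<Rightarrow> real" and b :: "'j \<Rightarrow> real"
  assumes a: "\<And>i. 0 \<le> a i" and b: "\<And>j. 0 \<le> b j"
  shows "(\<Sum>i\<in>I. \<Sum>j\<in>J. if A i j then a i * b j else 0)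
    \<le> (\<Sum>i\<in>I. \<Sum>k\<in>I. if \<exists>j\<in>J. A i j \<and> A k j then a i * a k else 0)
      + (\<Sum>j\<in>J. \<Sum>k\<in>J. if \<exists>i\<in>I. A i j \<and> A i k then b j * b k else 0)"
proof -
  define f where "f = (\<lambda>i. \<Sum>j\<in>J. if A i j then b j else 0)"
  define h where "h = (\<lambda>j. \<Sum>i\<in>I. if A i j then a i else 0)"
  have "(\<Sum>i\<in>I. \<Sum>j\<in>J. if A i j then a i * b j else 0)
    \<le> (\<Sum>i\<in>I. \<Sum>j\<in>J. (if A i j \<and> f i \<le> h j then a i * b j else 0)
        + (if A i j \<and> h j \<le> f i then b j * a i else 0))"
    using a b by (intro sum_mono) auto
  also have "\<dots> = (\<Sum>i\<in>I. \<Sum>j\<in>J. if A i j \<and> f i \<le> h j then a i * b j else 0)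
      + (\<Sum>j\<in>J. \<Sum>i\<in>I. if A i j \<and> h j \<le> f i then b j * a i else 0)"
    by (simp only: sum.distrib sum.swap[of _ J I])
  also have "\<dots> \<le> (\<Sum>i\<in>I. \<Sum>k\<in>I. if \<exists>j\<in>J. A i j \<and> A k j then a i * a k else 0)
      + (\<Sum>j\<in>J. \<Sum>k\<in>J. if \<exists>i\<in>I. A i j \<and> A i k then b j * b k else 0)"
    by (intro add_mono relation_sum_le_half[OF a b f_def h_def]
        relation_sum_le_half[where A = "\<lambda>j i. A i j", OF b a h_def f_def])
  finally show ?thesis .
qed

lemma sum_exp_double_le: "(\<Sum>k<Suc n. exp (2 * real k)) \<le> 2 * exp (2 * real n)"
proof (induction n)
  case (Suc n)
  have "(2::real) \<le> exp 2" using exp_ge_add_one_self[of 2] by simp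
  then have "2 * exp (2 * real n) \<le> exp (2 * real (Suc n))"
    by (simp add: algebra_simps exp_add)
  with Suc show ?case by simp
qed simp

text \<open>Together with the next lemma: up to constants, exp(2u) is the sum of exp(2k) over the
  integers k from 0 to u, because a geometric sum is comparable to its last term.\<close>

lemma exp_double_le_layers:
  assumes "0 \<le> u" "u < real T"
  shows "exp (2 * u) \<le> exp 2 * (\<Sum>k<T. if real k \<le> u then exp (2 * real k) else 0)"
proof -
  define n where "n = nat \<lfloor>u\<rfloor>"
  have n: "real n \<le> u" "u < real n + 1" "n < T" unfolding n_def using assms by linarith+
  have "exp (2 * u) \<le> exp (2 + 2 * real n)" using n by simp
  also have "\<dots> = exp 2 * (if real n \<le> u then exp (2 * real n) else 0)" using n by (simp add: exp_add)
  also have "\<dots> \<le> exp 2 * (\<Sum>k<T. if real k \<le> u then exp (2 * real k) else 0)"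
    using n(3) by (intro mult_left_mono member_le_sum[of n "{..<T}" "\<lambda>k. if real k \<le> u then exp (2 * real k) else 0"]) auto
  finally show ?thesis .
qed

lemma layers_le_exp_double:
  "(\<Sum>k<T. if real k \<le> v then exp (2 * real k) else 0) \<le> 2 * exp (2 * v)"
proof (cases "v < 0")
  case True
  then have "(\<Sum>k<T. if real k \<le> v then exp (2 * real k) else 0) = 0" by (intro sum.neutral) auto
  then show ?thesis by simp
next
  case False
  define n where "n = nat \<lfloor>v\<rfloor>"
  have n: "real n \<le> v" "\<And>k. real k \<le> v \<longleftrightarrow> k < Suc n"
    unfolding n_def using False by linarith+
  have "(\<Sum>k<T. if real k \<le> v then exp (2 * real k) else 0) = (\<Sum>k\<in>{..<T} \<inter> {..<Suc n}. exp (2 * real k))"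
    unfolding n(2) by (simp add: sum.inter_restrict)
  also have "\<dots> \<le> (\<Sum>k<Suc n. exp (2 * real k))" by (intro sum_mono2) auto
  also have "\<dots> \<le> 2 * exp (2 * real n)" by (rule sum_exp_double_le)
  also have "\<dots> \<le> 2 * exp (2 * v)" using n(1) by simp
  finally show ?thesis .
qed

text \<open>A bilinear form in two finite families; the energy of a single family is its diagonal
  value.\<close>

definition energy :: "'i set \<Rightarrow> ('i \<Rightarrow> 'x::metric_space) \<Rightarrow> 'j set \<Rightarrow> ('j \<Rightarrow> 'x) \<Rightarrow> real" where
  "energy I y J z = (\<Sum>i\<in>I. \<Sum>j\<in>J. exp (- dist (y i) (z j)))"

lemma energy_nonneg: "0 \<le> energy I y J z"
  unfolding energy_def by (intro sum_nonneg) simp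

lemma energy_commute: "energy I y J z = energy J z I y"
  unfolding energy_def by (subst sum.swap) (simp add: dist_commute)

lemma energy_mono:
  assumes "finite I" "finite J" "I' \<subseteq> I" "J' \<subseteq> J"
  shows "energy I' y J' z \<le> energy I y J z"
proof -
  have "energy I' y J' z \<le> (\<Sum>i\<in>I'. \<Sum>j\<in>J. exp (- dist (y i) (z j)))"
    unfolding energy_def using assms by (intro sum_mono sum_mono2) auto
  also have "\<dots> \<le> energy I y J z"
    unfolding energy_def using assms by (intro sum_mono2 sum_nonneg) auto
  finally show ?thesis .
qed

lemma energy_union:
  assumes "finite A" "finite B" "A \<inter> B = {}"
  shows "energy (A \<union> B) z (A \<union> B) z = energy A z A z + energy B z B z + 2 * energy A z B z"
proof -
  have "energy (A \<union> B) z (A \<union> B) z = energy A z A z + energy A z B z + energy B z A z + energy B z B z"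
    unfolding energy_def using assms by (simp add: sum.union_disjoint sum.distrib)
  then show ?thesis using energy_commute[of B z A z] by simp
qed

lemma energy_Sigma:
  assumes "finite S" "\<And>s. s \<in> S \<Longrightarrow> finite (R s)"
  shows "energy (Sigma S R) z (Sigma S R) z
    = (\<Sum>s\<in>S. \<Sum>t\<in>S. energy (R s) (\<lambda>i. z (s, i)) (R t) (\<lambda>j. z (t, j)))"
proof -
  have sum_Sigma: "(\<Sum>p\<in>Sigma S R. f p) = (\<Sum>s\<in>S. \<Sum>i\<in>R s. f (s, i))" for f :: "_ \<Rightarrow> real"
    using assms by (simp add: sum.Sigma)
  have "energy (Sigma S R) z (Sigma S R) z
      = (\<Sum>s\<in>S. \<Sum>i\<in>R s. \<Sum>t\<in>S. \<Sum>j\<in>R t. exp (- dist (z (s, i)) (z (t, j))))"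
    unfolding energy_def by (simp only: sum_Sigma)
  also have "\<dots> = (\<Sum>s\<in>S. \<Sum>t\<in>S. \<Sum>i\<in>R s. \<Sum>j\<in>R t. exp (- dist (z (s, i)) (z (t, j))))"
    by (intro sum.cong refl sum.swap)
  finally show ?thesis unfolding energy_def .
qed

lemma energy_isometry:
  assumes "\<And>x y. dist (f x) (f y) = dist x y"
  shows "energy I (\<lambda>i. f (y i)) J (\<lambda>j. f (z j)) = energy I y J z"
  unfolding energy_def assms ..

context hyperbolic_space
begin

text \<open>exp(2) pays for rounding products down to integer levels, exp(2 D) for lowering the
  level by \<open>D\<close> when relations are composed, and 2 for the geometric sum over
  levels.\<close>

definition energy_const :: real where "energy_const = 2 * exp (2 + 2 * D)"

lemma exp_dist_gromov_product:
  "exp (- dist x y) = exp (- dist x0 x) * exp (- dist x0 y) * exp (2 * gp x y)"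
  by (simp add: gromov_product_def field_simps flip: exp_add)

lemma energy_layers_le:
  fixes w :: "'k \<Rightarrow> 'x"
  shows "(\<Sum>k<T. exp (2 * real k) * (\<Sum>i\<in>N. \<Sum>j\<in>N. if real k \<le> gp (w i) (w j) + D
      then exp (- dist x0 (w i)) * exp (- dist x0 (w j)) else 0)) \<le> 2 * exp (2 * D) * energy N w N w"
proof -
  have eq: "exp (- dist (w i) (w j)) = exp (- dist x0 (w i)) * exp (- dist x0 (w j)) * exp (2 * gp (w i) (w j))" for i j
    by (rule exp_dist_gromov_product)
  let ?c = "\<lambda>i. exp (- dist x0 (w i))"
  have "(\<Sum>k<T. exp (2 * real k) * (\<Sum>i\<in>N. \<Sum>j\<in>N. if real k \<le> gp (w i) (w j) + D then ?c i * ?c j else 0))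
    = (\<Sum>k<T. \<Sum>i\<in>N. \<Sum>j\<in>N. ?c i * ?c j * (if real k \<le> gp (w i) (w j) + D then exp (2 * real k) else 0))"
    unfolding sum_distrib_left by (intro sum.cong refl) auto
  also have "\<dots> = (\<Sum>i\<in>N. \<Sum>j\<in>N. \<Sum>k<T. ?c i * ?c j * (if real k \<le> gp (w i) (w j) + D then exp (2 * real k) else 0))"
    by (subst sum.swap) (intro sum.cong refl sum.swap)
  also have "\<dots> = (\<Sum>i\<in>N. \<Sum>j\<in>N. ?c i * ?c j * (\<Sum>k<T. if real k \<le> gp (w i) (w j) + D then exp (2 * real k) else 0))"
    by (simp only: sum_distrib_left)
  also have "\<dots> \<le> (\<Sum>i\<in>N. \<Sum>j\<in>N. ?c i * ?c j * (2 * exp (2 * (gp (w i) (w j) + D))))"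
    by (intro sum_mono mult_left_mono layers_le_exp_double) simp
  also have "\<dots> = (\<Sum>i\<in>N. \<Sum>j\<in>N. 2 * exp (2 * D) * exp (- dist (w i) (w j)))"
    unfolding eq by (intro sum.cong refl) (simp add: exp_add algebra_simps)
  also have "\<dots> = 2 * exp (2 * D) * energy N w N w"
    unfolding energy_def by (simp only: sum_distrib_left)
  finally show ?thesis .
qed

text \<open>
  The kernel \<open>exp (- d(x, y))\<close> is a product of weights times \<open>exp (2 (x\<cdot>y))\<close>, a superposition of the
  relations \<open>(x\<cdot>y) \<ge> k\<close>. By the four-point inequality the composition of such a relation with its
  converse only lowers the level \<open>k\<close> by \<open>D\<close>.
\<close>

lemma energy_mixed_le:
  fixes y :: "'i \<Rightarrow> 'x" and z :: "'j \<Rightarrow> 'x"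
  assumes fin: "finite I" "finite J"
  shows "energy I y J z \<le> energy_const * (energy I y I y + energy J z J z)"
proof -
  define a where "a i = exp (- dist x0 (y i))" for i
  define b where "b j = exp (- dist x0 (z j))" for j
  \<comment> \<open>A product with \<open>y i\<close> is at most d(x0, y i), so finitely many levels
    occur; the sum is a crude common bound for these distances.\<close>
  define T where "T = Suc (nat \<lceil>\<Sum>i\<in>I. dist x0 (y i)\<rceil>)"
  have ab: "0 \<le> a i" "0 \<le> b j" for i j unfolding a_def b_def by simp_all
  have T: "gp (y i) (z j) < real T" if "i \<in> I" for i j
  proof -
    have "gp (y i) (z j) \<le> dist x0 (y i)" by (rule gromov_product_le)
    also have "\<dots> \<le> (\<Sum>i\<in>I. dist x0 (y i))" using fin that by (intro member_le_sum) auto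
    finally show ?thesis unfolding T_def by linarith
  qed
  let ?A = "\<lambda>k i j. real k \<le> gp (y i) (z j)"
  have layer: "(\<Sum>i\<in>I. \<Sum>j\<in>J. if ?A k i j then a i * b j else 0)
      \<le> (\<Sum>i\<in>I. \<Sum>l\<in>I. if real k \<le> gp (y i) (y l) + D then a i * a l else 0)
       + (\<Sum>j\<in>J. \<Sum>l\<in>J. if real k \<le> gp (z j) (z l) + D then b j * b l else 0)" for k :: nat
  proof -
    have 1: "real k \<le> gp (y i) (y l) + D" if "?A k i j" "?A k l j" for i l j
      using that gp_four_point[of "y i" "z j" "y l"] gromov_product_commute[of x0 "y l" "z j"] by linarith
    have 2: "real k \<le> gp (z j) (z l) + D" if "?A k i j" "?A k i l" for i l j
      using that gp_four_point[of "z j" "y i" "z l"] gromov_product_commute[of x0 "y i" "z j"] by linarith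
    have "(\<Sum>i\<in>I. \<Sum>j\<in>J. if ?A k i j then a i * b j else 0)
      \<le> (\<Sum>i\<in>I. \<Sum>l\<in>I. if \<exists>j\<in>J. ?A k i j \<and> ?A k l j then a i * a l else 0)
       + (\<Sum>j\<in>J. \<Sum>l\<in>J. if \<exists>i\<in>I. ?A k i j \<and> ?A k i l then b j * b l else 0)"
      by (rule relation_sum_le[OF ab])
    also have "\<dots> \<le> (\<Sum>i\<in>I. \<Sum>l\<in>I. if real k \<le> gp (y i) (y l) + D then a i * a l else 0)
       + (\<Sum>j\<in>J. \<Sum>l\<in>J. if real k \<le> gp (z j) (z l) + D then b j * b l else 0)"
      using ab 1 2 by (intro add_mono sum_mono) auto
    finally show ?thesis .
  qed
  have "energy I y J z = (\<Sum>i\<in>I. \<Sum>j\<in>J. a i * b j * exp (2 * gp (y i) (z j)))"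
    unfolding energy_def a_def b_def by (intro sum.cong refl exp_dist_gromov_product)
  also have "\<dots> \<le> (\<Sum>i\<in>I. \<Sum>j\<in>J. a i * b j *
      (exp 2 * (\<Sum>k<T. if ?A k i j then exp (2 * real k) else 0)))"
    using T ab by (intro sum_mono mult_left_mono exp_double_le_layers gromov_product_nonneg) auto
  also have "\<dots> = (\<Sum>i\<in>I. \<Sum>j\<in>J. \<Sum>k<T. exp 2 * (exp (2 * real k) * (if ?A k i j then a i * b j else 0)))"
    unfolding sum_distrib_left by (intro sum.cong refl) auto
  also have "\<dots> = (\<Sum>i\<in>I. \<Sum>k<T. \<Sum>j\<in>J. exp 2 * (exp (2 * real k) * (if ?A k i j then a i * b j else 0)))"
    by (intro sum.cong refl sum.swap)
  also have "\<dots> = (\<Sum>k<T. \<Sum>i\<in>I. \<Sum>j\<in>J. exp 2 * (exp (2 * real k) * (if ?A k i j then a i * b j else 0)))"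
    by (rule sum.swap)
  also have "\<dots> = exp 2 * (\<Sum>k<T. exp (2 * real k) * (\<Sum>i\<in>I. \<Sum>j\<in>J. if ?A k i j then a i * b j else 0))"
    by (simp only: sum_distrib_left)
  also have "\<dots> \<le> exp 2 * (\<Sum>k<T. exp (2 * real k) *
      ((\<Sum>i\<in>I. \<Sum>l\<in>I. if real k \<le> gp (y i) (y l) + D then a i * a l else 0)
       + (\<Sum>j\<in>J. \<Sum>l\<in>J. if real k \<le> gp (z j) (z l) + D then b j * b l else 0)))"
    by (intro mult_left_mono sum_mono layer) auto
  also have "\<dots> \<le> exp 2 * (2 * exp (2 * D) * energy I y I y + 2 * exp (2 * D) * energy J z J z)"
    unfolding distrib_left sum.distrib
    by (intro mult_left_mono add_mono energy_layers_le[where N = I and w = y, folded a_def]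
        energy_layers_le[where N = J and w = z, folded b_def]) auto
  also have "\<dots> = energy_const * (energy I y I y + energy J z J z)"
    unfolding energy_const_def by (simp add: exp_add algebra_simps)
  finally show ?thesis .
qed

text \<open>\<open>u\<close> and \<open>v\<close> are the images of \<open>x\<close> and
  \<open>y\<close>. Since \<open>x\<close> and \<open>y\<close> avoid the shadows of
  \<open>q\<close> and \<open>q'\<close>, their images point in the directions of \<open>p\<close>
  and \<open>p'\<close>, so the product of \<open>u\<close> and \<open>v\<close> is at most C + 2 D.
  Each image gains L - 2 (C + D) in distance from \<open>x0\<close>, and the total is 2 L - 4 (C +
  D) - 2 (C + 2 D).\<close>

lemma ping_pong_dist:
  fixes p q p' q' x y u v :: 'x
  assumes p: "L \<le> dist x0 p" and p': "L \<le> dist x0 p'" and pp': "gp p p' \<le> C"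
    and u: "dist x0 u = dist x0 x + dist x0 p - 2 * gp q x" "dist u p = dist x0 x" "gp q x \<le> C + D"
    and v: "dist x0 v = dist x0 y + dist x0 p' - 2 * gp q' y" "dist v p' = dist x0 y" "gp q' y \<le> C + D"
    and L: "2 * C + 3 * D < L"
  shows "dist x y + (2 * L - 6 * C - 8 * D) \<le> dist u v"
proof -
  have up: "L - (C + D) \<le> gp p u"
    using u p unfolding gromov_product_def[of x0 p u] by (simp add: dist_commute)
  have vp: "L - (C + D) \<le> gp v p'"
    using v p' unfolding gromov_product_def[of x0 v p'] by (simp add: dist_commute)
  have "gp u v \<le> C + 2 * D"
    using gp_four_point2[of p u v p'] up vp pp' L by linarith
  then have "dist x0 u + dist x0 v - 2 * (C + 2 * D) \<le> dist u v"
    unfolding gromov_product_def by simp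
  moreover have "dist x y \<le> dist x0 x + dist x0 y"
    using dist_triangle[of x y x0] by (simp add: dist_commute)
  moreover have "dist x0 x + L - 2 * (C + D) \<le> dist x0 u" "dist x0 y + L - 2 * (C + D) \<le> dist x0 v"
    using u(1,3) v(1,3) p p' by (auto simp: algebra_simps)
  ultimately show ?thesis by (simp add: algebra_simps)
qed

text \<open>
  Index \<open>i\<close> is bad for \<open>s\<close> if \<open>y i\<close> lies in the shadow of \<open>q s\<close>. The bad sets are disjoint, so
  the bad pairs contribute at most \<open>M\<close> times the energy; on the good pairs different isometries
  move points to different shadows, at distance growing with \<open>L\<close>.
\<close>

lemma energy_contraction:
  fixes y :: "'i \<Rightarrow> 'x" and \<sigma> :: "nat \<Rightarrow> 'x \<Rightarrow> 'x" and q :: "nat \<Rightarrow> 'x"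
  assumes I: "finite I"
    and iso: "\<And>s x z. s < M \<Longrightarrow> dist (\<sigma> s x) (\<sigma> s z) = dist x z"
    and q: "\<And>s x. s < M \<Longrightarrow> dist (\<sigma> s x) x0 = dist x (q s)"
    and far: "\<And>s. s < M \<Longrightarrow> L \<le> dist x0 (\<sigma> s x0)"
    and sep: "\<And>s t. s < M \<Longrightarrow> t < M \<Longrightarrow> s \<noteq> t \<Longrightarrow> gp (\<sigma> s x0) (\<sigma> t x0) \<le> C"
    and sep': "\<And>s t. s < M \<Longrightarrow> t < M \<Longrightarrow> s \<noteq> t \<Longrightarrow> gp (q s) (q t) \<le> C"
    and L: "2 * C + 3 * D < L"
  shows "energy ({..<M} \<times> I) (\<lambda>(s, i). \<sigma> s (y i)) ({..<M} \<times> I) (\<lambda>(s, i). \<sigma> s (y i))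
    \<le> (1 + 2 * energy_const) * (2 * energy_const * M + M + (real M)\<^sup>2 * exp (- (2 * L - 6 * C - 8 * D)))
      * energy I y I y"
proof -
  define z where "z = (\<lambda>(s, i). \<sigma> s (y i))"
  define R where "R s = {i \<in> I. C + D < gp (q s) (y i)}" for s
  define E where "E = energy I y I y"
  define \<epsilon> where "\<epsilon> = exp (- (2 * L - 6 * C - 8 * D))"
  let ?S = "{..<M}"
  let ?Bad = "Sigma ?S R" and ?Good = "Sigma ?S (\<lambda>s. I - R s)"
  have R: "R s \<subseteq> I" "finite (R s)" for s using I unfolding R_def by auto
  have E: "0 \<le> E" "energy A y B y \<le> E" if "A \<subseteq> I" "B \<subseteq> I" for A B
    unfolding E_def using energy_nonneg energy_mono[OF I I] that by blast+
  have isometric: "energy A (\<lambda>i. \<sigma> s (y i)) A (\<lambda>i. \<sigma> s (y i)) = energy A y A y" if "s < M" for s A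
    by (rule energy_isometry[of "\<sigma> s", OF iso[OF that]])
  have c: "0 \<le> energy_const" unfolding energy_const_def by simp
  have \<epsilon>E: "0 \<le> \<epsilon> * E" using E(1)[of "{}" "{}"] unfolding \<epsilon>_def by simp
  have split: "?S \<times> I = ?Bad \<union> ?Good" "?Bad \<inter> ?Good = {}" "finite ?Bad" "finite ?Good"
    using R I by auto
  have R_disj: "s = t" if "s < M" "t < M" "i \<in> R s" "i \<in> R t" for s t i
  proof (rule ccontr)
    assume "s \<noteq> t"
    with sep' that have "gp (q s) (q t) \<le> C" by blast
    then show False
      using that gp_four_point[of "q s" "y i" "q t"] gromov_product_commute[of x0 "y i" "q t"]
      unfolding R_def by auto
  qed
  have "(\<Sum>s<M. energy (R s) y (R s) y) \<le> E"
  proof -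
    have "(\<Sum>s<M. energy (R s) y (R s) y) \<le> (\<Sum>s<M. energy (R s) y I y)"
      using R I by (intro sum_mono energy_mono) auto
    also have "\<dots> = energy (\<Union>s<M. R s) y I y"
      unfolding energy_def using R R_disj by (subst sum.UNION_disjoint) auto
    also have "\<dots> \<le> E" unfolding E_def using R I by (intro energy_mono) auto
    finally show ?thesis .
  qed
  note sum_R = this
  have "energy ?Bad z ?Bad z = (\<Sum>s<M. \<Sum>t<M. energy (R s) (\<lambda>i. \<sigma> s (y i)) (R t) (\<lambda>j. \<sigma> t (y j)))"
    unfolding z_def using R by (subst energy_Sigma) auto
  also have "\<dots> \<le> (\<Sum>s<M. \<Sum>t<M. energy_const * (energy (R s) y (R s) y + energy (R t) y (R t) y))"
  proof (intro sum_mono)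
    fix s t assume "s \<in> ?S" "t \<in> ?S"
    then show "energy (R s) (\<lambda>i. \<sigma> s (y i)) (R t) (\<lambda>j. \<sigma> t (y j))
      \<le> energy_const * (energy (R s) y (R s) y + energy (R t) y (R t) y)"
      using energy_mixed_le[OF R(2) R(2), of s "\<lambda>i. \<sigma> s (y i)" t "\<lambda>j. \<sigma> t (y j)"]
        isometric[of s "R s"] isometric[of t "R t"] by simp
  qed
  also have "\<dots> = 2 * energy_const * M * (\<Sum>s<M. energy (R s) y (R s) y)"
    by (simp add: sum.distrib algebra_simps flip: sum_distrib_left)
  also have "\<dots> \<le> 2 * energy_const * M * E" using c by (intro mult_left_mono sum_R) auto
  finally have bad: "energy ?Bad z ?Bad z \<le> 2 * energy_const * M * E" .
  have "energy ?Good z ?Good z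
      = (\<Sum>s<M. \<Sum>t<M. energy (I - R s) (\<lambda>i. \<sigma> s (y i)) (I - R t) (\<lambda>j. \<sigma> t (y j)))"
    unfolding z_def using I by (subst energy_Sigma) auto
  \<comment> \<open>On the diagonal both copies are moved by the same isometry, which preserves
    their energy; off the diagonal every distance grows, which gives the factor
    \<open>\<epsilon>\<close>.\<close>
  also have "\<dots> \<le> (\<Sum>s<M. \<Sum>t<M. (if s = t then E else 0) + \<epsilon> * E)"
  proof (intro sum_mono)
    fix s t assume st: "s \<in> ?S" "t \<in> ?S"
    show "energy (I - R s) (\<lambda>i. \<sigma> s (y i)) (I - R t) (\<lambda>j. \<sigma> t (y j)) \<le> (if s = t then E else 0) + \<epsilon> * E"
    proof (cases "s = t")
      case True
      then have "energy (I - R s) (\<lambda>i. \<sigma> s (y i)) (I - R t) (\<lambda>j. \<sigma> t (y j)) \<le> E"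
        using isometric[of t "I - R t"] st E(2)[of "I - R t" "I - R t"] by simp
      then show ?thesis using True \<epsilon>E by simp
    next
      case False
      have "energy (I - R s) (\<lambda>i. \<sigma> s (y i)) (I - R t) (\<lambda>j. \<sigma> t (y j))
        \<le> (\<Sum>i\<in>I - R s. \<Sum>j\<in>I - R t. \<epsilon> * exp (- dist (y i) (y j)))"
        unfolding energy_def
      proof (intro sum_mono)
        fix i j assume i: "i \<in> I - R s" and j: "j \<in> I - R t"
        have *: "dist x0 (\<sigma> s x) = dist x0 x + dist x0 (\<sigma> s x0) - 2 * gp (q s) x" "dist (\<sigma> s x) (\<sigma> s x0) = dist x0 x"
          if "s < M" for s x
          using q[OF that, of x] q[OF that, of x0] iso[OF that, of x x0]
          unfolding gromov_product_def by (simp_all add: dist_commute field_simps)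
        have "dist (y i) (y j) + (2 * L - 6 * C - 8 * D) \<le> dist (\<sigma> s (y i)) (\<sigma> t (y j))"
          using st False i j unfolding R_def
          by (intro ping_pong_dist[where p = "\<sigma> s x0" and p' = "\<sigma> t x0" and q = "q s" and q' = "q t"] far sep L *) auto
        then show "exp (- dist (\<sigma> s (y i)) (\<sigma> t (y j))) \<le> \<epsilon> * exp (- dist (y i) (y j))"
          unfolding \<epsilon>_def by (simp flip: exp_add)
      qed
      also have "\<dots> = \<epsilon> * energy (I - R s) y (I - R t) y"
        unfolding energy_def by (simp only: sum_distrib_left)
      also have "\<dots> \<le> \<epsilon> * E" unfolding \<epsilon>_def by (intro mult_left_mono E) auto
      finally show ?thesis using False by simp
    qed
  qed
  also have "\<dots> = (M + (real M)\<^sup>2 * \<epsilon>) * E"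
    by (simp add: sum.distrib power2_eq_square algebra_simps)
  finally have good: "energy ?Good z ?Good z \<le> (M + (real M)\<^sup>2 * \<epsilon>) * E" .
  have "energy (?S \<times> I) z (?S \<times> I) z = energy ?Bad z ?Bad z + energy ?Good z ?Good z + 2 * energy ?Bad z ?Good z"
    unfolding split(1) by (rule energy_union[OF split(3,4,2)])
  \<comment> \<open>The cross term between bad and good pairs is absorbed by the Cauchy-Schwarz
    substitute, at the price of the factor 1 + 2 \<open>energy_const\<close>.\<close>
  also have "\<dots> \<le> (1 + 2 * energy_const) * (energy ?Bad z ?Bad z + energy ?Good z ?Good z)"
    using energy_mixed_le[OF split(3,4), of z z] by (simp add: algebra_simps)
  also have "\<dots> \<le> (1 + 2 * energy_const) * (2 * energy_const * M * E + (M + (real M)\<^sup>2 * \<epsilon>) * E)"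
    using c by (intro mult_left_mono add_mono bad good) auto
  finally show ?thesis unfolding z_def E_def \<epsilon>_def by (simp add: algebra_simps)
qed

end

section \<open>Schottky families in convolution powers\<close>

primrec convolution_power :: "('g, 'b) monoid_scheme \<Rightarrow> 'g pmf \<Rightarrow> nat \<Rightarrow> 'g pmf" where
  "convolution_power G \<mu> 0 = return_pmf \<one>\<^bsub>G\<^esub>"
| "convolution_power G \<mu> (Suc n) =
     bind_pmf (convolution_power G \<mu> n) (\<lambda>w. map_pmf (\<lambda>g. w \<otimes>\<^bsub>G\<^esub> g) \<mu>)"

context group
begin

lemma set_convolution_power:
  assumes "set_pmf \<mu> \<subseteq> carrier G"
  shows "set_pmf (convolution_power G \<mu> n) \<subseteq> carrier G"
  using assms by (induction n) (auto simp: subset_iff)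

lemma convolution_power_add:
  assumes \<mu>: "set_pmf \<mu> \<subseteq> carrier G"
  shows "convolution_power G \<mu> (m + n) =
    bind_pmf (convolution_power G \<mu> m) (\<lambda>w. map_pmf (\<lambda>v. w \<otimes> v) (convolution_power G \<mu> n))"
proof (induction n)
  case 0
  have "bind_pmf (convolution_power G \<mu> m) (\<lambda>w. return_pmf (w \<otimes> \<one>))
      = bind_pmf (convolution_power G \<mu> m) return_pmf"
    using set_convolution_power[OF \<mu>] by (intro bind_pmf_cong) (auto simp: subset_iff)
  then show ?case by (simp add: bind_return_pmf')
next
  case (Suc n)
  have "convolution_power G \<mu> (m + Suc n) = bind_pmf (convolution_power G \<mu> m) (\<lambda>w.
      bind_pmf (convolution_power G \<mu> n) (\<lambda>v. map_pmf (\<lambda>g. (w \<otimes> v) \<otimes> g) \<mu>))"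
    using Suc by (simp add: bind_assoc_pmf bind_map_pmf)
  also have "\<dots> = bind_pmf (convolution_power G \<mu> m) (\<lambda>w.
      bind_pmf (convolution_power G \<mu> n) (\<lambda>v. map_pmf (\<lambda>g. w \<otimes> (v \<otimes> g)) \<mu>))"
    using set_convolution_power[OF \<mu>] \<mu>
    by (intro bind_pmf_cong map_pmf_cong refl) (auto simp: m_assoc subset_iff)
  finally show ?case by (simp add: map_bind_pmf pmf.map_comp comp_def)
qed

lemma convolution_power_support_mult:
  assumes \<mu>: "set_pmf \<mu> \<subseteq> carrier G"
    and "a \<in> set_pmf (convolution_power G \<mu> m)" "b \<in> set_pmf (convolution_power G \<mu> n)"
  shows "a \<otimes> b \<in> set_pmf (convolution_power G \<mu> (m + n))"
  using assms(2,3) unfolding convolution_power_add[OF \<mu>] by auto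

lemma convolution_power_support_pow:
  assumes \<mu>: "set_pmf \<mu> \<subseteq> carrier G" and "a \<in> set_pmf (convolution_power G \<mu> m)"
  shows "a [^] k \<in> set_pmf (convolution_power G \<mu> (k * m))"
proof (induction k)
  case (Suc k)
  then show ?case using convolution_power_support_mult[OF \<mu> Suc assms(2)] by (simp add: add.commute)
qed simp

lemma generated_semigroup_support:
  assumes \<mu>: "set_pmf \<mu> \<subseteq> carrier G" and "a \<in> generated_semigroup G (set_pmf \<mu>)"
  obtains n where "n \<ge> 1" "a \<in> set_pmf (convolution_power G \<mu> n)"
proof -
  from assms(2) have "\<exists>n\<ge>1. a \<in> set_pmf (convolution_power G \<mu> n)"
  proof induction
    case (incl s)
    then have "s \<in> set_pmf (convolution_power G \<mu> 1)" using \<mu> by (auto simp: subset_iff bind_return_pmf)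
    then show ?case by blast
  next
    case (mult a b)
    then obtain m n where "m \<ge> 1" "n \<ge> 1" "a \<in> set_pmf (convolution_power G \<mu> m)"
      "b \<in> set_pmf (convolution_power G \<mu> n)" by blast
    then show ?case using convolution_power_support_mult[OF \<mu>, of a m b n] by (intro exI[of _ "m + n"]) auto
  qed
  then show ?thesis using that by blast
qed

end

lemma gromov_product_lipschitz: "gromov_product w x y \<le> gromov_product w x' y + dist x x'"
  unfolding gromov_product_def using dist_triangle[of w x x'] dist_triangle[of x' y x]
  by (simp add: dist_commute field_simps)

section \<open>Separation of conjugates of independent loxodromic elements\<close>

context hyperbolic_action
begin

lemma act_gromov_product:
  "g \<in> carrier G \<Longrightarrow> gromov_product (\<phi> g w) (\<phi> g x) (\<phi> g y) = gromov_product w x y"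
  unfolding gromov_product_def by (simp add: act_isometry)

lemma dist_conj_le:
  assumes "a \<in> carrier G" "b \<in> carrier G"
  shows "dist x0 (\<phi> b x0) - 2 * dist x0 (\<phi> a x0) \<le> dist x0 (\<phi> (a \<otimes> b \<otimes> inv a) x0)"
proof -
  have i: "dist (\<phi> (inv a) x0) x0 = dist x0 (\<phi> a x0)"
    using act_isometry[of a "\<phi> (inv a) x0" x0] assms act_inv by (simp add: dist_commute)
  have "dist x0 (\<phi> (a \<otimes> b \<otimes> inv a) x0) = dist (\<phi> (inv a) x0) (\<phi> b (\<phi> (inv a) x0))"
    using assms act_dist_left[of "inv a" x0 "\<phi> b (\<phi> (inv a) x0)"] by (simp add: act_mult)
  moreover have "dist x0 (\<phi> b x0) \<le> dist x0 (\<phi> (inv a) x0) + dist (\<phi> (inv a) x0) (\<phi> b (\<phi> (inv a) x0))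
      + dist (\<phi> b (\<phi> (inv a) x0)) (\<phi> b x0)"
    using dist_triangle[of x0 "\<phi> b x0" "\<phi> (inv a) x0"]
      dist_triangle[of "\<phi> (inv a) x0" "\<phi> b x0" "\<phi> b (\<phi> (inv a) x0)"] by simp
  ultimately show ?thesis using i assms by (simp add: act_isometry dist_commute)
qed

text \<open>The orbit of \<open>h\<close> stays away from the direction of
  \<open>g [^] (- p)\<close>, so its translate by \<open>g [^] p\<close> lies in the shadow of
  \<open>orbit_pt g p\<close>. That direction has product at most \<open>C\<close> with the
  untranslated orbit of \<open>h\<close>.\<close>

lemma schottky_separation:
  assumes g: "g \<in> carrier G" and h: "h \<in> carrier G"
    and C: "\<And>a b. gp (orbit_pt g a) (orbit_pt h b) \<le> C"
    and p: "2 * C + D < dist x0 (orbit_pt g p)"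
  shows "gp (orbit_pt h k) (\<phi> (g [^] p) (orbit_pt h l)) \<le> C + D"
proof -
  let ?y = "\<phi> (g [^] p) (orbit_pt h l)"
  have m: "dist (orbit_pt g (- p)) x0 = dist x0 (orbit_pt g p)"
    using dist_orbit_pt[OF g, of "- p" 0] dist_orbit_pt[OF g, of 0 p] orbit_pt_0[OF g] by simp
  have "dist x0 ?y = dist (orbit_pt g (- p)) (orbit_pt h l)"
    using act_isometry[of "g [^] p" "orbit_pt g (- p)" "orbit_pt h l"] act_orbit_pt[OF g, of p "- p"] g
    by (simp add: orbit_pt_0)
  moreover have "dist (orbit_pt g p) ?y = dist x0 (orbit_pt h l)"
    using act_isometry[of "g [^] p" x0 "orbit_pt h l"] g unfolding orbit_pt_def by simp
  ultimately have "gp (orbit_pt g p) ?y = dist x0 (orbit_pt g p) - gp (orbit_pt g (- p)) (orbit_pt h l)"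
    using m unfolding gromov_product_def by (simp add: dist_commute field_simps)
  then have "C + D < gp (orbit_pt g p) ?y" using C[of "- p" l] p by linarith
  then show ?thesis
    using C[of p k] gp_four_point[of "orbit_pt h k" ?y "orbit_pt g p"]
      gromov_product_commute[of x0 "orbit_pt h k" "orbit_pt g p"] gromov_product_commute[of x0 ?y "orbit_pt g p"]
    by linarith
qed

text \<open>Moving the basepoint to \<open>orbit_pt g p\<close> reduces the estimate to
  \<open>schottky_separation\<close> with exponent q - p. This costs one \<open>E\<close>; replacing
  each of the two conjugates by a translated orbit point of \<open>h\<close> costs one more.\<close>

lemma conj_separation:
  fixes p q k l :: int
  assumes g: "g \<in> carrier G" and h: "h \<in> carrier G"
    and C: "\<And>a b. gp (orbit_pt g a) (orbit_pt h b) \<le> C"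
    and p: "2 * C + D < dist x0 (orbit_pt g (q - p))"
    and E: "dist x0 (orbit_pt g p) \<le> E" "dist x0 (orbit_pt g q) \<le> E"
  shows "gp (\<phi> (g [^] p \<otimes> h [^] k \<otimes> inv (g [^] p)) x0) (\<phi> (g [^] q \<otimes> h [^] l \<otimes> inv (g [^] q)) x0)
    \<le> C + D + 3 * E"
proof -
  define x where "x = \<phi> (g [^] p) (orbit_pt h k)"
  define y where "y = \<phi> (g [^] q) (orbit_pt h l)"
  have near: "dist (\<phi> (g [^] r \<otimes> h [^] m \<otimes> inv (g [^] r)) x0) (\<phi> (g [^] r) (orbit_pt h m)) = dist x0 (orbit_pt g r)"
    for r m :: int
    using g h act_isometry[of "g [^] r \<otimes> h [^] m" "\<phi> (inv (g [^] r)) x0" x0]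
      act_dist_left[of "inv (g [^] r)" x0 x0]
    by (simp add: orbit_pt_def act_mult)
  have "gp x y \<le> gromov_product (orbit_pt g p) x y + dist x0 (orbit_pt g p)"
    by (rule gromov_product_base_change)
  also have "gromov_product (orbit_pt g p) x y = gp (orbit_pt h k) (\<phi> (g [^] (q - p)) (orbit_pt h l))"
  proof -
    have "y = \<phi> (g [^] p) (\<phi> (g [^] (q - p)) (orbit_pt h l))"
      using g act_mult[of "g [^] p" "g [^] (q - p)" "orbit_pt h l"] int_pow_mult[OF g, of p "q - p"]
      unfolding y_def by simp
    then show ?thesis using act_gromov_product[of "g [^] p" x0] g unfolding x_def orbit_pt_def by simp
  qed
  also have "\<dots> \<le> C + D" by (rule schottky_separation[OF g h C p])
  finally have "gp x y \<le> C + D + E" using E by simp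
  then show ?thesis
    using near[of p k] near[of q l] E
      gromov_product_lipschitz[of x0 "\<phi> (g [^] p \<otimes> h [^] k \<otimes> inv (g [^] p)) x0" y x]
      gromov_product_lipschitz[of x0 "\<phi> (g [^] q \<otimes> h [^] l \<otimes> inv (g [^] q)) x0" "\<phi> (g [^] p \<otimes> h [^] k \<otimes> inv (g [^] p)) x0" y]
      gromov_product_commute[of x0 y "\<phi> (g [^] p \<otimes> h [^] k \<otimes> inv (g [^] p)) x0"]
      gromov_product_commute[of x0 "\<phi> (g [^] q \<otimes> h [^] l \<otimes> inv (g [^] q)) x0" "\<phi> (g [^] p \<otimes> h [^] k \<otimes> inv (g [^] p)) x0"]
    unfolding x_def[symmetric] y_def[symmetric] by linarith
qed

text \<open>Inverses keep the shape of the family with the exponent negated, so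
  \<open>conj_separation\<close> covers the directions of the inverses too.\<close>

lemma inv_conj_pow:
  fixes k :: int
  assumes "a \<in> carrier G" "h \<in> carrier G"
  shows "inv (a \<otimes> h [^] k \<otimes> inv a) = a \<otimes> h [^] (- k) \<otimes> inv a"
  using assms by (simp add: inv_mult_group int_pow_neg m_assoc)

text \<open>
  The order of quantifiers matters: \<open>C\<close> is chosen before \<open>L\<close>. The family consists of conjugates
  \<open>g\<^sup>P\<^sup>i h\<^sup>m g\<^sup>-\<^sup>P\<^sup>i\<close> whose exponents \<open>m\<close> depend on \<open>i\<close> so that all words have the same length.
\<close>

lemma exists_schottky_family:
  fixes M :: nat
  assumes \<mu>: "set_pmf \<mu> \<subseteq> carrier G" and ne: "non_elementary_measure G \<phi> x0 \<mu>"
  obtains C where "\<And>L. \<exists>n\<ge>1. \<exists>s. \<forall>i<M. s i \<in> set_pmf (convolution_power G \<mu> n) \<and>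
    L \<le> dist x0 (\<phi> (s i) x0) \<and>
    (\<forall>j<M. i \<noteq> j \<longrightarrow> gp (\<phi> (s i) x0) (\<phi> (s j) x0) \<le> C \<and> gp (\<phi> (inv (s i)) x0) (\<phi> (inv (s j)) x0) \<le> C)"
proof -
  define \<Gamma> where "\<Gamma> = generated_semigroup G (set_pmf \<mu>)"
  have \<Gamma>: "subgroup \<Gamma> G" using ne unfolding non_elementary_measure_def \<Gamma>_def by (simp add: Let_def)
  obtain g h where gh: "g \<in> \<Gamma>" "h \<in> \<Gamma>" "loxodromic (\<phi> g)" "loxodromic (\<phi> h)"
    "boundary_fixed_points x0 (\<phi> g) \<inter> boundary_fixed_points x0 (\<phi> h) = {}"
    using ne unfolding non_elementary_measure_def non_elementary_action_def \<Gamma>_def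
    by (auto simp: Let_def)
  have g: "g \<in> carrier G" and h: "h \<in> carrier G" using gh \<Gamma> subgroup.subset by blast+
  obtain C1 where C1: "\<And>a b. gp (orbit_pt g a) (orbit_pt h b) \<le> C1"
    using loxodromic_independent[OF g gh(3) h gh(4,5)] by blast
  obtain \<tau> where \<tau>: "0 < \<tau>" "\<And>n::int. real_of_int \<bar>n\<bar> * \<tau> \<le> dist x0 (orbit_pt g n)"
    using loxodromic_orbit_pt_lower[OF g gh(3)] by blast
  obtain \<upsilon> where \<upsilon>: "0 < \<upsilon>" "\<And>n::int. real_of_int \<bar>n\<bar> * \<upsilon> \<le> dist x0 (orbit_pt h n)"
    using loxodromic_orbit_pt_lower[OF h gh(4)] by blast
  obtain a where a: "a \<ge> 1" "g \<in> set_pmf (convolution_power G \<mu> a)"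
    using generated_semigroup_support[OF \<mu>] gh(1) unfolding \<Gamma>_def by blast
  obtain a' where a': "a' \<ge> 1" "inv g \<in> set_pmf (convolution_power G \<mu> a')"
    using generated_semigroup_support[OF \<mu>] subgroup.m_inv_closed[OF \<Gamma> gh(1)] unfolding \<Gamma>_def by blast
  obtain b where b: "b \<ge> 1" "h \<in> set_pmf (convolution_power G \<mu> b)"
    using generated_semigroup_support[OF \<mu>] gh(2) unfolding \<Gamma>_def by blast
  define P' where "P' = Suc (nat \<lceil>(2 * C1 + D) / \<tau>\<rceil>)"
  \<comment> \<open>\<open>P'\<close> makes distinct conjugators far enough apart for
    \<open>conj_separation\<close>. The factor \<open>b\<close> makes the word lengths of the
    conjugators multiples of the length of \<open>h\<close>, so that the exponent of
    \<open>h\<close> can compensate for their differences.\<close>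
  define P where "P = P' * b"
  \<comment> \<open>\<open>E\<close> depends on the conjugators alone, hence not on the later choice
    of \<open>L\<close>.\<close>
  define E where "E = (\<Sum>i<M. dist x0 (orbit_pt g (int (P * i))))"
  have E: "dist x0 (orbit_pt g (int (P * i))) \<le> E" if "i < M" for i
    unfolding E_def using that by (intro member_le_sum) auto
  have far: "2 * C1 + D < dist x0 (orbit_pt g (int (P * j) - int (P * i)))" if "i \<noteq> j" for i j
  proof -
    have "(2 * C1 + D) / \<tau> < real P'" unfolding P'_def by linarith
    then have "2 * C1 + D < real P' * \<tau>" using \<tau>(1) by (simp add: field_simps)
    also have "\<dots> \<le> real_of_int \<bar>int (P * j) - int (P * i)\<bar> * \<tau>"
    proof -
      have "1 * 1 \<le> int b * \<bar>int j - int i\<bar>"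
        using that b(1) by (intro mult_mono) auto
      then have "int P' * 1 \<le> int P' * (int b * \<bar>int j - int i\<bar>)"
        by (intro mult_left_mono) auto
      also have "\<dots> = \<bar>int (P * j) - int (P * i)\<bar>"
      proof -
        have "int (P * j) - int (P * i) = (int P' * int b) * (int j - int i)"
          unfolding P_def by (simp add: algebra_simps)
        then show ?thesis by (simp add: abs_mult)
      qed
      finally have "real_of_int (int P') \<le> real_of_int \<bar>int (P * j) - int (P * i)\<bar>" by linarith
      then show ?thesis using \<tau>(1) by (intro mult_right_mono) auto
    qed
    also have "\<dots> \<le> dist x0 (orbit_pt g (int (P * j) - int (P * i)))" by (rule \<tau>(2))
    finally show ?thesis .
  qed
  show ?thesis
  proof (rule that[of "C1 + D + 3 * E"])
    fix L :: real
    define k0 where "k0 = Suc (nat \<lceil>(L + 2 * E) / \<upsilon>\<rceil>)"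
    \<comment> \<open>All words get length k b. The first summand keeps the subtraction in
      \<open>m\<close> from truncating, and \<open>k0\<close> is the exponent that remains in every
      case and produces the displacement \<open>L\<close>.\<close>
    define k where "k = M * P' * (a + a') + k0"
    define m where "m i = k - i * P' * (a + a')" for i
    define s where "s i = g [^] (int (P * i)) \<otimes> h [^] int (m i) \<otimes> inv (g [^] (int (P * i)))" for i
    have supp: "s i \<in> set_pmf (convolution_power G \<mu> (k * b))" if "i < M" for i
    proof -
      have "inv (g [^] (int (P * i))) = inv g [^] (P * i)"
        unfolding int_pow_int using g by (simp add: nat_pow_inv)
      then have "s i = (g [^] (P * i) \<otimes> h [^] m i) \<otimes> inv g [^] (P * i)"
        unfolding s_def by (simp only: int_pow_int)
      moreover have "k * b = P * i * a + m i * b + P * i * a'"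
      proof -
        have "i * P' * (a + a') \<le> M * P' * (a + a')" using that by (intro mult_right_mono) auto
        then have "k = i * P' * (a + a') + m i" unfolding k_def m_def by linarith
        then show ?thesis unfolding P_def by (simp add: algebra_simps)
      qed
      ultimately show ?thesis
        using convolution_power_support_mult[OF \<mu> convolution_power_support_mult[OF \<mu>]]
          convolution_power_support_pow[OF \<mu>] a a' b by metis
    qed
    have long: "L \<le> dist x0 (\<phi> (s i) x0)" if "i < M" for i
    proof -
      have "i * P' * (a + a') \<le> M * P' * (a + a')" using that by (intro mult_right_mono) auto
      then have "k0 \<le> m i" unfolding k_def m_def by linarith
      have "(L + 2 * E) / \<upsilon> \<le> real k0" unfolding k0_def by linarith
      then have "L + 2 * E \<le> real k0 * \<upsilon>" using \<upsilon>(1) by (simp add: field_simps)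
      also have "\<dots> \<le> real_of_int \<bar>int (m i)\<bar> * \<upsilon>" using \<open>k0 \<le> m i\<close> \<upsilon>(1) by (intro mult_right_mono) auto
      also have "\<dots> \<le> dist x0 (orbit_pt h (int (m i)))" by (rule \<upsilon>(2))
      finally show ?thesis
        using dist_conj_le[of "g [^] (int (P * i))" "h [^] int (m i)"] g h E[OF that]
        unfolding s_def orbit_pt_def by simp
    qed
    have sep: "gp (\<phi> (s i) x0) (\<phi> (s j) x0) \<le> C1 + D + 3 * E"
      "gp (\<phi> (inv (s i)) x0) (\<phi> (inv (s j)) x0) \<le> C1 + D + 3 * E" if "i < M" "j < M" "i \<noteq> j" for i j
    proof -
      show "gp (\<phi> (s i) x0) (\<phi> (s j) x0) \<le> C1 + D + 3 * E"
        unfolding s_def by (rule conj_separation[OF g h C1 far E E]) (use that in auto)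
      have "inv (s i) = g [^] (int (P * i)) \<otimes> h [^] (- int (m i)) \<otimes> inv (g [^] (int (P * i)))" for i
        unfolding s_def using g h by (intro inv_conj_pow) auto
      then show "gp (\<phi> (inv (s i)) x0) (\<phi> (inv (s j)) x0) \<le> C1 + D + 3 * E"
        using conj_separation[OF g h C1 far E E] that by simp
    qed
    have "k * b \<ge> 1" using b unfolding k_def k0_def by simp
    with supp long sep show "\<exists>n\<ge>1. \<exists>s. \<forall>i<M. s i \<in> set_pmf (convolution_power G \<mu> n) \<and>
      L \<le> dist x0 (\<phi> (s i) x0) \<and> (\<forall>j<M. i \<noteq> j \<longrightarrow> gp (\<phi> (s i) x0) (\<phi> (s j) x0) \<le> C1 + D + 3 * E \<and>
        gp (\<phi> (inv (s i)) x0) (\<phi> (inv (s j)) x0) \<le> C1 + D + 3 * E)"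
      by (intro exI[of _ "k * b"] exI[of _ s] conjI) auto
  qed
qed

end

section \<open>Exponential escape\<close>

lemma energy_reindex:
  assumes "bij_betw h N I"
  shows "energy N (\<lambda>n. y (h n)) N (\<lambda>n. y (h n)) = energy I y I y"
proof -
  have "energy I y I y = (\<Sum>n\<in>N. \<Sum>j\<in>I. exp (- dist (y (h n)) (y j)))"
    unfolding energy_def by (rule sum.reindex_bij_betw[OF assms, symmetric])
  also have "\<dots> = (\<Sum>n\<in>N. \<Sum>m\<in>N. exp (- dist (y (h n)) (y (h m))))"
    by (intro sum.cong refl sum.reindex_bij_betw[OF assms, symmetric])
  finally show ?thesis unfolding energy_def by simp
qed

text \<open>Two points in the ball are at distance at most 2 R, so each such pair contributes at
  least exp(- 2 R) to the energy, and the pairs number the square of the count.\<close>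

lemma count_ball_le_energy:
  fixes y :: "'i \<Rightarrow> 'x::metric_space"
  assumes "finite I"
  shows "(\<Sum>i\<in>I. if dist x0 (y i) \<le> R then 1 else 0) \<le> exp R * sqrt (energy I y I y)"
proof -
  let ?b = "\<lambda>i. if dist x0 (y i) \<le> R then 1 else 0 :: real"
  have "(\<Sum>i\<in>I. ?b i)\<^sup>2 = (\<Sum>i\<in>I. \<Sum>j\<in>I. ?b i * ?b j)"
    by (simp add: power2_eq_square sum_product)
  also have "\<dots> \<le> (\<Sum>i\<in>I. \<Sum>j\<in>I. exp (2 * R) * exp (- dist (y i) (y j)))"
  proof (intro sum_mono)
    fix i j
    have "dist (y i) (y j) \<le> 2 * R" if "dist x0 (y i) \<le> R" "dist x0 (y j) \<le> R"
      using that dist_triangle[of "y i" "y j" x0] by (simp add: dist_commute)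
    then show "?b i * ?b j \<le> exp (2 * R) * exp (- dist (y i) (y j))"
      by (auto simp flip: exp_add)
  qed
  also have "\<dots> = exp (2 * R) * energy I y I y"
    unfolding energy_def by (simp only: sum_distrib_left)
  also have "\<dots> = (exp R * sqrt (energy I y I y))\<^sup>2"
    by (simp add: power_mult_distrib energy_nonneg exp_double)
  finally show ?thesis
    by (rule power2_le_imp_le) (simp add: energy_nonneg)
qed

lemma measure_bind_pmf_eq:
  "measure_pmf.prob (bind_pmf p f) A = (\<integral>x. measure_pmf.prob (f x) A \<partial>measure_pmf p)"
proof -
  have "ennreal (measure_pmf.prob (bind_pmf p f) A) = (\<integral>\<^sup>+x. ennreal (measure_pmf.prob (f x) A) \<partial>measure_pmf p)"
    using emeasure_bind_pmf[of p f A] by (simp add: measure_pmf.emeasure_eq_measure)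
  also have "\<dots> = ennreal (\<integral>x. measure_pmf.prob (f x) A \<partial>measure_pmf p)"
    by (intro nn_integral_eq_integral measure_pmf.integrable_const_bound[where B = 1]) auto
  finally show ?thesis by (subst (asm) ennreal_inj) auto
qed

text \<open>Each atom alone lowers the integral below \<open>U\<close> by at least c (U - F (s i));
  averaging this over \<open>i\<close> brings in the mean of the \<open>F (s i)\<close>. Taking one
  atom at a time allows repetitions among the \<open>s i\<close>.\<close>

lemma pmf_integral_le_if_small_average:
  fixes F :: "'g \<Rightarrow> real" and s :: "nat \<Rightarrow> 'g"
  assumes F: "\<And>g. g \<in> set_pmf p \<Longrightarrow> 0 \<le> F g \<and> F g \<le> U"
    and s: "\<And>i. i < M \<Longrightarrow> c \<le> pmf p (s i)" "\<And>i. i < M \<Longrightarrow> s i \<in> set_pmf p" and c: "0 \<le> c"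
    and M: "0 < M" and avg: "(\<Sum>i<M. F (s i)) \<le> U * real M / 2"
  shows "(\<integral>g. F g \<partial>measure_pmf p) \<le> (1 - c / 2) * U"
proof -
  have int: "integrable (measure_pmf p) F"
    using F by (intro measure_pmf.integrable_const_bound[where B = U]) (auto simp: AE_measure_pmf_iff)
  have each: "c * (U - F (s i)) \<le> U - (\<integral>g. F g \<partial>measure_pmf p)" if i: "i < M" for i
  proof -
    have ind: "integrable (measure_pmf p) (\<lambda>g. indicator {s i} g * (U - F (s i)))"
      by (intro measure_pmf.integrable_const_bound[where B = "\<bar>U - F (s i)\<bar>"]) (auto simp: indicator_def)
    have "c * (U - F (s i)) \<le> pmf p (s i) * (U - F (s i))"
      using s[OF i] F by (intro mult_right_mono) auto
    also have "\<dots> = (\<integral>g. indicator {s i} g * (U - F (s i)) \<partial>measure_pmf p)"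
      by (simp add: measure_pmf_single)
    also have "\<dots> \<le> (\<integral>g. U - F g \<partial>measure_pmf p)"
      using F s(2)[OF i] int ind
      by (intro integral_mono_AE) (auto simp: AE_measure_pmf_iff indicator_def)
    also have "\<dots> = U - (\<integral>g. F g \<partial>measure_pmf p)" using int by simp
    finally show ?thesis .
  qed
  have "real M * (c * U / 2) \<le> c * (\<Sum>i<M. U - F (s i))"
    using avg c mult_left_mono[of "U * real M / 2" "\<Sum>i<M. U - F (s i)" c]
    by (simp add: sum_subtractf algebra_simps)
  also have "\<dots> \<le> (\<Sum>i<M. U - (\<integral>g. F g \<partial>measure_pmf p))"
    unfolding sum_distrib_left using each by (intro sum_mono) auto
  also have "\<dots> = real M * (U - (\<integral>g. F g \<partial>measure_pmf p))" by simp
  finally have "c * U / 2 \<le> U - (\<integral>g. F g \<partial>measure_pmf p)" using M by simp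
  then show ?thesis by (simp add: algebra_simps)
qed

section \<open>Decay of ball probabilities\<close>

context hyperbolic_action
begin

definition ball_prob :: "'g pmf \<Rightarrow> real \<Rightarrow> 'x \<Rightarrow> real" where
  "ball_prob p R y = measure_pmf.prob p {w. dist x0 (\<phi> w y) \<le> R}"

lemma ball_prob_bounds: "0 \<le> ball_prob p R y" "ball_prob p R y \<le> 1"
  unfolding ball_prob_def by simp_all

text \<open>The last increments of a product are the first to act on \<open>y\<close>, so
  conditioning on them only moves the starting point. This is how the induction peels off blocks of
  increments.\<close>

lemma ball_prob_convolution_power_add:
  assumes \<mu>: "set_pmf \<mu> \<subseteq> carrier G"
  shows "ball_prob (convolution_power G \<mu> (m + n)) R y =
    (\<integral>g. ball_prob (convolution_power G \<mu> m) R (\<phi> g y) \<partial>measure_pmf (convolution_power G \<mu> n))"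
proof -
  let ?p = "convolution_power G \<mu>"
  have "?p (m + n) = bind_pmf (?p m) (\<lambda>w. bind_pmf (?p n) (\<lambda>v. return_pmf (w \<otimes> v)))"
    unfolding convolution_power_add[OF \<mu>] map_pmf_def ..
  also have "\<dots> = bind_pmf (?p n) (\<lambda>v. map_pmf (\<lambda>w. w \<otimes> v) (?p m))"
    unfolding map_pmf_def by (rule bind_commute_pmf)
  finally have "ball_prob (?p (m + n)) R y
    = (\<integral>v. measure_pmf.prob (?p m) {w. dist x0 (\<phi> (w \<otimes> v) y) \<le> R} \<partial>measure_pmf (?p n))"
    unfolding ball_prob_def by (simp add: measure_bind_pmf_eq vimage_def)
  also have "\<dots> = (\<integral>v. ball_prob (?p m) R (\<phi> v y) \<partial>measure_pmf (?p n))"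
  proof (intro integral_cong_AE)
    show "AE v in measure_pmf (?p n). measure_pmf.prob (?p m) {w. dist x0 (\<phi> (w \<otimes> v) y) \<le> R} =
        ball_prob (?p m) R (\<phi> v y)"
      unfolding AE_measure_pmf_iff ball_prob_def
    proof
      fix v assume v: "v \<in> set_pmf (?p n)"
      then show "measure_pmf.prob (?p m) {w. dist x0 (\<phi> (w \<otimes> v) y) \<le> R} =
          measure_pmf.prob (?p m) {w. dist x0 (\<phi> w (\<phi> v y)) \<le> R}"
        using set_convolution_power[OF \<mu>]
        by (intro measure_pmf.finite_measure_eq_AE) (auto simp: AE_measure_pmf_iff act_mult subset_iff)
    qed
  qed auto
  finally show ?thesis .
qed

text \<open>The constants are chosen in the order \<open>K\<close>, \<open>M\<close>,
  \<open>C\<close>, \<open>L\<close>: \<open>M\<close> at least 8 K keeps the terms linear in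
  \<open>M\<close> below M^2 / 8, and \<open>L\<close>, still free once \<open>C\<close> is fixed,
  does the same to the quadratic term. Together they make (M/2)^2.\<close>

lemma contraction_step_of_schottky:
  assumes \<mu>: "set_pmf \<mu> \<subseteq> carrier G" and ne: "non_elementary_measure G \<phi> x0 \<mu>"
  obtains M n s where "M \<ge> (1::nat)" "n \<ge> (1::nat)" "\<forall>i<M. s i \<in> set_pmf (convolution_power G \<mu> n)"
    "\<forall>(I::nat set) y. finite I \<longrightarrow>
      energy ({..<M} \<times> I) (\<lambda>(t, i). \<phi> (s t) (y i)) ({..<M} \<times> I) (\<lambda>(t, i). \<phi> (s t) (y i))
        \<le> (real M / 2)\<^sup>2 * energy I y I y"
proof -
  define K where "K = (1 + 2 * energy_const) * (2 * energy_const + 1)"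
  have c: "0 \<le> energy_const" unfolding energy_const_def by simp
  have K: "1 \<le> K" "1 + 2 * energy_const \<le> K" unfolding K_def using c by (auto simp: algebra_simps)
  define M where "M = nat \<lceil>8 * K\<rceil>"
  have M: "8 * K \<le> real M" "M \<ge> 1" unfolding M_def using K by linarith+
  obtain C where C: "\<And>L. \<exists>n\<ge>1. \<exists>s. \<forall>i<M. s i \<in> set_pmf (convolution_power G \<mu> n) \<and>
    L \<le> dist x0 (\<phi> (s i) x0) \<and>
    (\<forall>j<M. i \<noteq> j \<longrightarrow> gp (\<phi> (s i) x0) (\<phi> (s j) x0) \<le> C \<and> gp (\<phi> (inv (s i)) x0) (\<phi> (inv (s j)) x0) \<le> C)"
    using exists_schottky_family[OF \<mu> ne, of M] by blast
  \<comment> \<open>The first entry is the threshold for ping-pong, the second brings the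
    off-diagonal factor down to 1 / (8 K).\<close>
  define L where "L = max (2 * C + 3 * D + 1) ((6 * C + 8 * D + ln (8 * K)) / 2)"
  have L: "2 * C + 3 * D < L" unfolding L_def by linarith
  have "ln (8 * K) \<le> 2 * L - 6 * C - 8 * D" unfolding L_def by (simp add: field_simps max_def)
  then have "exp (- (2 * L - 6 * C - 8 * D)) \<le> exp (- ln (8 * K))" by simp
  also have "\<dots> = 1 / (8 * K)" using K by (simp add: exp_minus inverse_eq_divide)
  finally have eps: "exp (- (2 * L - 6 * C - 8 * D)) \<le> 1 / (8 * K)" .
  obtain n s where n: "n \<ge> 1" and s: "\<And>i. i < M \<Longrightarrow> s i \<in> set_pmf (convolution_power G \<mu> n)"
    "\<And>i. i < M \<Longrightarrow> L \<le> dist x0 (\<phi> (s i) x0)"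
    "\<And>i j. i < M \<Longrightarrow> j < M \<Longrightarrow> i \<noteq> j \<Longrightarrow> gp (\<phi> (s i) x0) (\<phi> (s j) x0) \<le> C"
    "\<And>i j. i < M \<Longrightarrow> j < M \<Longrightarrow> i \<noteq> j \<Longrightarrow> gp (\<phi> (inv (s i)) x0) (\<phi> (inv (s j)) x0) \<le> C"
    using C[of L] by blast
  have sc: "s i \<in> carrier G" if "i < M" for i
    using s(1)[OF that] set_convolution_power[OF \<mu>] by blast
  show ?thesis
  proof (rule that[OF M(2) n])
    show "\<forall>i<M. s i \<in> set_pmf (convolution_power G \<mu> n)" using s(1) by blast
  next
    show "\<forall>(I::nat set) y. finite I \<longrightarrow>
      energy ({..<M} \<times> I) (\<lambda>(t, i). \<phi> (s t) (y i)) ({..<M} \<times> I) (\<lambda>(t, i). \<phi> (s t) (y i))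
        \<le> (real M / 2)\<^sup>2 * energy I y I y"
    proof (intro allI impI)
      fix I :: "nat set" and y assume I: "finite I"
      have "energy ({..<M} \<times> I) (\<lambda>(t, i). \<phi> (s t) (y i)) ({..<M} \<times> I) (\<lambda>(t, i). \<phi> (s t) (y i))
        \<le> (1 + 2 * energy_const) * (2 * energy_const * M + M + (real M)\<^sup>2 * exp (- (2 * L - 6 * C - 8 * D)))
        * energy I y I y"
        using sc s L by (intro energy_contraction[where q = "\<lambda>i. \<phi> (inv (s i)) x0"] I) (auto simp: act_isometry act_dist_left act_inv)
      also have "\<dots> \<le> (real M / 2)\<^sup>2 * energy I y I y"
      proof (intro mult_right_mono energy_nonneg)
        have "(1 + 2 * energy_const) * (2 * energy_const * M + M) = K * M"
          unfolding K_def by (simp add: algebra_simps)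
        also have "\<dots> \<le> real M / 8 * M" using M by (intro mult_right_mono) auto
        finally have 1: "(1 + 2 * energy_const) * (2 * energy_const * M + M) \<le> (real M)\<^sup>2 / 8"
          by (simp add: power2_eq_square)
        have "(1 + 2 * energy_const) * ((real M)\<^sup>2 * exp (- (2 * L - 6 * C - 8 * D)))
          \<le> K * ((real M)\<^sup>2 * (1 / (8 * K)))"
          using K c eps by (intro mult_mono mult_left_mono mult_nonneg_nonneg) auto
        also have "\<dots> = (real M)\<^sup>2 / 8" using K by simp
        finally have 2: "(1 + 2 * energy_const) * ((real M)\<^sup>2 * exp (- (2 * L - 6 * C - 8 * D))) \<le> (real M)\<^sup>2 / 8" .
        have "(1 + 2 * energy_const) * (2 * energy_const * M + M + (real M)\<^sup>2 * exp (- (2 * L - 6 * C - 8 * D)))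
          \<le> (real M)\<^sup>2 / 8 + (real M)\<^sup>2 / 8"
          using add_mono[OF 1 2] by (simp only: distrib_left)
        also have "\<dots> = (real M / 2)\<^sup>2" by (simp add: power_divide)
        finally show "(1 + 2 * energy_const) * (2 * energy_const * M + M + (real M)\<^sup>2 * exp (- (2 * L - 6 * C - 8 * D)))
          \<le> (real M / 2)\<^sup>2" .
      qed
      finally show "energy ({..<M} \<times> I) (\<lambda>(t, i). \<phi> (s t) (y i)) ({..<M} \<times> I) (\<lambda>(t, i). \<phi> (s t) (y i))
          \<le> (real M / 2)\<^sup>2 * energy I y I y" .
    qed
  qed
qed

text \<open>
  The index set changes from \<open>I\<close> to \<open>{..<M} \<times> I\<close> in each induction step, so it is transported back
  to a set of naturals.
\<close>

lemma ball_prob_le_energy: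
  fixes M n :: nat
  assumes \<mu>: "set_pmf \<mu> \<subseteq> carrier G" and M: "M \<ge> 1"
    and s: "\<And>i. i < M \<Longrightarrow> s i \<in> set_pmf (convolution_power G \<mu> n)"
    and c: "0 \<le> c" "c \<le> 1" "\<And>i. i < M \<Longrightarrow> c \<le> pmf (convolution_power G \<mu> n) (s i)"
    and contr: "\<And>(I::nat set) y. finite I \<Longrightarrow>
      energy ({..<M} \<times> I) (\<lambda>(t, i). \<phi> (s t) (y i)) ({..<M} \<times> I) (\<lambda>(t, i). \<phi> (s t) (y i))
        \<le> (real M / 2)\<^sup>2 * energy I y I y"
    and I: "finite (I :: nat set)"
  shows "(\<Sum>i\<in>I. ball_prob (convolution_power G \<mu> (k * n)) R (y i))
    \<le> exp R * (1 - c / 2) ^ k * sqrt (energy I y I y)"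
  using I
proof (induction k arbitrary: I y)
  case 0
  have "ball_prob (convolution_power G \<mu> (0 * n)) R z = (if dist x0 z \<le> R then 1 else 0)" for z
    unfolding ball_prob_def by (simp add: act_one indicator_def measure_return_pmf)
  then show ?case using count_ball_le_energy[OF 0] by simp
next
  case (Suc k)
  let ?p = "convolution_power G \<mu>"
  define F where "F g = (\<Sum>i\<in>I. ball_prob (?p (k * n)) R (\<phi> g (y i)))" for g
  define U where "U = exp R * (1 - c / 2) ^ k * sqrt (energy I y I y)"
  have nonneg: "0 \<le> exp R * (1 - c / 2) ^ k" using c by simp
  have F: "0 \<le> F g \<and> F g \<le> U" if "g \<in> set_pmf (?p n)" for g
  proof -
    have "g \<in> carrier G" using that set_convolution_power[OF \<mu>] by blast
    then have "energy I (\<lambda>i. \<phi> g (y i)) I (\<lambda>i. \<phi> g (y i)) = energy I y I y"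
      by (intro energy_isometry act_isometry)
    then show ?thesis
      using Suc.IH[OF Suc.prems, of "\<lambda>i. \<phi> g (y i)"] unfolding F_def U_def
      by (auto intro: sum_nonneg ball_prob_bounds)
  qed
  have avg: "(\<Sum>t<M. F (s t)) \<le> U * real M / 2"
  proof -
    let ?P = "{..<M} \<times> I" and ?z = "\<lambda>(t, i). \<phi> (s t) (y i)"
    obtain h where h: "bij_betw h {0..<card ?P} ?P"
      using ex_bij_betw_nat_finite[of ?P] Suc.prems by auto
    have "(\<Sum>t<M. F (s t)) = (\<Sum>q\<in>?P. ball_prob (?p (k * n)) R (?z q))"
      unfolding F_def by (simp add: sum.cartesian_product case_prod_beta)
    also have "\<dots> = (\<Sum>m\<in>{0..<card ?P}. ball_prob (?p (k * n)) R (?z (h m)))"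
      by (rule sum.reindex_bij_betw[OF h, symmetric])
    also have "\<dots> \<le> exp R * (1 - c / 2) ^ k * sqrt (energy {0..<card ?P} (\<lambda>m. ?z (h m)) {0..<card ?P} (\<lambda>m. ?z (h m)))"
      by (rule Suc.IH) simp
    also have "\<dots> = exp R * (1 - c / 2) ^ k * sqrt (energy ?P ?z ?P ?z)"
      unfolding energy_reindex[OF h] ..
    also have "\<dots> \<le> exp R * (1 - c / 2) ^ k * sqrt ((real M / 2)\<^sup>2 * energy I y I y)"
      using nonneg by (intro mult_left_mono real_sqrt_le_mono contr Suc.prems) auto
    also have "\<dots> = U * real M / 2" unfolding U_def by (simp add: real_sqrt_mult)
    finally show ?thesis .
  qed
  have "(\<Sum>i\<in>I. ball_prob (?p (Suc k * n)) R (y i))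
    = (\<Sum>i\<in>I. \<integral>g. ball_prob (?p (k * n)) R (\<phi> g (y i)) \<partial>measure_pmf (?p n))"
    using ball_prob_convolution_power_add[OF \<mu>, of "k * n" n R] by (simp add: add.commute)
  also have "\<dots> = (\<integral>g. F g \<partial>measure_pmf (?p n))"
    unfolding F_def
    by (subst Bochner_Integration.integral_sum)
      (auto intro!: measure_pmf.integrable_const_bound[where B = 1] simp: ball_prob_bounds)
  also have "\<dots> \<le> (1 - c / 2) * U"
    using M by (intro pmf_integral_le_if_small_average[where M = M and s = s] F s c avg) auto
  finally show ?case unfolding U_def by (simp add: algebra_simps)
qed

theorem exponential_escape:
  assumes \<mu>: "set_pmf \<mu> \<subseteq> carrier G" and ne: "non_elementary_measure G \<phi> x0 \<mu>"
  obtains b C where "0 < b" "0 \<le> C"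
    "\<And>n R. measure_pmf.prob (convolution_power G \<mu> n) {w. dist x0 (\<phi> w x0) \<le> R} \<le> C * exp (R - b * real n)"
proof -
  let ?p = "convolution_power G \<mu>"
  obtain M N s where M: "M \<ge> (1::nat)" and N: "N \<ge> (1::nat)" and s_all: "\<forall>i<M. s i \<in> set_pmf (?p N)"
    and contr: "\<forall>(I::nat set) y. finite I \<longrightarrow>
      energy ({..<M} \<times> I) (\<lambda>(t, i). \<phi> (s t) (y i)) ({..<M} \<times> I) (\<lambda>(t, i). \<phi> (s t) (y i))
        \<le> (real M / 2)\<^sup>2 * energy I y I y"
    by (rule contraction_step_of_schottky[OF \<mu> ne])
  have s: "s i \<in> set_pmf (?p N)" if "i < M" for i using s_all that by blast
  define c where "c = Min ((\<lambda>i. pmf (?p N) (s i)) ` {..<M})"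
  have c: "c \<le> pmf (?p N) (s i)" if "i < M" for i
    unfolding c_def using that by (intro Min_le) auto
  have "c \<in> (\<lambda>i. pmf (?p N) (s i)) ` {..<M}"
    unfolding c_def using M by (intro Min_in) (auto simp: lessThan_empty_iff)
  then have c01: "0 < c" "c \<le> 1" using s by (auto simp: pmf_positive pmf_le_1)
  define \<rho> where "\<rho> = 1 - c / 2"
  have \<rho>: "1 / 2 \<le> \<rho>" "\<rho> < 1" unfolding \<rho>_def using c01 by auto
  have decay: "ball_prob (?p (k * N)) R y \<le> exp R * \<rho> ^ k" for k R y
    using ball_prob_le_energy[OF \<mu> M s _ c01(2) c contr[rule_format], of "{0}" k R "\<lambda>_. y"] c01(1)
    unfolding \<rho>_def energy_def by simp
  define b where "b = - ln \<rho> / real N"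
  have "ln \<rho> < 0" using \<rho> by (intro ln_less_zero) auto
  then have b: "0 < b" unfolding b_def using N by (simp add: divide_neg_pos)
  show ?thesis
  proof (rule that[of b 2])
    fix n R
    define k where "k = n div N"
    \<comment> \<open>The \<open>n mod N\<close> surplus increments move the starting point, and
      \<open>decay\<close> is uniform in it.\<close>
    have "n = k * N + n mod N" unfolding k_def by simp
    then have "measure_pmf.prob (?p n) {w. dist x0 (\<phi> w x0) \<le> R} =
      (\<integral>g. ball_prob (?p (k * N)) R (\<phi> g x0) \<partial>measure_pmf (?p (n mod N)))"
      using ball_prob_convolution_power_add[OF \<mu>, of "k * N" "n mod N" R x0] unfolding ball_prob_def by simp
    also have "\<dots> \<le> (\<integral>g. exp R * \<rho> ^ k \<partial>measure_pmf (?p (n mod N)))"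
      by (intro integral_mono decay measure_pmf.integrable_const measure_pmf.integrable_const_bound[where B = 1])
        (auto simp: ball_prob_bounds)
    also have "\<dots> = exp R * \<rho> ^ k" by simp
    \<comment> \<open>Rounding \<open>n\<close> down to a multiple of \<open>N\<close> costs at most
      one factor 1 / \<open>\<rho>\<close>, which is at most 2 because \<open>c\<close> is at most
      1.\<close>
    also have "\<dots> \<le> exp R * (2 * exp (- b * real n))"
    proof (intro mult_left_mono)
      have "n < (k + 1) * N" unfolding k_def using N by (simp add: dividend_less_div_times)
      then have "real n \<le> real (k + 1) * real N" by (metis less_imp_le of_nat_le_iff of_nat_mult)
      then have "b * real n \<le> b * (real (k + 1) * real N)" using b by (intro mult_left_mono) auto
      also have "\<dots> = - ln \<rho> * real (k + 1)" unfolding b_def using N by simp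
      finally have "exp (ln \<rho> * real (k + 1)) \<le> exp (- b * real n)" by simp
      moreover have "exp (ln \<rho> * real (k + 1)) = \<rho> ^ (k + 1)"
        using \<rho> by (metis exp_of_nat2_mult exp_ln less_le_trans zero_less_divide_1_iff zero_less_numeral)
      moreover have "\<rho> ^ k \<le> 2 * \<rho> ^ (k + 1)" using \<rho> by (simp add: mult_le_cancel_right1)
      ultimately show "\<rho> ^ k \<le> 2 * exp (- b * real n)" by linarith
    qed simp
    also have "\<dots> = 2 * exp (R - b * real n)" by (simp add: exp_diff exp_minus divide_inverse)
    finally show "measure_pmf.prob (?p n) {w. dist x0 (\<phi> w x0) \<le> R} \<le> 2 * exp (R - b * real n)" .
  qed (use b in auto)
qed

end

section \<open>Tracking by quasigeodesic rays\<close>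

lemma eventually_ln_le_linear:
  assumes "0 < \<epsilon>"
  shows "\<forall>\<^sub>F n in sequentially. a * ln (real n) + b \<le> \<epsilon> * real n"
proof -
  have "(\<lambda>n. a * (ln (real n) / real n) + b * (1 / real n)) \<longlonglongrightarrow> a * 0 + b * 0"
    by (intro tendsto_intros lim_ln_over_n lim_1_over_n)
  then have "\<forall>\<^sub>F n in sequentially. a * (ln (real n) / real n) + b * (1 / real n) < \<epsilon>"
    using assms by (intro order_tendstoD) auto
  then show ?thesis
    using eventually_gt_at_top[of 0]
  proof eventually_elim
    case (elim n)
    then show ?case by (simp add: field_simps)
  qed
qed

lemma dist_le_sum_steps:
  fixes x :: "nat \<Rightarrow> 'a::metric_space"
  assumes "i \<le> n"
  shows "dist (x i) (x n) \<le> (\<Sum>l<n. dist (x l) (x (Suc l))) - (\<Sum>l<i. dist (x l) (x (Suc l)))"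
  using assms
proof (induction n rule: dec_induct)
  case (step n)
  then show ?case using dist_triangle[of "x i" "x (Suc n)" "x n"] by simp
qed simp

context hyperbolic_space
begin

text \<open>Tripod comparison at \<open>x n\<close>: the geodesics towards \<open>x 0\<close> and
  \<open>x m\<close> run together for the length \<open>d\<close> of the product, so their points
  \<open>p\<close> and \<open>q\<close> at that distance are within 4 D. The path before time
  \<open>n\<close> passes near \<open>p\<close>, the path after it near \<open>q\<close>.\<close>

lemma close_pair_of_detour:
  fixes x :: "nat \<Rightarrow> 'x"
  assumes nm: "0 < n" "n < m" "m \<le> 2 ^ k" and J: "\<And>i. i < m \<Longrightarrow> dist (x i) (x (Suc i)) \<le> J"
  obtains i j where "i < n" "n \<le> j" "j < m" "dist (x i) (x j) \<le> 4 * D + 2 * (real k * D + J)"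
    "gromov_product (x n) (x 0) (x m) \<le> dist (x i) (x n) + (real k * D + J)"
proof -
  have mn: "m - n \<le> 2 ^ k" "n \<le> 2 ^ k" using nm by linarith+
  define d where "d = gromov_product (x n) (x 0) (x m)"
  have d: "0 \<le> d" "d \<le> dist (x n) (x 0)" "d \<le> dist (x n) (x m)"
    unfolding d_def by (auto intro: gromov_product_nonneg gromov_product_le)
  obtain p where p: "dist (x n) p = d" "dist p (x 0) = dist (x n) (x 0) - d"
    using point_between[OF d(1,2)] by blast
  obtain q where q: "dist (x n) q = d" "dist q (x m) = dist (x n) (x m) - d"
    using point_between[OF d(1,3)] by blast
  \<comment> \<open>Seen from a point between them, the two ends have product zero. The chain
    estimate therefore yields a step of product at most k D, and such a step of length at most
    \<open>J\<close> starts within k D + J of that point.\<close>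
  have "gromov_product p (x 0) (x n) = 0" "gromov_product q (x n) (x m) = 0"
    using p q unfolding gromov_product_def by (simp_all add: dist_commute)
  moreover obtain i where i: "i \<in> {0..<n}"
    "gromov_product p (x i) (x (Suc i)) - real k * D \<le> gromov_product p (x 0) (x n)"
    using chain_gromov_product[of 0 n k p x] nm mn by auto
  moreover obtain j where j: "j \<in> {n..<m}"
    "gromov_product q (x j) (x (Suc j)) - real k * D \<le> gromov_product q (x n) (x m)"
    using chain_gromov_product[of n m k q x] nm mn by blast
  moreover have "dist (x i) (x (Suc i)) \<le> J" "dist (x j) (x (Suc j)) \<le> J"
    using i j nm J by auto
  ultimately have pi: "dist p (x i) \<le> real k * D + J" and qj: "dist q (x j) \<le> real k * D + J"
    using gromov_product_ge_diff[of p "x i" "x (Suc i)"] gromov_product_ge_diff[of q "x j" "x (Suc j)"]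
    by linarith+
  have "gromov_product (x n) p (x 0) = d" "gromov_product (x n) (x m) q = d"
    using p q unfolding gromov_product_def by (simp_all add: dist_commute)
  then have "d - 2 * D \<le> gromov_product (x n) p q"
    using four_point2[of "x n" p "x 0" "x m" q] unfolding d_def by simp
  then have "dist p q \<le> 4 * D" using p q unfolding gromov_product_def by simp
  then have "dist (x i) (x j) \<le> 4 * D + 2 * (real k * D + J)"
    using pi qj dist_triangle[of "x i" "x j" p] dist_triangle[of p "x j" q] by (simp add: dist_commute)
  moreover have "d \<le> dist (x i) (x n) + (real k * D + J)"
    using p pi dist_triangle[of "x n" p "x i"] by (simp add: dist_commute)
  ultimately show ?thesis using that i j unfolding d_def by auto
qed

text \<open>
  Passing from \<open>n\<close> to \<open>R * n\<close> gains more than the error accumulated so far, hence errors do not add up.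
\<close>

lemma gromov_product_extend:
  fixes x :: "nat \<Rightarrow> 'x" and e :: "nat \<Rightarrow> real"
  assumes R: "2 \<le> R" and n0: "1 \<le> n0"
    and near: "\<And>n m. n0 \<le> n \<Longrightarrow> n \<le> m \<Longrightarrow> m \<le> R * n \<Longrightarrow> gromov_product (x n) x0 (x m) \<le> e n"
    and grow: "\<And>n. n0 \<le> n \<Longrightarrow> dist x0 (x n) + e (R * n) + D \<le> dist x0 (x (R * n))"
    and nm: "n0 \<le> n" "n \<le> m"
  shows "gromov_product (x n) x0 (x m) \<le> e n + D"
  using nm
proof (induction "m - n" arbitrary: n rule: less_induct)
  case less
  show ?case
  proof (cases "m \<le> R * n")
    case True
    then show ?thesis using near[of n m] less.prems D_nonneg by simp
  next
    case False
    have n: "1 \<le> n" "n < R * n" using less.prems n0 R by auto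
    have e: "0 \<le> e n" using near[of n n] less.prems n gromov_product_nonneg[of "x n" x0 "x n"] by simp
    have "gromov_product (x (R * n)) x0 (x m) \<le> e (R * n) + D"
    proof (rule less.hyps)
      show "m - R * n < m - n" "n0 \<le> R * n" "R * n \<le> m" using less.prems(1) n(2) False by linarith+
    qed
    moreover have "gromov_product (x n) x0 (x (R * n)) \<le> e n" using near less.prems n by simp
    ultimately show ?thesis
      using grow[OF less.prems(1)] gp_four_point[of "x n" "x (R * n)" "x m"] e
        gromov_product_rotate[of "x n" x0 "x m"] gromov_product_rotate[of "x (R * n)" x0 "x m"]
        gromov_product_rotate[of "x n" x0 "x (R * n)"]
      by linarith
  qed
qed

text \<open>In a space that is not proper no limiting geodesic ray can be extracted by compactness.
  Instead \<open>p k\<close> is taken at distance k from \<open>x0\<close> between \<open>x0\<close>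
  and a late path point; the distances of these points agree with those of the integers up to 4 D,
  and rounding the parameter adds 1.\<close>

lemma ray_tracking_gromov_sequence:
  fixes x :: "nat \<Rightarrow> 'x"
  assumes x: "x \<in> gromov_sequences x0"
  obtains \<gamma> where "quasigeodesic_ray \<gamma>"
    "\<And>n e. 0 \<le> e \<Longrightarrow> (\<And>m. n \<le> m \<Longrightarrow> gromov_product (x n) x0 (x m) \<le> e) \<Longrightarrow>
      infdist (x n) (\<gamma> ` {0..}) \<le> e + 2 * D + 1"
proof -
  have "\<exists>N. \<forall>m n. min m n \<ge> N \<longrightarrow> gp (x m) (x n) \<ge> real k" for k
    using x unfolding gromov_sequences_def by blast
  then obtain N0 where N0: "\<And>k m n. min m n \<ge> N0 k \<Longrightarrow> gp (x m) (x n) \<ge> real k" by metis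
  \<comment> \<open>The maximum makes \<open>N\<close> monotone, so for i \<le> j both
    \<open>x (N i)\<close> and \<open>x (N j)\<close> lie past the threshold of i.\<close>
  define N where "N k = Max (N0 ` {..k})" for k
  have N_mono: "N i \<le> N j" if "i \<le> j" for i j
    unfolding N_def using that by (intro Max_mono) auto
  have "N0 k \<le> N k" for k unfolding N_def by (intro Max_ge) auto
  then have N: "gp (x m) (x n) \<ge> real k" if "m \<ge> N k" "n \<ge> N k" for k m n
    using N0[of k m n] that by (meson le_trans min.boundedI)
  have "real k \<le> dist x0 (x (N k))" for k
    using N[of k "N k" "N k"] gromov_product_le(1)[of x0 "x (N k)" "x (N k)"] by simp
  then have "\<exists>p. dist x0 p = real k \<and> dist p (x (N k)) = dist x0 (x (N k)) - real k" for k
    by (intro point_between) auto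
  then obtain p where p: "\<And>k. dist x0 (p k) = real k" "\<And>k. dist (p k) (x (N k)) = dist x0 (x (N k)) - real k"
    by metis
  have gp_p: "gp (p k) (x (N k)) = real k" for k
    using p unfolding gromov_product_def by simp
  have le: "dist (p i) (p j) \<le> real j - real i + 4 * D" "real j - real i \<le> dist (p i) (p j)" if "i \<le> j" for i j
  proof -
    have "real i \<le> gp (x (N i)) (x (N j))" using N_mono[OF that] by (intro N) auto
    then have "real i - 2 * D \<le> gp (p i) (p j)"
      using gp_four_point2[of "p i" "x (N i)" "x (N j)" "p j"] gp_p[of i] gp_p[of j] that
        gromov_product_commute[of x0 "x (N j)" "p j"] by simp
    then show "dist (p i) (p j) \<le> real j - real i + 4 * D"
      using p unfolding gromov_product_def by simp
    show "real j - real i \<le> dist (p i) (p j)" using dist_triangle[of x0 "p j" "p i"] p by simp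
  qed
  have pp: "dist (p i) (p j) \<le> \<bar>real i - real j\<bar> + 4 * D" "\<bar>real i - real j\<bar> \<le> dist (p i) (p j)" for i j
    using le[of i j] le[of j i] by (cases "i \<le> j"; simp add: dist_commute)+
  define \<gamma> where "\<gamma> t = p (nat \<lfloor>t\<rfloor>)" for t :: real
  have "quasigeodesic 1 (4 * D + 1) {0..} \<gamma>"
    unfolding quasigeodesic_def
  proof (intro conjI ballI)
    fix s t :: real assume st: "s \<in> {0..}" "t \<in> {0..}"
    have "real (nat \<lfloor>s\<rfloor>) \<le> s" "s < real (nat \<lfloor>s\<rfloor>) + 1" "real (nat \<lfloor>t\<rfloor>) \<le> t" "t < real (nat \<lfloor>t\<rfloor>) + 1"
      using st by auto
    then have "\<bar>real (nat \<lfloor>s\<rfloor>) - real (nat \<lfloor>t\<rfloor>)\<bar> \<le> \<bar>t - s\<bar> + 1" "\<bar>t - s\<bar> - 1 \<le> \<bar>real (nat \<lfloor>s\<rfloor>) - real (nat \<lfloor>t\<rfloor>)\<bar>"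
      by linarith+
    then show "1 / 1 * \<bar>t - s\<bar> - (4 * D + 1) \<le> dist (\<gamma> s) (\<gamma> t)" "dist (\<gamma> s) (\<gamma> t) \<le> 1 * \<bar>t - s\<bar> + (4 * D + 1)"
      using pp[of "nat \<lfloor>s\<rfloor>" "nat \<lfloor>t\<rfloor>"] D_nonneg unfolding \<gamma>_def by simp_all
  qed (use D_nonneg in auto)
  then have qg: "quasigeodesic_ray \<gamma>" unfolding quasigeodesic_ray_def by blast
  have on_ray: "p k \<in> \<gamma> ` {0..}" for k
    unfolding \<gamma>_def by (intro image_eqI[of _ _ "real k"]) auto
  have "infdist (x n) (\<gamma> ` {0..}) \<le> e + 2 * D + 1"
    if e: "0 \<le> e" "\<And>m. n \<le> m \<Longrightarrow> gromov_product (x n) x0 (x m) \<le> e" for n e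
  proof -
    define v where "v = dist x0 (x n) - e"
    define k where "k = nat \<lfloor>v\<rfloor>"
    have v: "v \<le> gp (x n) (x m)" if "n \<le> m" for m
      using e(2)[OF that] gromov_product_rotate[of "x n" x0 "x m"] unfolding v_def by simp
    have "dist (x n) (p k) \<le> e + 2 * D + 1"
    proof (cases "0 \<le> v")
      case True
      then have k: "real k \<le> v" "v < real k + 1" unfolding k_def by linarith+
      \<comment> \<open>If n \<le> N k, the hypothesis on later points applies to
        \<open>x (N k)\<close>; otherwise both indices are past the threshold of
        \<open>k\<close>.\<close>
      have "real k \<le> gp (x n) (x (N k))"
        using k v[of "N k"] N[of k n "N k"] by (cases "n \<le> N k") auto
      then have "real k - D \<le> gp (x n) (p k)"
        using gp_four_point[of "x n" "x (N k)" "p k"] gp_p[of k] gromov_product_commute[of x0 "p k" "x (N k)"]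
        by simp
      then show ?thesis using p(1)[of k] k unfolding gromov_product_def v_def by simp
    next
      case False
      then have "k = 0" unfolding k_def by simp
      then have "p k = x0" using p(1)[of 0] by simp
      then show ?thesis using False D_nonneg unfolding v_def by (simp add: dist_commute)
    qed
    then show ?thesis using infdist_le2[OF on_ray] by blast
  qed
  with qg show ?thesis using that by blast
qed

text \<open>The close pair around \<open>n\<close> either has a gap below K ln j, or linear progress
  turns its closeness into a bound on the gap. The stated bound adds the two cases, and n - i is at
  most the gap.\<close>

lemma detour_bound:
  fixes x :: "nat \<Rightarrow> 'x"
  assumes c: "0 < c" and K: "0 \<le> K"
    and prog: "\<And>j i. n \<le> j \<Longrightarrow> i < j \<Longrightarrow> K * ln (real j) \<le> real (j - i) \<Longrightarrow> c * real (j - i) \<le> dist (x i) (x j)"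
    and J: "\<And>i. i < m \<Longrightarrow> dist (x i) (x (Suc i)) \<le> J" and J0: "0 \<le> J"
    and n: "1 \<le> n" and m: "n \<le> m" and l: "ln (real m) \<le> l" "0 \<le> l"
  obtains i where "i \<le> n" "real (n - i) \<le> K * l + (4 * D + 2 * ((2 * l + 1) * D + J)) / c"
    "gromov_product (x n) (x 0) (x m) \<le> dist (x i) (x n) + ((2 * l + 1) * D + J)"
proof (cases "n = m")
  case True
  have "0 \<le> (2 * l + 1) * D + J" "0 \<le> K * l + (4 * D + 2 * ((2 * l + 1) * D + J)) / c"
    using l(2) D_nonneg J0 c K by (auto intro!: add_nonneg_nonneg divide_nonneg_nonneg)
  moreover have "gromov_product (x n) (x 0) (x m) = 0"
    using True unfolding gromov_product_def by (simp add: dist_commute)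
  ultimately show ?thesis using that[of n] by simp
next
  case False
  define k where "k = nat \<lceil>log 2 (real m)\<rceil>"
  have m1: "1 \<le> m" and n': "0 < n" and nm: "n < m" using n m False by simp_all
  have "m \<le> 2 ^ k"
  proof -
    have "log 2 (real m) \<le> real k" unfolding k_def by linarith
    then have "real m \<le> 2 powr real k" using m1 by (simp add: log_le_iff)
    then show ?thesis by (simp add: powr_realpow)
  qed
  \<comment> \<open>ln 2 is at least 1/2, so the binary logarithm is at most twice the natural one;
    the 1 comes from rounding up.\<close>
  have k: "real k \<le> 2 * l + 1"
  proof -
    have "1 / 2 \<le> ln (2::real)" using ln2_ge_two_thirds by simp
    then have "log 2 (real m) \<le> 2 * ln (real m)"
      unfolding log_def using m1 mult_left_mono[of 1 "2 * ln (2::real)" "ln (real m)"] by (simp add: field_simps)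
    moreover have "0 \<le> log 2 (real m)" using m1 by simp
    then have "real k < log 2 (real m) + 1" unfolding k_def by linarith
    ultimately show ?thesis using l by linarith
  qed
  obtain i j where ij: "i < n" "n \<le> j" "j < m" "dist (x i) (x j) \<le> 4 * D + 2 * (real k * D + J)"
    "gromov_product (x n) (x 0) (x m) \<le> dist (x i) (x n) + (real k * D + J)"
    using close_pair_of_detour[where x = x and J = J, OF n' nm \<open>m \<le> 2 ^ k\<close> J] by blast
  have kD: "real k * D \<le> (2 * l + 1) * D" using k D_nonneg by (rule mult_right_mono)
  have "real (j - i) \<le> K * l + (4 * D + 2 * ((2 * l + 1) * D + J)) / c"
  proof (cases "K * ln (real j) \<le> real (j - i)")
    case True
    have "c * real (j - i) \<le> dist (x i) (x j)" using True ij by (intro prog) auto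
    then have "real (j - i) \<le> (4 * D + 2 * ((2 * l + 1) * D + J)) / c"
      using ij(4) kD c by (simp add: pos_le_divide_eq mult.commute)
    moreover have "0 \<le> K * l" using K l by simp
    ultimately show ?thesis by linarith
  next
    case False
    have "ln (real j) \<le> ln (real m)" using ij n by simp
    then have "K * ln (real j) \<le> K * l" using K l by (intro mult_left_mono) auto
    moreover have "0 \<le> (4 * D + 2 * ((2 * l + 1) * D + J)) / c"
      using l D_nonneg J0 c by (auto intro!: add_nonneg_nonneg divide_nonneg_nonneg)
    ultimately show ?thesis using False by linarith
  qed
  moreover have "real (n - i) \<le> real (j - i)" using ij by simp
  ultimately show ?thesis using that[of i] ij kD by fastforce
qed

text \<open>The condition on \<open>R\<close> feeds \<open>grow\<close>: of the distance c R n
  reached at time R n, the error takes at most half, and the other half covers the distance C n at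
  time \<open>n\<close> and, once n \<ge> D, also \<open>D\<close>.\<close>

lemma eventually_detour_bound:
  fixes x :: "nat \<Rightarrow> 'x" and e :: "nat \<Rightarrow> real" and R :: nat
  assumes c: "0 < c" and C: "\<forall>\<^sub>F n in sequentially. dist x0 (x n) \<le> C * real n"
    and low: "\<forall>\<^sub>F n in sequentially. c * real n \<le> dist x0 (x n)"
    and R: "2 \<le> R" "2 * (C + 1) \<le> c * real R"
    and near: "\<forall>\<^sub>F n in sequentially. \<forall>m. n \<le> m \<and> m \<le> R * n \<longrightarrow> gromov_product (x n) x0 (x m) \<le> e n"
    and e: "\<forall>\<^sub>F n in sequentially. e n \<le> c / 2 * real n"
  shows "\<forall>\<^sub>F n in sequentially. \<forall>m\<ge>n. gromov_product (x n) x0 (x m) \<le> e n + D"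
proof -
  have "\<forall>\<^sub>F n in sequentially. dist x0 (x n) \<le> C * real n \<and> c * real n \<le> dist x0 (x n) \<and>
    (\<forall>m. n \<le> m \<and> m \<le> R * n \<longrightarrow> gromov_product (x n) x0 (x m) \<le> e n) \<and> e n \<le> c / 2 * real n \<and>
    max 1 (nat \<lceil>D\<rceil>) \<le> n"
    by (intro eventually_conj C low near e eventually_ge_at_top)
  then obtain n0 where n0: "\<And>n. n0 \<le> n \<Longrightarrow> dist x0 (x n) \<le> C * real n \<and> c * real n \<le> dist x0 (x n) \<and>
    (\<forall>m. n \<le> m \<and> m \<le> R * n \<longrightarrow> gromov_product (x n) x0 (x m) \<le> e n) \<and> e n \<le> c / 2 * real n \<and>
    max 1 (nat \<lceil>D\<rceil>) \<le> n"
    unfolding eventually_sequentially by blast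
  have grow: "dist x0 (x n) + e (R * n) + D \<le> dist x0 (x (R * n))" if n: "n0 \<le> n" for n
  proof -
    have Rn: "n0 \<le> R * n" using n R(1) by (simp add: le_trans[OF n])
    have "2 * (C + 1) * real n \<le> c * real R * real n" using R(2) by (intro mult_right_mono) auto
    then have "(C + 1) * real n \<le> c * real (R * n) - c / 2 * real (R * n)" by (simp add: algebra_simps)
    moreover have "D \<le> real n" using n0[OF n] by linarith
    ultimately show ?thesis using n0[OF n] n0[OF Rn] by (simp add: distrib_right)
  qed
  have "gromov_product (x n) x0 (x m) \<le> e n + D" if "n0 \<le> n" "n \<le> m" for n m
  proof (rule gromov_product_extend[OF R(1), of n0])
    show "1 \<le> n0" using n0[OF order_refl] by simp
  qed (use n0 grow that in auto)
  then show ?thesis unfolding eventually_sequentially by blast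
qed

text \<open>A deterministic statement; \<open>prog\<close>, \<open>C\<close> and \<open>cont\<close>
  are the almost sure properties of sample paths. The logarithmic bound is a further conclusion
  about the same \<open>\<gamma>\<close>, so one ray serves both rates.\<close>

theorem quasigeodesic_tracking:
  fixes x :: "nat \<Rightarrow> 'x"
  defines "S \<equiv> \<lambda>n. \<Sum>i<n. dist (x i) (x (Suc i))"
  assumes x0: "x 0 = x0" and c: "0 < c" and K: "0 \<le> K"
    and prog: "\<forall>\<^sub>F j in sequentially. \<forall>i<j. K * ln (real j) \<le> real (j - i) \<longrightarrow> c * real (j - i) \<le> dist (x i) (x j)"
    and C: "\<forall>\<^sub>F n in sequentially. S n \<le> C * real n"
    and cont: "\<And>\<epsilon>. 0 < \<epsilon> \<Longrightarrow> \<exists>\<eta>>0. \<forall>\<^sub>F n in sequentially. \<forall>i\<le>n. real (n - i) \<le> \<eta> * real n \<longrightarrow> S n - S i \<le> \<epsilon> * real n"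
  obtains \<gamma> where "quasigeodesic_ray \<gamma>"
    "(\<lambda>n. infdist (x n) (\<gamma> ` {0..}) / real n) \<longlonglongrightarrow> 0"
    "\<And>B. (\<And>i. dist (x i) (x (Suc i)) \<le> B) \<Longrightarrow>
      \<exists>A. \<forall>\<^sub>F n in sequentially. infdist (x n) (\<gamma> ` {0..}) \<le> A * ln (real n)"
proof -
  have S: "dist (x i) (x n) \<le> S n - S i" if "i \<le> n" for i n
    unfolding S_def by (rule dist_le_sum_steps[OF that])
  have up: "\<forall>\<^sub>F n in sequentially. dist x0 (x n) \<le> C * real n"
    using C
  proof eventually_elim
    case (elim n)
    then show ?case using S[of 0 n] x0 unfolding S_def by simp
  qed
  have low: "\<forall>\<^sub>F n in sequentially. c * real n \<le> dist x0 (x n)"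
    using prog eventually_ln_le_linear[OF zero_less_one, of K 0] eventually_gt_at_top[of 0]
  proof eventually_elim
    case (elim n)
    then show ?case using x0 by (auto dest!: spec[of _ 0])
  qed
  define R where "R = max 2 (nat \<lceil>2 * (C + 1) / c\<rceil>)"
  have R: "2 \<le> R" "2 * (C + 1) \<le> c * real R"
  proof -
    show "2 \<le> R" unfolding R_def by simp
    have "2 * (C + 1) / c \<le> real R" unfolding R_def by linarith
    then show "2 * (C + 1) \<le> c * real R" using c by (simp add: field_simps)
  qed
  have detour: "\<exists>i\<le>n. real (n - i) \<le> K * ln (real (R * n)) + (4 * D + 2 * ((2 * ln (real (R * n)) + 1) * D + J)) / c \<and>
      gromov_product (x n) x0 (x m) \<le> dist (x i) (x n) + ((2 * ln (real (R * n)) + 1) * D + J)"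
    if a: "\<And>j i. n \<le> j \<Longrightarrow> i < j \<Longrightarrow> K * ln (real j) \<le> real (j - i) \<Longrightarrow> c * real (j - i) \<le> dist (x i) (x j)"
      "\<And>i. i < R * n \<Longrightarrow> dist (x i) (x (Suc i)) \<le> J" "0 \<le> J" "1 \<le> n" "n \<le> m" "m \<le> R * n" for n m J
  proof -
    have l: "ln (real m) \<le> ln (real (R * n))" "0 \<le> ln (real (R * n))"
    proof -
      have "real m \<le> real (R * n)" "0 < real m" using a(4,5,6) by (simp_all del: of_nat_mult)
      then show "ln (real m) \<le> ln (real (R * n))" by simp
      show "0 \<le> ln (real (R * n))" using a(4,5,6) using \<open>real m \<le> real (R * n)\<close> by (intro ln_ge_zero) linarith
    qed
    have J: "dist (x i) (x (Suc i)) \<le> J" if "i < m" for i using a(2)[of i] that a(6) by simp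
    show ?thesis
      using detour_bound[where x = x and n = n and J = J, OF c K a(1) J a(3,4,5) l] unfolding x0 by blast
  qed
  have sublinear: "\<forall>\<^sub>F n in sequentially. \<forall>m\<ge>n. gromov_product (x n) x0 (x m) \<le> \<epsilon> * real n + D"
    if \<epsilon>: "0 < \<epsilon>" "\<epsilon> \<le> c / 2" for \<epsilon>
  proof (rule eventually_detour_bound[OF c up low R])
    show "\<forall>\<^sub>F n in sequentially. \<epsilon> * real n \<le> c / 2 * real n"
      using \<epsilon> by (intro always_eventually allI mult_right_mono) auto
    obtain \<eta> where \<eta>: "0 < \<eta>" "\<forall>\<^sub>F n in sequentially. \<forall>i\<le>n. real (n - i) \<le> \<eta> * real n \<longrightarrow> S n - S i \<le> \<epsilon> / 4 * real n"
      using cont[of "\<epsilon> / 4"] \<epsilon> by auto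
    \<comment> \<open>Jumps up to time R n are bounded by J = \<open>\<epsilon>1\<close> R n, which
      enters the window length as 2 J / c and the product directly. The two entries keep these
      contributions below \<open>\<eta>\<close> n / 2 and \<open>\<epsilon>\<close> n / 4.\<close>
    define \<epsilon>1 where "\<epsilon>1 = min (\<eta> * c / (4 * real R)) (\<epsilon> / (4 * real R))"
    have \<epsilon>1: "0 < \<epsilon>1" "\<epsilon>1 * real R \<le> \<eta> * c / 4" "\<epsilon>1 * real R \<le> \<epsilon> / 4"
      using \<eta> c \<epsilon> R(1) unfolding \<epsilon>1_def by (auto simp: field_simps min_def)
    have jump: "\<forall>\<^sub>F n in sequentially. \<forall>i<R * n. dist (x i) (x (Suc i)) \<le> \<epsilon>1 * real R * real n"
    proof -
      obtain \<eta>1 where \<eta>1: "0 < \<eta>1" "\<forall>\<^sub>F n in sequentially. \<forall>i\<le>n. real (n - i) \<le> \<eta>1 * real n \<longrightarrow> S n - S i \<le> \<epsilon>1 * real n"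
        using cont[OF \<epsilon>1(1)] by auto
      have "\<forall>\<^sub>F n in sequentially. (\<forall>i\<le>n. real (n - i) \<le> \<eta>1 * real n \<longrightarrow> S n - S i \<le> \<epsilon>1 * real n) \<and>
          nat \<lceil>1 / \<eta>1\<rceil> \<le> n"
        by (intro eventually_conj \<eta>1 eventually_ge_at_top)
      then obtain N where N: "\<And>n. N \<le> n \<Longrightarrow> (\<forall>i\<le>n. real (n - i) \<le> \<eta>1 * real n \<longrightarrow> S n - S i \<le> \<epsilon>1 * real n) \<and>
          nat \<lceil>1 / \<eta>1\<rceil> \<le> n"
        unfolding eventually_sequentially by blast
      \<comment> \<open>A single step is a window of length 1, which \<open>cont\<close> admits as
        soon as \<open>\<eta>1\<close> times the index is at least 1.\<close>
      have late: "dist (x i) (x (Suc i)) \<le> \<epsilon>1 * real (Suc i)" if "N \<le> i" for i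
      proof -
        have N': "\<forall>j\<le>Suc i. real (Suc i - j) \<le> \<eta>1 * real (Suc i) \<longrightarrow> S (Suc i) - S j \<le> \<epsilon>1 * real (Suc i)"
          "nat \<lceil>1 / \<eta>1\<rceil> \<le> Suc i" using N[of "Suc i"] that by auto
        have "1 / \<eta>1 \<le> real (Suc i)" using N'(2) by linarith
        then have "1 \<le> \<eta>1 * real (Suc i)" using \<eta>1(1) by (simp add: field_simps)
        then have "S (Suc i) - S i \<le> \<epsilon>1 * real (Suc i)" using N'(1)[rule_format, of i] by simp
        then show ?thesis unfolding S_def by simp
      qed
      define A where "A = S N"
      have early: "dist (x i) (x (Suc i)) \<le> A" if "i < N" for i
        unfolding A_def S_def using that by (intro member_le_sum) auto
      have pos: "0 < \<epsilon>1 * real R" using \<epsilon>1(1) R(1) by simp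
      show ?thesis
        using eventually_ln_le_linear[OF pos, of 0 A] eventually_gt_at_top[of 0]
      proof eventually_elim
        case (elim n)
        show ?case
        proof (intro allI impI)
          fix i assume i: "i < R * n"
          show "dist (x i) (x (Suc i)) \<le> \<epsilon>1 * real R * real n"
          proof (cases "i < N")
            case True
            then show ?thesis using early[OF True] elim by simp
          next
            case False
            have "real (Suc i) \<le> real (R * n)" using i by (simp only: of_nat_le_iff Suc_le_eq)
            then have "\<epsilon>1 * real (Suc i) \<le> \<epsilon>1 * real (R * n)" using \<epsilon>1(1) by (intro mult_left_mono) auto
            then show ?thesis using late[of i] False by simp
          qed
        qed
      qed
    qed
    have T: "\<forall>\<^sub>F n in sequentially. K * ln (real (R * n)) + (4 * D + 2 * ((2 * ln (real (R * n)) + 1) * D)) / c \<le> \<eta> / 2 * real n"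
      using eventually_ln_le_linear[OF half_gt_zero[OF \<eta>(1)], of "K + 4 * D / c" "(K + 4 * D / c) * ln (real R) + 6 * D / c"]
        eventually_gt_at_top[of 0]
    proof eventually_elim
      case (elim n)
      have "(4 * D + 2 * ((2 * l + 1) * D)) / c = 4 * D / c * l + 6 * D / c" for l
        using c by (simp add: field_simps)
      then have eq: "K * l + (4 * D + 2 * ((2 * l + 1) * D)) / c = (K + 4 * D / c) * l + 6 * D / c" for l
        by (simp add: distrib_right)
      have "ln (real (R * n)) = ln (real n) + ln (real R)" using elim R(1) by (simp add: ln_mult)
      then show ?case using elim(1) unfolding eq by (simp only: distrib_left add.assoc)
    qed
    have pos: "0 < \<epsilon> / 4" using \<epsilon> by simp
    have E: "\<forall>\<^sub>F n in sequentially. (2 * ln (real (R * n)) + 1) * D \<le> \<epsilon> / 4 * real n"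
      using eventually_ln_le_linear[OF pos, of "2 * D" "2 * D * ln (real R) + D"] eventually_gt_at_top[of 0]
    proof eventually_elim
      case (elim n)
      then show ?case using R(1) by (simp add: ln_mult algebra_simps)
    qed
    have prog': "\<forall>\<^sub>F n in sequentially. \<forall>j\<ge>n. \<forall>i<j. K * ln (real j) \<le> real (j - i) \<longrightarrow> c * real (j - i) \<le> dist (x i) (x j)"
      using prog by (rule eventually_all_ge_at_top)
    show "\<forall>\<^sub>F n in sequentially. \<forall>m. n \<le> m \<and> m \<le> R * n \<longrightarrow> gromov_product (x n) x0 (x m) \<le> \<epsilon> * real n"
      using jump T E prog' \<eta>(2) eventually_ge_at_top[of 1]
    proof eventually_elim
      case (elim n)
      show ?case
      proof (intro allI impI)
        fix m assume m: "n \<le> m \<and> m \<le> R * n"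
        let ?l = "ln (real (R * n))" and ?J = "\<epsilon>1 * real R * real n"
        have "0 \<le> ?J" using \<epsilon>1 by simp
        then obtain i where i: "i \<le> n" "real (n - i) \<le> K * ?l + (4 * D + 2 * ((2 * ?l + 1) * D + ?J)) / c"
          "gromov_product (x n) x0 (x m) \<le> dist (x i) (x n) + ((2 * ?l + 1) * D + ?J)"
          using detour[of n ?J m] elim m by blast
        have J: "?J \<le> \<eta> * c / 4 * real n" "?J \<le> \<epsilon> / 4 * real n"
          using mult_right_mono[OF \<epsilon>1(2) of_nat_0_le_iff, of n] mult_right_mono[OF \<epsilon>1(3) of_nat_0_le_iff, of n]
          by simp_all
        have "(4 * D + 2 * ((2 * ?l + 1) * D + ?J)) / c = (4 * D + 2 * ((2 * ?l + 1) * D)) / c + 2 * ?J / c"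
          by (simp add: add_divide_distrib algebra_simps)
        moreover have "2 * ?J / c \<le> \<eta> / 2 * real n" using J(1) c by (simp add: field_simps)
        ultimately have "real (n - i) \<le> \<eta> * real n" using i(2) elim(2) by linarith
        then have "S n - S i \<le> \<epsilon> / 4 * real n" using elim(5) i(1) by blast
        then show "gromov_product (x n) x0 (x m) \<le> \<epsilon> * real n"
          using i(3) S[OF i(1)] J(2) elim(3) mult_nonneg_nonneg[OF less_imp_le[OF \<epsilon>(1)] of_nat_0_le_iff, of n]
          by linarith
      qed
    qed
  qed
  have gs: "x \<in> gromov_sequences x0"
  proof -
    have "\<exists>N. \<forall>m n. min m n \<ge> N \<longrightarrow> gp (x m) (x n) \<ge> Z" for Z
    proof -
      have "\<forall>\<^sub>F n in sequentially. (\<forall>m\<ge>n. gromov_product (x n) x0 (x m) \<le> c / 2 * real n + D) \<and>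
          c * real n \<le> dist x0 (x n) \<and> nat \<lceil>(Z + D) / (c / 2)\<rceil> \<le> n"
        using sublinear[of "c / 2"] c by (intro eventually_conj low eventually_ge_at_top) auto
      then obtain N where N: "\<And>n. N \<le> n \<Longrightarrow> (\<forall>m\<ge>n. gromov_product (x n) x0 (x m) \<le> c / 2 * real n + D) \<and>
          c * real n \<le> dist x0 (x n) \<and> nat \<lceil>(Z + D) / (c / 2)\<rceil> \<le> n"
        unfolding eventually_sequentially by blast
      have le: "Z \<le> gp (x n) (x m)" if "N \<le> n" "n \<le> m" for n m
      proof -
        have "(Z + D) / (c / 2) \<le> real n" using N[OF that(1)] by linarith
        then have "Z + D \<le> c / 2 * real n" using c by (simp add: field_simps)
        then show ?thesis
          using N[OF that(1)] that(2) gromov_product_rotate[of "x n" x0 "x m"] by fastforce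
      qed
      have "Z \<le> gp (x m) (x n)" if "min m n \<ge> N" for m n
        using le[of m n] le[of n m] that gromov_product_commute[of x0 "x m" "x n"] by (cases "m \<le> n") auto
      then show ?thesis by blast
    qed
    then show ?thesis unfolding gromov_sequences_def by blast
  qed
  obtain \<gamma> where \<gamma>: "quasigeodesic_ray \<gamma>"
    "\<And>n e. 0 \<le> e \<Longrightarrow> (\<And>m. n \<le> m \<Longrightarrow> gromov_product (x n) x0 (x m) \<le> e) \<Longrightarrow>
      infdist (x n) (\<gamma> ` {0..}) \<le> e + 2 * D + 1"
    using ray_tracking_gromov_sequence[OF gs] by blast
  have close: "infdist (x n) (\<gamma> ` {0..}) \<le> e + 2 * D + 1"
    if "\<forall>m\<ge>n. gromov_product (x n) x0 (x m) \<le> e" for n e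
  proof (rule \<gamma>(2))
    show "0 \<le> e" using that gromov_product_nonneg[of "x n" x0 "x n"] by (meson order_refl order_trans)
  qed (use that in blast)
  have "(\<lambda>n. infdist (x n) (\<gamma> ` {0..}) / real n) \<longlonglongrightarrow> 0"
  proof (rule order_tendstoI)
    fix a :: real assume "a < 0"
    then show "\<forall>\<^sub>F n in sequentially. a < infdist (x n) (\<gamma> ` {0..}) / real n"
      by (intro always_eventually allI) (meson divide_nonneg_nonneg infdist_nonneg less_le_trans of_nat_0_le_iff)
  next
    fix a :: real assume a: "0 < a"
    define \<epsilon> where "\<epsilon> = min (a / 4) (c / 2)"
    have \<epsilon>: "0 < \<epsilon>" "\<epsilon> \<le> c / 2" "\<epsilon> \<le> a / 4" unfolding \<epsilon>_def using a c by auto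
    have pos: "0 < a / 4" using a by simp
    show "\<forall>\<^sub>F n in sequentially. infdist (x n) (\<gamma> ` {0..}) / real n < a"
      using sublinear[OF \<epsilon>(1,2)] eventually_ln_le_linear[OF pos, of 0 "3 * D + 1"] eventually_gt_at_top[of 0]
    proof eventually_elim
      case (elim n)
      have "infdist (x n) (\<gamma> ` {0..}) \<le> (\<epsilon> * real n + D) + 2 * D + 1" using elim(1) by (rule close)
      also have "\<dots> \<le> a / 4 * real n + a / 4 * real n"
        using elim(2) mult_right_mono[OF \<epsilon>(3) of_nat_0_le_iff, of n] by linarith
      also have "\<dots> < a * real n" using a elim(3) by simp
      finally show ?case using elim(3) by (simp add: field_simps)
    qed
  qed
  moreover have "\<exists>A. \<forall>\<^sub>F n in sequentially. infdist (x n) (\<gamma> ` {0..}) \<le> A * ln (real n)"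
    if B: "\<And>i. dist (x i) (x (Suc i)) \<le> B" for B
  proof -
    have B0: "0 \<le> B" using B[of 0] zero_le_dist order_trans by blast
    define l where "l n = ln (real (R * n))" for n
    define e where "e n = B * (K * l n + (4 * D + 2 * ((2 * l n + 1) * D + B)) / c) + ((2 * l n + 1) * D + B)" for n
    define A1 where "A1 = B * (K + 4 * D / c) + 2 * D"
    define A2 where "A2 = B * ((4 * D + 2 * (D + B)) / c) + D + B + A1 * ln (real R)"
    have e_eq: "e n = A1 * ln (real n) + A2" if "0 < n" for n
      unfolding e_def A1_def A2_def l_def using that R(1) c by (simp add: ln_mult field_simps)
    have prog': "\<forall>\<^sub>F n in sequentially. \<forall>j\<ge>n. \<forall>i<j. K * ln (real j) \<le> real (j - i) \<longrightarrow> c * real (j - i) \<le> dist (x i) (x j)"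
      using prog by (rule eventually_all_ge_at_top)
    have SB: "S n - S i \<le> B * real (n - i)" if "i \<le> n" for i n
      using that
    proof (induction n rule: dec_induct)
      case (step n)
      then show ?case using B[of n] unfolding S_def by (simp add: Suc_diff_le algebra_simps)
    qed simp
    have "\<forall>\<^sub>F n in sequentially. \<forall>m\<ge>n. gromov_product (x n) x0 (x m) \<le> e n + D"
    proof (rule eventually_detour_bound[OF c up low R])
      show "\<forall>\<^sub>F n in sequentially. e n \<le> c / 2 * real n"
        using eventually_ln_le_linear[OF half_gt_zero[OF c], of A1 A2] eventually_gt_at_top[of 0]
        by eventually_elim (use c e_eq in auto)
      show "\<forall>\<^sub>F n in sequentially. \<forall>m. n \<le> m \<and> m \<le> R * n \<longrightarrow> gromov_product (x n) x0 (x m) \<le> e n"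
        using prog' eventually_ge_at_top[of 1]
      proof eventually_elim
        case (elim n)
        show ?case
        proof (intro allI impI)
          fix m assume m: "n \<le> m \<and> m \<le> R * n"
          obtain i where i: "i \<le> n" "real (n - i) \<le> K * l n + (4 * D + 2 * ((2 * l n + 1) * D + B)) / c"
            "gromov_product (x n) x0 (x m) \<le> dist (x i) (x n) + ((2 * l n + 1) * D + B)"
            using detour[of n B m] elim m B B0 unfolding l_def by blast
          have "dist (x i) (x n) \<le> B * real (n - i)" using S[OF i(1)] SB[OF i(1)] by linarith
          also have "\<dots> \<le> B * (K * l n + (4 * D + 2 * ((2 * l n + 1) * D + B)) / c)"
            using i(2) B0 by (rule mult_left_mono)
          finally show "gromov_product (x n) x0 (x m) \<le> e n" using i(3) unfolding e_def by linarith
        qed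
      qed
    qed
    \<comment> \<open>Since e < 3, this gives ln n \<ge> 1, which absorbs the additive constants
      into the multiple of ln n.\<close>
    moreover have "\<forall>\<^sub>F n in sequentially. 3 \<le> n" by (rule eventually_ge_at_top)
    ultimately have "\<forall>\<^sub>F n in sequentially. infdist (x n) (\<gamma> ` {0..}) \<le> (A1 + \<bar>A2\<bar> + 3 * D + 1) * ln (real n)"
    proof eventually_elim
      case (elim n)
      have "1 \<le> ln (real n)"
      proof -
        have "exp 1 \<le> real n" using exp_le elim(2) by linarith
        then show ?thesis using elim(2) by (simp add: ln_ge_iff)
      qed
      then have "(\<bar>A2\<bar> + 3 * D + 1) * 1 \<le> (\<bar>A2\<bar> + 3 * D + 1) * ln (real n)"
        using D_nonneg by (intro mult_left_mono) auto
      moreover have "infdist (x n) (\<gamma> ` {0..}) \<le> (e n + D) + 2 * D + 1" using elim(1) by (rule close)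
      ultimately show ?case using e_eq[of n] elim(2) by (simp add: algebra_simps)
    qed
    then show ?thesis by blast
  qed
  ultimately show ?thesis using that \<gamma>(1) by blast
qed

end

section \<open>Sums of independent identically distributed variables\<close>

lemma sum_powers_below:
  fixes f :: real
  assumes "0 \<le> f"
  shows "(\<Sum>k<n. 2 ^ k * of_bool (2 ^ k < f)) \<le> 2 * f"
proof -
  \<comment> \<open>The second bound carries the induction: if 2^n < f, the new term at most doubles
    it to 2 * 2^n, which is below 2 f.\<close>
  have "(\<Sum>k<n. 2 ^ k * of_bool (2 ^ k < f)) \<le> 2 * f \<and> (\<Sum>k<n. 2 ^ k * of_bool (2 ^ k < f)) \<le> (2::real) ^ n"
    using assms by (induction n) (auto simp: of_bool_def)
  then show ?thesis by blast
qed

lemma sum_inverse_powers_above: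
  fixes f :: real
  assumes f: "0 \<le> f"
  shows "(\<Sum>k<n. (f * of_bool (f \<le> 2 ^ k))\<^sup>2 / 2 ^ k) \<le> 2 * f"
proof -
  let ?s = "\<lambda>n. \<Sum>k<n. (f * of_bool (f \<le> 2 ^ k))\<^sup>2 / 2 ^ k"
  \<comment> \<open>The subtracted term is the part of the geometric series still to come; the sum
    vanishes until 2^k first reaches \<open>f\<close>.\<close>
  have "?s n = 0 \<or> ?s n \<le> 2 * f - 2 * (f\<^sup>2 / 2 ^ n)"
  proof (induction n)
    case (Suc n)
    show ?case
    proof (cases "f \<le> 2 ^ n")
      case True
      then have "f * f \<le> f * 2 ^ n" using f by (intro mult_left_mono) auto
      then have sq: "f\<^sup>2 / 2 ^ n \<le> f" by (simp add: power2_eq_square field_simps)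
      show ?thesis
        using Suc
      proof
        assume "?s n = 0"
        then show ?thesis using True sq by (intro disjI2) simp
      next
        assume "?s n \<le> 2 * f - 2 * (f\<^sup>2 / 2 ^ n)"
        then show ?thesis using True by (intro disjI2) simp
      qed
    next
      case False
      then have eq: "?s (Suc n) = ?s n" by simp
      have "f\<^sup>2 / 2 ^ Suc n \<le> f\<^sup>2 / 2 ^ n" by (simp add: field_simps)
      then show ?thesis unfolding eq using Suc by linarith
    qed
  qed simp
  moreover have "0 \<le> 2 * (f\<^sup>2 / 2 ^ n)" by simp
  ultimately show ?thesis using f by linarith
qed

context prob_space
begin

lemma sum_indep_deviation:
  fixes Z :: "nat \<Rightarrow> 'a \<Rightarrow> real"
  assumes ind: "indep_vars (\<lambda>_. borel) Z UNIV" and B: "\<And>i \<omega>. \<bar>Z i \<omega>\<bar> \<le> B"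
    and mean: "\<And>i. expectation (Z i) = m" and second: "\<And>i. expectation (\<lambda>\<omega>. (Z i \<omega>)\<^sup>2) \<le> v"
    and a: "0 < a"
  shows "prob {\<omega> \<in> space M. a \<le> \<bar>(\<Sum>i<n. Z i \<omega>) - real n * m\<bar>} \<le> real n * v / a\<^sup>2"
proof -
  have meas [measurable]: "random_variable borel (Z i)" for i
    using ind unfolding indep_vars_def by auto
  have int: "integrable M (Z i)" for i
    using B by (intro integrable_const_bound[where B = B]) auto
  have int2: "integrable M (\<lambda>\<omega>. Z i \<omega> * Z j \<omega>)" for i j
  proof (rule integrable_const_bound[where B = "B * B"])
    show "AE \<omega> in M. norm (Z i \<omega> * Z j \<omega>) \<le> B * B"
      using B by (auto simp: abs_mult intro!: mult_mono order_trans[OF abs_ge_zero B])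
  qed simp
  have prod: "expectation (\<lambda>\<omega>. Z i \<omega> * Z j \<omega>) = m * m" if "i \<noteq> j" for i j
  proof -
    have "expectation (\<lambda>\<omega>. \<Prod>l\<in>{i, j}. Z l \<omega>) = (\<Prod>l\<in>{i, j}. expectation (Z l))"
      using int by (intro indep_vars_lebesgue_integral indep_vars_subset[OF ind]) auto
    then show ?thesis using that mean by simp
  qed
  let ?T = "\<lambda>\<omega>. \<Sum>i<n. Z i \<omega>"
  have T_sq: "(?T \<omega>)\<^sup>2 = (\<Sum>i<n. \<Sum>j<n. Z i \<omega> * Z j \<omega>)" for \<omega>
    by (simp add: power2_eq_square sum_product)
  have intT2: "integrable M (\<lambda>\<omega>. (?T \<omega>)\<^sup>2)"
    unfolding T_sq using int2 by (intro Bochner_Integration.integrable_sum) auto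
  have intT: "integrable M ?T" using int by (intro Bochner_Integration.integrable_sum) auto
  have ET: "expectation ?T = real n * m" using int mean by simp
  have "expectation (\<lambda>\<omega>. (?T \<omega>)\<^sup>2) = (\<Sum>i<n. \<Sum>j<n. expectation (\<lambda>\<omega>. Z i \<omega> * Z j \<omega>))"
    unfolding T_sq using int2 by simp
  also have "\<dots> \<le> (\<Sum>i<n. \<Sum>j<n. m * m + (if i = j then v else 0))"
  proof (intro sum_mono)
    fix i j
    show "expectation (\<lambda>\<omega>. Z i \<omega> * Z j \<omega>) \<le> m * m + (if i = j then v else 0)"
      using prod[of i j] second[of i] by (cases "i = j") (auto simp: power2_eq_square intro: add_increasing)
  qed
  also have "\<dots> = (real n * m)\<^sup>2 + real n * v"
    by (simp add: sum.distrib power2_eq_square algebra_simps)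
  finally have var: "variance ?T \<le> real n * v"
    using variance_eq[OF intT intT2] ET by simp
  have "prob {\<omega> \<in> space M. a \<le> \<bar>?T \<omega> - real n * m\<bar>} \<le> variance ?T / a\<^sup>2"
    using Chebyshev_inequality[of ?T a] intT2 a unfolding ET by simp
  also have "\<dots> \<le> real n * v / a\<^sup>2" using var by (intro divide_right_mono) auto
  finally show ?thesis .
qed

text \<open>
  Etemadi's truncation: along the times \<open>2 ^ k\<close>, cut the variables off at height \<open>2 ^ k\<close>. Monotonicity
  fills the gaps between dyadic times at the cost of a factor 2.
\<close>

lemma iid_sum_upper_bound:
  fixes X :: "nat \<Rightarrow> 'a \<Rightarrow> 'g" and f :: "'g \<Rightarrow> real"
  assumes ind: "indep_vars (\<lambda>_. count_space UNIV) X UNIV"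
    and dist: "\<And>i. distr M (count_space UNIV) (X i) = measure_pmf \<mu>"
    and f: "\<And>x. 0 \<le> f x" and int: "integrable (measure_pmf \<mu>) f"
    and \<epsilon>: "(\<integral>x. f x \<partial>measure_pmf \<mu>) \<le> \<epsilon>" "0 < \<epsilon>"
  shows "AE \<omega> in M. \<forall>\<^sub>F n in sequentially. (\<Sum>i<n. f (X i \<omega>)) \<le> 4 * \<epsilon> * real n"
proof -
  have X [measurable]: "X i \<in> measurable M (count_space UNIV)" for i
    using ind unfolding indep_vars_def by auto
  have prob_X: "prob {\<omega> \<in> space M. P (X i \<omega>)} = measure_pmf.prob \<mu> {x. P x}" for P i
  proof -
    have "measure_pmf.prob \<mu> {x. P x} = measure (distr M (count_space UNIV) (X i)) {x. P x}"
      unfolding dist ..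
    also have "\<dots> = prob {\<omega> \<in> space M. P (X i \<omega>)}"
      by (subst measure_distr) (auto intro!: arg_cong[where f = prob])
    finally show ?thesis by simp
  qed
  have exp_X: "expectation (\<lambda>\<omega>. h (X i \<omega>)) = (\<integral>x. h x \<partial>measure_pmf \<mu>)" for h :: "'g \<Rightarrow> real" and i
    unfolding dist[of i, symmetric] by (simp add: integral_distr)
  define h where "h k x = f x * of_bool (f x \<le> 2 ^ k)" for k x
  have h: "0 \<le> h k x" "h k x \<le> f x" "h k x \<le> 2 ^ k" for k x
    unfolding h_def using f[of x] by (auto simp: of_bool_def)
  \<comment> \<open>Outside \<open>A k\<close>, truncation changes none of the first 2^k variables
    and their truncated sum is at most twice the tolerated mean.\<close>
  define A where "A k = {\<omega> \<in> space M. (\<exists>i<2 ^ k. 2 ^ k < f (X i \<omega>)) \<or> 2 * \<epsilon> * 2 ^ k < (\<Sum>i<2 ^ k. h k (X i \<omega>))}" for k :: nat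
  have [measurable]: "(\<lambda>\<omega>. F (X i \<omega>)) \<in> borel_measurable M" for F :: "'g \<Rightarrow> real" and i
    by (rule measurable_compose[OF X]) simp
  have A_meas [measurable]: "A k \<in> events" for k
    unfolding A_def by simp
  \<comment> \<open>The integrand of the union bound plus Chebyshev's bound for \<open>A k\<close>.
    Summed over \<open>k\<close> it is at most a constant times \<open>f\<close>, so a first moment
    is enough for Borel-Cantelli.\<close>
  define u where "u k x = 2 ^ k * of_bool (2 ^ k < f x) + (h k x)\<^sup>2 / 2 ^ k / \<epsilon>\<^sup>2" for k :: nat and x
  have int_bd: "integrable (measure_pmf \<mu>) F" if "\<And>x. \<bar>F x\<bar> \<le> B" for F :: "'g \<Rightarrow> real" and B
    using that by (intro measure_pmf.integrable_const_bound[where B = B]) auto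
  have h_sq_le: "(h k x)\<^sup>2 \<le> (2 ^ k)\<^sup>2" for k x
    using h(1,3) by (intro power_mono) auto
  have int_h2: "integrable (measure_pmf \<mu>) (\<lambda>x. (h k x)\<^sup>2)" for k
    using h_sq_le by (intro int_bd[of _ "(2 ^ k)\<^sup>2"]) auto
  have int_h: "integrable (measure_pmf \<mu>) (h k)" for k
    using h by (intro int_bd[of _ "2 ^ k"]) auto
  have int_ind: "integrable (measure_pmf \<mu>) (\<lambda>x. of_bool (2 ^ k < f x) :: real)" for k :: nat
    by (intro int_bd[of _ 1]) auto
  have prob_A: "prob (A k) \<le> (\<integral>x. u k x \<partial>measure_pmf \<mu>)" for k
  proof -
    let ?N = "2 ^ k :: nat"
    define m where "m = (\<integral>x. h k x \<partial>measure_pmf \<mu>)"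
    define v where "v = (\<integral>x. (h k x)\<^sup>2 \<partial>measure_pmf \<mu>)"
    have "m \<le> (\<integral>x. f x \<partial>measure_pmf \<mu>)" unfolding m_def using h int int_h by (intro integral_mono) auto
    with \<epsilon> have m: "m \<le> \<epsilon>" by simp
    have "A k \<subseteq> (\<Union>i<?N. {\<omega> \<in> space M. 2 ^ k < f (X i \<omega>)}) \<union>
        {\<omega> \<in> space M. \<epsilon> * 2 ^ k \<le> \<bar>(\<Sum>i<?N. h k (X i \<omega>)) - real ?N * m\<bar>}"
    proof
      fix \<omega> assume "\<omega> \<in> A k"
      moreover have "\<epsilon> * 2 ^ k \<le> \<bar>S - real ?N * m\<bar>" if "2 * \<epsilon> * 2 ^ k < S" for S
      proof -
        have "m * 2 ^ k \<le> \<epsilon> * 2 ^ k" using m by simp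
        then have "\<epsilon> * 2 ^ k \<le> S - m * 2 ^ k" using that by linarith
        then show ?thesis by (simp add: mult.commute)
      qed
      ultimately show "\<omega> \<in> (\<Union>i<?N. {\<omega> \<in> space M. 2 ^ k < f (X i \<omega>)}) \<union>
        {\<omega> \<in> space M. \<epsilon> * 2 ^ k \<le> \<bar>(\<Sum>i<?N. h k (X i \<omega>)) - real ?N * m\<bar>}"
        unfolding A_def by blast
    qed
    then have "prob (A k) \<le> prob ((\<Union>i<?N. {\<omega> \<in> space M. 2 ^ k < f (X i \<omega>)}) \<union>
        {\<omega> \<in> space M. \<epsilon> * 2 ^ k \<le> \<bar>(\<Sum>i<?N. h k (X i \<omega>)) - real ?N * m\<bar>})"
      by (intro finite_measure_mono) auto
    also have "\<dots> \<le> prob (\<Union>i<?N. {\<omega> \<in> space M. 2 ^ k < f (X i \<omega>)}) +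
        prob {\<omega> \<in> space M. \<epsilon> * 2 ^ k \<le> \<bar>(\<Sum>i<?N. h k (X i \<omega>)) - real ?N * m\<bar>}"
      by (intro measure_Un_le) auto
    also have "\<dots> \<le> 2 ^ k * measure_pmf.prob \<mu> {x. 2 ^ k < f x} + real ?N * v / (\<epsilon> * 2 ^ k)\<^sup>2"
    proof (intro add_mono)
      have "prob (\<Union>i<?N. {\<omega> \<in> space M. 2 ^ k < f (X i \<omega>)})
        \<le> (\<Sum>i<?N. prob {\<omega> \<in> space M. 2 ^ k < f (X i \<omega>)})"
        by (intro measure_UNION_le) auto
      then show "prob (\<Union>i<?N. {\<omega> \<in> space M. 2 ^ k < f (X i \<omega>)}) \<le> 2 ^ k * measure_pmf.prob \<mu> {x. 2 ^ k < f x}"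
        by (simp add: prob_X[of "\<lambda>x. 2 ^ k < f x"])
      show "prob {\<omega> \<in> space M. \<epsilon> * 2 ^ k \<le> \<bar>(\<Sum>i<?N. h k (X i \<omega>)) - real ?N * m\<bar>} \<le> real ?N * v / (\<epsilon> * 2 ^ k)\<^sup>2"
      proof (rule sum_indep_deviation[where B = "2 ^ k"])
        show "indep_vars (\<lambda>_. borel) (\<lambda>i \<omega>. h k (X i \<omega>)) UNIV"
          by (rule indep_vars_compose2[OF ind]) auto
        show "expectation (\<lambda>\<omega>. h k (X i \<omega>)) = m" for i unfolding exp_X m_def ..
        show "expectation (\<lambda>\<omega>. (h k (X i \<omega>))\<^sup>2) \<le> v" for i
          using exp_X[of "\<lambda>x. (h k x)\<^sup>2" i] unfolding v_def by simp
      qed (use h \<epsilon> in auto)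
    qed
    also have "\<dots> = (\<integral>x. 2 ^ k * of_bool (2 ^ k < f x) \<partial>measure_pmf \<mu>) + (\<integral>x. (h k x)\<^sup>2 / 2 ^ k / \<epsilon>\<^sup>2 \<partial>measure_pmf \<mu>)"
    proof -
      have "(\<integral>x. (of_bool (2 ^ k < f x) :: real) \<partial>measure_pmf \<mu>) = (\<integral>x. indicator {x. 2 ^ k < f x} x \<partial>measure_pmf \<mu>)"
        by (intro Bochner_Integration.integral_cong) (auto simp: indicator_def)
      then have "measure_pmf.prob \<mu> {x. 2 ^ k < f x} = (\<integral>x. of_bool (2 ^ k < f x) \<partial>measure_pmf \<mu>)"
        by simp
      moreover have "real ?N * v / (\<epsilon> * 2 ^ k)\<^sup>2 = v / 2 ^ k / \<epsilon>\<^sup>2"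
        by (simp add: power2_eq_square)
      ultimately show ?thesis unfolding v_def by simp
    qed
    also have "\<dots> = (\<integral>x. u k x \<partial>measure_pmf \<mu>)"
      unfolding u_def using int_ind int_h2 by (intro Bochner_Integration.integral_add[symmetric]) auto
    finally show ?thesis .
  qed
  have "summable (\<lambda>k. prob (A k))"
  proof (rule summableI_nonneg_bounded)
    fix n
    have int_u: "integrable (measure_pmf \<mu>) (u k)" for k
      unfolding u_def using int_ind int_h2 by (intro Bochner_Integration.integrable_add) auto
    have "(\<Sum>k<n. prob (A k)) \<le> (\<Sum>k<n. \<integral>x. u k x \<partial>measure_pmf \<mu>)"
      by (intro sum_mono prob_A)
    also have "\<dots> = (\<integral>x. (\<Sum>k<n. u k x) \<partial>measure_pmf \<mu>)"
      using int_u by (intro Bochner_Integration.integral_sum[symmetric]) auto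
    also have "\<dots> \<le> (\<integral>x. (2 + 2 / \<epsilon>\<^sup>2) * f x \<partial>measure_pmf \<mu>)"
    proof (intro integral_mono)
      fix x
      have "(\<Sum>k<n. u k x) = (\<Sum>k<n. 2 ^ k * of_bool (2 ^ k < f x)) + (\<Sum>k<n. (h k x)\<^sup>2 / 2 ^ k) / \<epsilon>\<^sup>2"
        unfolding u_def by (simp add: sum.distrib sum_divide_distrib)
      also have "\<dots> \<le> 2 * f x + 2 * f x / \<epsilon>\<^sup>2"
        unfolding h_def by (intro add_mono divide_right_mono sum_powers_below sum_inverse_powers_above f) simp
      finally show "(\<Sum>k<n. u k x) \<le> (2 + 2 / \<epsilon>\<^sup>2) * f x" by (simp add: algebra_simps)
    qed (use int_u int in auto)
    finally show "(\<Sum>k<n. prob (A k)) \<le> (\<integral>x. (2 + 2 / \<epsilon>\<^sup>2) * f x \<partial>measure_pmf \<mu>)" .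
  qed simp
  then have "AE \<omega> in M. \<forall>\<^sub>F k in sequentially. \<omega> \<in> space M - A k"
    by (intro borel_cantelli_AE1) (auto simp: emeasure_eq_measure)
  then show ?thesis
  proof eventually_elim
    case (elim \<omega>)
    then obtain k0 where k0: "\<And>k. k0 \<le> k \<Longrightarrow> \<omega> \<in> space M - A k" unfolding eventually_sequentially by blast
    have dyadic: "(\<Sum>i<2 ^ k. f (X i \<omega>)) \<le> 2 * \<epsilon> * 2 ^ k" if "k0 \<le> k" for k
    proof -
      have "\<And>i. i < 2 ^ k \<Longrightarrow> f (X i \<omega>) \<le> 2 ^ k" "(\<Sum>i<2 ^ k. h k (X i \<omega>)) \<le> 2 * \<epsilon> * 2 ^ k"
        using k0[OF that] unfolding A_def by (auto simp: not_less) (meson not_le)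
      then show ?thesis by (simp add: h_def)
    qed
    have "(\<Sum>i<n. f (X i \<omega>)) \<le> 4 * \<epsilon> * real n" if n: "2 ^ k0 \<le> n" for n
    proof -
      have "1 \<le> n" using n order_trans[OF one_le_power[of 2 k0] n] by simp
      then obtain k where k: "2 ^ k \<le> n" "n < 2 ^ (k + 1)"
        using ex_power_ivl1[of 2 n] by auto
      have "k0 \<le> k"
      proof -
        have "2 ^ k0 < (2::nat) ^ (k + 1)" using n k by linarith
        then have "k0 < k + 1" by (simp only: power_strict_increasing_iff[of 2])
        then show ?thesis by simp
      qed
      have "(\<Sum>i<n. f (X i \<omega>)) \<le> (\<Sum>i<2 ^ (k + 1). f (X i \<omega>))"
        using k f by (intro sum_mono2) auto
      also have "\<dots> \<le> 2 * \<epsilon> * 2 ^ (k + 1)" using \<open>k0 \<le> k\<close> by (intro dyadic) simp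
      also have "\<dots> = 4 * \<epsilon> * real (2 ^ k)" by simp
      also have "\<dots> \<le> 4 * \<epsilon> * real n"
      proof (rule mult_left_mono)
        show "real (2 ^ k) \<le> real n" using k(1) by (simp only: of_nat_le_iff)
      qed (use \<epsilon>(2) in simp)
      finally show ?thesis .
    qed
    then show ?case unfolding eventually_sequentially by blast
  qed
qed

text \<open>Split \<open>f\<close> at a height R: the part below R contributes at most R (n - i),
  and the excess has small mean by dominated convergence, so its sum over all of the first
  \<open>n\<close> variables is already small. Only the countably many levels 1 / (m + 1) are used,
  so one null set serves every \<open>\<epsilon>\<close>.\<close>

lemma iid_sum_increments:
  fixes X :: "nat \<Rightarrow> 'a \<Rightarrow> 'g" and f :: "'g \<Rightarrow> real"
  assumes ind: "indep_vars (\<lambda>_. count_space UNIV) X UNIV"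
    and dist: "\<And>i. distr M (count_space UNIV) (X i) = measure_pmf \<mu>"
    and f: "\<And>x. 0 \<le> f x" and int: "integrable (measure_pmf \<mu>) f"
  shows "AE \<omega> in M. \<forall>\<epsilon>>0. \<exists>\<eta>>0. \<forall>\<^sub>F n in sequentially. \<forall>i\<le>n. real (n - i) \<le> \<eta> * real n \<longrightarrow>
    (\<Sum>l<n. f (X l \<omega>)) - (\<Sum>l<i. f (X l \<omega>)) \<le> \<epsilon> * real n"
proof -
  define t where "t R x = max (f x - R) 0" for R x
  have int_t: "integrable (measure_pmf \<mu>) (t R)" if "0 \<le> R" for R
    using f that by (intro Bochner_Integration.integrable_bound[OF int]) (auto simp: t_def)
  have "(\<lambda>R. \<integral>x. t (real R) x \<partial>measure_pmf \<mu>) \<longlonglongrightarrow> (\<integral>x. 0 \<partial>measure_pmf \<mu>)"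
  proof (rule integral_dominated_convergence[where w = f])
    show "AE x in measure_pmf \<mu>. (\<lambda>R. t (real R) x) \<longlonglongrightarrow> 0"
    proof (intro AE_I2 tendsto_eventually)
      fix x
      show "\<forall>\<^sub>F R in sequentially. t (real R) x = 0"
        using eventually_ge_at_top[of "nat \<lceil>f x\<rceil>"]
      proof eventually_elim
        case (elim R)
        then have "f x \<le> real R" by linarith
        then show ?case by (simp add: t_def)
      qed
    qed
    show "AE x in measure_pmf \<mu>. norm (t (real R) x) \<le> f x" for R
      using f by (auto simp: t_def)
  qed (use int in auto)
  then have lim: "(\<lambda>R. \<integral>x. t (real R) x \<partial>measure_pmf \<mu>) \<longlonglongrightarrow> 0" by simp
  have "\<exists>R. (\<integral>x. t (real R) x \<partial>measure_pmf \<mu>) \<le> 1 / real (Suc m)" for m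
  proof -
    have "\<forall>\<^sub>F R in sequentially. (\<integral>x. t (real R) x \<partial>measure_pmf \<mu>) < 1 / real (Suc m)"
      using lim by (rule order_tendstoD) simp
    then show ?thesis by (metis (mono_tags, lifting) eventually_sequentially less_imp_le order_refl)
  qed
  then obtain R where R: "\<And>m. (\<integral>x. t (real (R m)) x \<partial>measure_pmf \<mu>) \<le> 1 / real (Suc m)" by metis
  have "AE \<omega> in M. \<forall>m. \<forall>\<^sub>F n in sequentially. (\<Sum>l<n. t (real (R m)) (X l \<omega>)) \<le> 4 * (1 / real (Suc m)) * real n"
    unfolding AE_all_countable
    by (intro allI iid_sum_upper_bound[OF ind dist] R int_t) (auto simp: t_def)
  then show ?thesis
  proof eventually_elim
    case (elim \<omega>)
    show ?case
    proof (intro allI impI)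
      fix \<epsilon> :: real assume \<epsilon>: "0 < \<epsilon>"
      define m where "m = nat \<lceil>8 / \<epsilon>\<rceil>"
      have "8 / \<epsilon> \<le> real (Suc m)" unfolding m_def by linarith
      then have m: "4 * (1 / real (Suc m)) \<le> \<epsilon> / 2" using \<epsilon> by (simp add: field_simps)
      define \<eta> where "\<eta> = \<epsilon> / (2 * (real (R m) + 1))"
      have \<eta>: "0 < \<eta>" "real (R m) * \<eta> \<le> \<epsilon> / 2" unfolding \<eta>_def using \<epsilon> by (auto simp: field_simps)
      have "\<forall>\<^sub>F n in sequentially. (\<Sum>l<n. t (real (R m)) (X l \<omega>)) \<le> 4 * (1 / real (Suc m)) * real n"
        using elim by blast
      then have "\<forall>\<^sub>F n in sequentially. \<forall>i\<le>n. real (n - i) \<le> \<eta> * real n \<longrightarrow>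
        (\<Sum>l<n. f (X l \<omega>)) - (\<Sum>l<i. f (X l \<omega>)) \<le> \<epsilon> * real n"
      proof eventually_elim
        case (elim n)
        show ?case
        proof (intro allI impI)
          fix i assume i: "i \<le> n" "real (n - i) \<le> \<eta> * real n"
          have "(\<Sum>l<n. f (X l \<omega>)) - (\<Sum>l<i. f (X l \<omega>)) = (\<Sum>l\<in>{i..<n}. f (X l \<omega>))"
            using i(1) sum.atLeastLessThan_concat[of 0 i n "\<lambda>l. f (X l \<omega>)"] by (simp add: lessThan_atLeast0)
          also have "\<dots> \<le> (\<Sum>l\<in>{i..<n}. real (R m) + t (real (R m)) (X l \<omega>))"
            by (intro sum_mono) (auto simp: t_def)
          also have "\<dots> = real (R m) * real (n - i) + (\<Sum>l\<in>{i..<n}. t (real (R m)) (X l \<omega>))"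
            by (simp add: sum.distrib mult.commute)
          also have "\<dots> \<le> real (R m) * (\<eta> * real n) + (\<Sum>l<n. t (real (R m)) (X l \<omega>))"
            using i by (intro add_mono mult_left_mono sum_mono2) (auto simp: t_def)
          also have "\<dots> \<le> \<epsilon> / 2 * real n + \<epsilon> / 2 * real n"
          proof (intro add_mono)
            show "real (R m) * (\<eta> * real n) \<le> \<epsilon> / 2 * real n"
              using mult_right_mono[OF \<eta>(2), of "real n"] by (simp add: mult.assoc)
            show "(\<Sum>l<n. t (real (R m)) (X l \<omega>)) \<le> \<epsilon> / 2 * real n"
              using elim mult_right_mono[OF m, of "real n"] by linarith
          qed
          finally show "(\<Sum>l<n. f (X l \<omega>)) - (\<Sum>l<i. f (X l \<omega>)) \<le> \<epsilon> * real n" by simp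
        qed
      qed
      then show "\<exists>\<eta>>0. \<forall>\<^sub>F n in sequentially. \<forall>i\<le>n. real (n - i) \<le> \<eta> * real n \<longrightarrow>
        (\<Sum>l<n. f (X l \<omega>)) - (\<Sum>l<i. f (X l \<omega>)) \<le> \<epsilon> * real n"
        using \<eta>(1) by blast
    qed
  qed
qed

end

section \<open>Random walks\<close>

context prob_space
begin

lemma indep_vars_shift:
  assumes "indep_vars (\<lambda>_. N) Y {1..}"
  shows "indep_vars (\<lambda>_. N) (\<lambda>i. Y (Suc i)) UNIV"
proof -
  have "indep_vars (\<lambda>j. PiM {Suc j} (\<lambda>_. N)) (\<lambda>j \<omega>. restrict (\<lambda>i. Y i \<omega>) {Suc j}) UNIV"
    by (rule indep_vars_restrict[OF assms]) (auto simp: disjoint_family_on_def)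
  then have "indep_vars (\<lambda>_. N) (\<lambda>j \<omega>. (restrict (\<lambda>i. Y i \<omega>) {Suc j}) (Suc j)) UNIV"
    by (rule indep_vars_compose2) simp
  then show ?thesis by simp
qed

end

context group
begin

lemma walk_closed: "(\<And>l. 1 \<le> l \<Longrightarrow> f l \<in> carrier G) \<Longrightarrow> walk G f n \<in> carrier G"
  by (induction n) auto

lemma walk_cong: "(\<And>l. 1 \<le> l \<Longrightarrow> l \<le> n \<Longrightarrow> f l = f' l) \<Longrightarrow> walk G f n = walk G f' n"
  by (induction n) auto

lemma walk_add:
  assumes f: "\<And>l. 1 \<le> l \<Longrightarrow> f l \<in> carrier G"
  shows "walk G f (i + n) = walk G f i \<otimes> walk G (\<lambda>l. f (i + l)) n"
proof (induction n)
  case 0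
  then show ?case using walk_closed[OF f] by simp
next
  case (Suc n)
  have "walk G (\<lambda>l. f (i + l)) n \<in> carrier G" by (intro walk_closed f) simp
  with Suc f walk_closed[OF f] show ?case by (simp add: m_assoc)
qed

text \<open>The product of two measurable group-valued maps is handled by splitting over the
  countably many values in \<open>C\<close> of the last factor; hence the increments must be maps
  into a countable set.\<close>

lemma measurable_walk:
  assumes "countable C" "{i<..i + n} \<subseteq> J"
  shows "(\<lambda>f. walk G (\<lambda>l. f (i + l)) n) \<in> measurable (PiM J (\<lambda>_. count_space C)) (count_space UNIV)"
  using assms(2)
proof (induction n)
  case (Suc n)
  have IH: "(\<lambda>f. walk G (\<lambda>l. f (i + l)) n) \<in> measurable (PiM J (\<lambda>_. count_space C)) (count_space UNIV)"
    using Suc.prems by (intro Suc.IH) auto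
  have "(\<lambda>f. walk G (\<lambda>l. f (i + l)) n \<otimes> f (i + Suc n)) \<in> measurable (PiM J (\<lambda>_. count_space C)) (count_space UNIV)"
  proof (rule measurable_compose_countable'[where I = C and f = "\<lambda>c f. walk G (\<lambda>l. f (i + l)) n \<otimes> c"])
    show "(\<lambda>f. f (i + Suc n)) \<in> measurable (PiM J (\<lambda>_. count_space C)) (count_space C)"
      using Suc.prems by (intro measurable_component_singleton) auto
    show "(\<lambda>f. walk G (\<lambda>l. f (i + l)) n \<otimes> c) \<in> measurable (PiM J (\<lambda>_. count_space C)) (count_space UNIV)" for c
      using measurable_compose[OF IH, of "\<lambda>w. w \<otimes> c"] by simp
  qed (use assms in auto)
  then show ?case by simp
qed simp

end

text \<open>The increments lie in the countable support everywhere, not just almost surely, which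
  gives the measurability of the walk; the final theorem gets there by a change on a null
  set.\<close>

locale iid_increments = group G + prob_space M
  for G :: "('g, 'b) monoid_scheme" (structure) and M :: "'w measure" +
  fixes \<mu> :: "'g pmf" and Y :: "nat \<Rightarrow> 'w \<Rightarrow> 'g"
  assumes \<mu>_carrier: "set_pmf \<mu> \<subseteq> carrier G"
    and indep_Y: "indep_vars (\<lambda>_. count_space (set_pmf \<mu>)) Y {1..}"
    and distr_Y: "\<And>i c. 1 \<le> i \<Longrightarrow> prob (Y i -` {c} \<inter> space M) = pmf \<mu> c"
begin

lemma Y_measurable: "1 \<le> i \<Longrightarrow> Y i \<in> measurable M (count_space (set_pmf \<mu>))"
  using indep_Y unfolding indep_vars_def by auto

lemma Y_in_support: "1 \<le> i \<Longrightarrow> \<omega> \<in> space M \<Longrightarrow> Y i \<omega> \<in> set_pmf \<mu>"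
  using measurable_space[OF Y_measurable] by auto

lemma indep_walk_increment:
  "indep_var (count_space UNIV) (\<lambda>\<omega>. walk G (\<lambda>l. Y (i + l) \<omega>) n)
    (count_space (set_pmf \<mu>)) (Y (i + Suc n))"
proof -
  let ?A = "{i<..i + n}" and ?B = "{i + Suc n}"
  have "indep_var (PiM ?A (\<lambda>_. count_space (set_pmf \<mu>))) (\<lambda>\<omega>. restrict (\<lambda>j. Y j \<omega>) ?A)
      (PiM ?B (\<lambda>_. count_space (set_pmf \<mu>))) (\<lambda>\<omega>. restrict (\<lambda>j. Y j \<omega>) ?B)"
    by (rule indep_var_restrict[OF indep_Y]) auto
  then have "indep_var (count_space UNIV) ((\<lambda>f. walk G (\<lambda>l. f (i + l)) n) \<circ> (\<lambda>\<omega>. restrict (\<lambda>j. Y j \<omega>) ?A))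
      (count_space (set_pmf \<mu>)) ((\<lambda>f. f (i + Suc n)) \<circ> (\<lambda>\<omega>. restrict (\<lambda>j. Y j \<omega>) ?B))"
    by (rule indep_var_compose)
      (auto intro!: measurable_walk measurable_component_singleton countable_set_pmf)
  moreover have "(\<lambda>f. walk G (\<lambda>l. f (i + l)) n) \<circ> (\<lambda>\<omega>. restrict (\<lambda>j. Y j \<omega>) ?A) = (\<lambda>\<omega>. walk G (\<lambda>l. Y (i + l) \<omega>) n)"
    unfolding comp_def by (intro ext walk_cong) auto
  moreover have "(\<lambda>f. f (i + Suc n)) \<circ> (\<lambda>\<omega>. restrict (\<lambda>j. Y j \<omega>) ?B) = Y (i + Suc n)"
    by (simp add: comp_def fun_eq_iff)
  ultimately show ?thesis by simp
qed

lemma walk_random_variable: "(\<lambda>\<omega>. walk G (\<lambda>l. Y (i + l) \<omega>) n) \<in> measurable M (count_space UNIV)"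
  by (rule indep_var_rv1[OF indep_walk_increment])

text \<open>Disintegration over the value of the last increment. The law does not depend on the
  starting index \<open>i\<close>, so the escape estimate applies to every window of the
  walk.\<close>

lemma walk_distribution:
  "prob ((\<lambda>\<omega>. walk G (\<lambda>l. Y (i + l) \<omega>) n) -` A \<inter> space M) = measure_pmf.prob (convolution_power G \<mu> n) A"
proof (induction n arbitrary: A)
  case 0
  then show ?case by (auto simp: measure_return_pmf indicator_def prob_space)
next
  case (Suc n)
  let ?W = "\<lambda>n \<omega>. walk G (\<lambda>l. Y (i + l) \<omega>) n" and ?p = "convolution_power G \<mu>" and ?C = "set_pmf \<mu>"
  define B where "B c = {w. w \<otimes> c \<in> A}" for c
  define E where "E c = (\<lambda>\<omega>. (?W n \<omega>, Y (i + Suc n) \<omega>)) -` (B c \<times> {c}) \<inter> space M" for c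
  have E_sets: "E c \<in> events" for c
  proof -
    have "E c = (?W n -` B c \<inter> space M) \<inter> (Y (i + Suc n) -` ({c} \<inter> ?C) \<inter> space M)"
      unfolding E_def using Y_in_support[of "i + Suc n"] by auto
    also have "\<dots> \<in> events"
    proof (rule sets.Int)
      show "?W n -` B c \<inter> space M \<in> events" by (rule measurable_sets[OF walk_random_variable]) simp
      show "Y (i + Suc n) -` ({c} \<inter> ?C) \<inter> space M \<in> events" by (rule measurable_sets[OF Y_measurable]) auto
    qed
    finally show ?thesis .
  qed
  have prob_E: "prob (E c) = measure_pmf.prob (?p n) (B c) * pmf \<mu> c" if "c \<in> ?C" for c
    unfolding E_def using that
    by (subst indep_varD[OF indep_walk_increment]) (auto simp: Suc.IH distr_Y)
  have "?W (Suc n) -` A \<inter> space M = (\<Union>c\<in>?C. E c)"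
    unfolding E_def B_def using Y_in_support[of "i + Suc n"] by auto
  then have "emeasure M (?W (Suc n) -` A \<inter> space M) = (\<integral>\<^sup>+c. emeasure M (E c) \<partial>count_space ?C)"
    using E_sets by (simp only:) (intro emeasure_UN_countable countable_set_pmf, auto simp: disjoint_family_on_def E_def)
  also have "\<dots> = (\<integral>\<^sup>+c. ennreal (pmf \<mu> c) * emeasure (?p n) (B c) \<partial>count_space ?C)"
    by (intro nn_integral_cong)
      (simp add: emeasure_eq_measure prob_E measure_pmf.emeasure_eq_measure ennreal_mult mult.commute)
  also have "\<dots> = (\<integral>\<^sup>+c. ennreal (pmf \<mu> c) * emeasure (?p n) (B c) \<partial>count_space UNIV)"
    by (intro nn_integral_count_space_eq) (auto simp: set_pmf_iff)
  also have "\<dots> = (\<integral>\<^sup>+c. emeasure (?p n) (B c) \<partial>measure_pmf \<mu>)"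
    by (rule nn_integral_measure_pmf[symmetric])
  also have "\<dots> = emeasure (bind_pmf \<mu> (\<lambda>c. map_pmf (\<lambda>w. w \<otimes> c) (?p n))) A"
    by (simp add: B_def vimage_def)
  also have "bind_pmf \<mu> (\<lambda>c. map_pmf (\<lambda>w. w \<otimes> c) (?p n)) = ?p (Suc n)"
    unfolding convolution_power.simps map_pmf_def by (rule bind_commute_pmf)
  finally show ?case by (simp add: emeasure_eq_measure measure_pmf.emeasure_eq_measure)
qed

end

section \<open>Linear progress along sample paths\<close>

context hyperbolic_action
begin

lemma act_walk_dist:
  assumes f: "\<And>l. 1 \<le> l \<Longrightarrow> f l \<in> carrier G"
  shows "dist (\<phi> (walk G f i) x0) (\<phi> (walk G f (i + n)) x0) = dist x0 (\<phi> (walk G (\<lambda>l. f (i + l)) n) x0)"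
proof -
  have "walk G (\<lambda>l. f (i + l)) n \<in> carrier G" by (intro walk_closed f) simp
  then show ?thesis using walk_closed[OF f] by (simp add: walk_add[OF f] act_mult act_isometry)
qed

text \<open>At speed c = b / 2 a window fails with probability at most C exp(- b (j - i) / 2). The
  choice K = 6 / b bounds this by C / j^3, and at most j starting indices per \<open>j\<close> leave
  the summable C / j^2.\<close>

lemma eventually_linear_progress:
  fixes M :: "'w measure"
  assumes iid: "iid_increments G M \<mu> Y" and ne: "non_elementary_measure G \<phi> x0 \<mu>"
  obtains c K where "0 < c" "0 \<le> K"
    "AE \<omega> in M. \<forall>\<^sub>F j in sequentially. \<forall>i<j. K * ln (real j) \<le> real (j - i) \<longrightarrow>
      c * real (j - i) \<le> dist (\<phi> (walk G (\<lambda>l. Y l \<omega>) i) x0) (\<phi> (walk G (\<lambda>l. Y l \<omega>) j) x0)"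
proof -
  interpret I: iid_increments G M \<mu> Y by (rule iid)
  obtain b C where b: "0 < b" "0 \<le> C" and esc:
    "\<And>n R. measure_pmf.prob (convolution_power G \<mu> n) {w. dist x0 (\<phi> w x0) \<le> R} \<le> C * exp (R - b * real n)"
    using exponential_escape[OF I.\<mu>_carrier ne] by blast
  define c where "c = b / 2"
  define K where "K = 6 / b"
  define F where "F i n = (\<lambda>\<omega>. walk G (\<lambda>l. Y (i + l) \<omega>) n) -` {w. dist x0 (\<phi> w x0) \<le> c * real n} \<inter> space M" for i n
  define E where "E j = (\<Union>i\<in>{i\<in>{..<j}. K * ln (real j) \<le> real (j - i)}. F i (j - i))" for j
  have F_sets: "F i n \<in> sets M" for i n
    unfolding F_def by (rule measurable_sets[OF I.walk_random_variable]) simp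
  have prob_E: "measure M (E j) \<le> C * inverse (real j ^ 2)" for j
  proof (cases "j = 0")
    case False
    have "measure M (E j) \<le> (\<Sum>i\<in>{i\<in>{..<j}. K * ln (real j) \<le> real (j - i)}. measure M (F i (j - i)))"
      unfolding E_def by (intro measure_UNION_le F_sets) auto
    also have "\<dots> \<le> (\<Sum>i\<in>{i\<in>{..<j}. K * ln (real j) \<le> real (j - i)}. C * inverse (real j ^ 3))"
    proof (intro sum_mono)
      fix i assume "i \<in> {i\<in>{..<j}. K * ln (real j) \<le> real (j - i)}"
      then have "b / 2 * (K * ln (real j)) \<le> b / 2 * real (j - i)"
        using b by (intro mult_left_mono) auto
      then have le: "3 * ln (real j) \<le> b / 2 * real (j - i)" unfolding K_def using b by simp
      have "measure M (F i (j - i)) \<le> C * exp (c * real (j - i) - b * real (j - i))"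
        unfolding F_def I.walk_distribution by (rule esc)
      also have "c * real (j - i) - b * real (j - i) = - (b / 2 * real (j - i))" unfolding c_def by (simp add: algebra_simps)
      also have "C * exp (- (b / 2 * real (j - i))) \<le> C * exp (- (3 * ln (real j)))"
        using le b by (intro mult_left_mono) auto
      also have "exp (- (3 * ln (real j))) = inverse (real j ^ 3)"
      proof -
        have "exp (3 * ln (real j)) = exp (ln (real j)) ^ 3" using exp_of_nat_mult[of 3 "ln (real j)"] by simp
        then show ?thesis using False by (simp add: exp_minus)
      qed
      finally show "measure M (F i (j - i)) \<le> C * inverse (real j ^ 3)" .
    qed
    also have "\<dots> \<le> real j * (C * inverse (real j ^ 3))"
    proof -
      have "card {i\<in>{..<j}. K * ln (real j) \<le> real (j - i)} \<le> card {..<j}" by (intro card_mono) auto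
      then show ?thesis using b by (simp add: mult_right_mono)
    qed
    also have "\<dots> = C * inverse (real j ^ 2)" using False by (simp add: field_simps power2_eq_square power3_eq_cube)
    finally show ?thesis .
  qed (simp add: E_def)
  have "summable (\<lambda>j. measure M (E j))"
  proof (rule summable_comparison_test')
    show "summable (\<lambda>j. C * inverse (real j ^ 2))"
      by (intro summable_mult inverse_power_summable) simp
  qed (use prob_E in simp)
  moreover have E_sets: "E j \<in> sets M" for j unfolding E_def using F_sets by (intro sets.finite_UN) auto
  ultimately have "AE \<omega> in M. \<forall>\<^sub>F j in sequentially. \<omega> \<in> space M - E j"
    by (intro borel_cantelli_AE1) (auto simp: I.emeasure_eq_measure)
  then have "AE \<omega> in M. \<forall>\<^sub>F j in sequentially. \<forall>i<j. K * ln (real j) \<le> real (j - i) \<longrightarrow>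
      c * real (j - i) \<le> dist (\<phi> (walk G (\<lambda>l. Y l \<omega>) i) x0) (\<phi> (walk G (\<lambda>l. Y l \<omega>) j) x0)"
    using AE_space
  proof eventually_elim
    case (elim \<omega>)
    have Yc: "Y l \<omega> \<in> carrier G" if "1 \<le> l" for l
      using I.Y_in_support[OF that elim(2)] I.\<mu>_carrier by blast
    from elim(1) show ?case
    proof eventually_elim
      case (elim j)
      show ?case
      proof (intro allI impI)
        fix i assume ij: "i < j" "K * ln (real j) \<le> real (j - i)"
        then have "\<omega> \<notin> F i (j - i)" using elim unfolding E_def by auto
        then have "c * real (j - i) \<le> dist x0 (\<phi> (walk G (\<lambda>l. Y (i + l) \<omega>) (j - i)) x0)"
          using elim unfolding F_def by auto
        then show "c * real (j - i) \<le> dist (\<phi> (walk G (\<lambda>l. Y l \<omega>) i) x0) (\<phi> (walk G (\<lambda>l. Y l \<omega>) j) x0)"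
          using act_walk_dist[where f = "\<lambda>l. Y l \<omega>" and i = i and n = "j - i", OF Yc] ij(1) by simp
      qed
    qed
  qed
  then show ?thesis using that[of c K] b unfolding c_def K_def by simp
qed

end

theorem theorem1p3:
  fixes G :: "('g, 'b) monoid_scheme"
    and \<phi> :: "'g \<Rightarrow> 'x::metric_space \<Rightarrow> 'x"
    and x0 :: 'x
    and \<mu> :: "'g pmf"
    and M :: "'w measure"
    and g :: "nat \<Rightarrow> 'w \<Rightarrow> 'g"
  assumes "group G" and "countable (carrier G)"
    and "gromov_hyperbolic TYPE('x)" and "separable_space (euclidean :: 'x topology)"
    and "isometric_action G \<phi>"
    and "set_pmf \<mu> \<subseteq> carrier G"
    and "non_elementary_measure G \<phi> x0 \<mu>"
    and "integrable (measure_pmf \<mu>) (\<lambda>h. dist x0 (\<phi> h x0))"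
    and "prob_space M"
    and "prob_space.indep_vars M (\<lambda>_. count_space UNIV) g {1..}"
    and "\<And>i. i \<ge> 1 \<Longrightarrow> distr M (count_space UNIV) (g i) = measure_pmf \<mu>"
  shows "AE \<omega> in M. \<exists>\<gamma>. quasigeodesic_ray \<gamma> \<and>
           (\<lambda>n. infdist (\<phi> (walk G (\<lambda>i. g i \<omega>) n) x0) (\<gamma> ` {0..}) / real n) \<longlonglongrightarrow> 0 \<and>
           (bounded ((\<lambda>h. \<phi> h x0) ` set_pmf \<mu>) \<longrightarrow>
             limsup (\<lambda>n. ereal (infdist (\<phi> (walk G (\<lambda>i. g i \<omega>) n) x0) (\<gamma> ` {0..}) / ln (real n))) < \<infinity>)"
proof -
  obtain D where "hyperbolic_space TYPE('x) D"
    using gromov_hyperbolic_imp_hyperbolic_space[OF assms(3)] by blast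
  then interpret hyperbolic_action D x0 G \<phi>
    using assms(1,5) by (simp add: hyperbolic_action_def hyperbolic_action_axioms_def)
  interpret P: prob_space M by (rule assms(9))
  have g_meas: "g i \<in> measurable M (count_space UNIV)" if "1 \<le> i" for i
    using assms(10) that unfolding P.indep_vars_def by auto
  obtain c0 where c0: "c0 \<in> set_pmf \<mu>" using set_pmf_not_empty[of \<mu>] by blast
  \<comment> \<open>Values of \<open>g\<close> outside the support, taken with probability zero, are
    sent to a fixed support point so that \<open>iid_increments\<close> applies.\<close>
  define r where "r h = (if h \<in> set_pmf \<mu> then h else c0)" for h
  define Y where "Y i \<omega> = r (g i \<omega>)" for i \<omega>
  have Y_eq: "AE \<omega> in M. \<forall>i\<ge>1. Y i \<omega> = g i \<omega>"
    unfolding AE_all_countable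
  proof
    fix i :: nat
    have "AE \<omega> in M. g i \<omega> \<in> set_pmf \<mu>" if i: "1 \<le> i"
    proof (rule AE_distrD[OF g_meas[OF i]])
      show "AE h in distr M (count_space UNIV) (g i). h \<in> set_pmf \<mu>"
        unfolding assms(11)[OF i] by (simp add: AE_measure_pmf_iff)
    qed
    then show "AE \<omega> in M. 1 \<le> i \<longrightarrow> Y i \<omega> = g i \<omega>"
      by (cases "1 \<le> i") (auto simp: Y_def r_def)
  qed
  interpret I: iid_increments G M \<mu> Y
  proof
    show "set_pmf \<mu> \<subseteq> carrier G" by (rule assms(6))
    show "P.indep_vars (\<lambda>_. count_space (set_pmf \<mu>)) Y {1..}"
      unfolding Y_def by (rule P.indep_vars_compose2[OF assms(10)]) (use c0 in \<open>auto simp: r_def\<close>)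
    fix i :: nat and c assume i: "1 \<le> i"
    show "P.prob (Y i -` {c} \<inter> space M) = pmf \<mu> c"
    proof -
      have "P.prob (Y i -` {c} \<inter> space M) = P.prob (g i -` (r -` {c}) \<inter> space M)"
        unfolding Y_def by (simp add: vimage_def)
      also have "\<dots> = measure (distr M (count_space UNIV) (g i)) (r -` {c})"
        by (rule measure_distr[OF g_meas[OF i], symmetric]) simp
      also have "\<dots> = measure_pmf.prob \<mu> (r -` {c})" unfolding assms(11)[OF i] ..
      also have "\<dots> = measure_pmf.prob \<mu> {c}"
        by (intro measure_pmf.finite_measure_eq_AE) (auto simp: AE_measure_pmf_iff r_def)
      finally show ?thesis by (simp add: measure_pmf_single)
    qed
  qed
  define f where "f h = dist x0 (\<phi> h x0)" for h
  have int_f: "integrable (measure_pmf \<mu>) f" using assms(8) unfolding f_def .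
  obtain c K where c: "0 < c" and K: "0 \<le> K" and prog:
    "AE \<omega> in M. \<forall>\<^sub>F j in sequentially. \<forall>i<j. K * ln (real j) \<le> real (j - i) \<longrightarrow>
      c * real (j - i) \<le> dist (\<phi> (walk G (\<lambda>l. Y l \<omega>) i) x0) (\<phi> (walk G (\<lambda>l. Y l \<omega>) j) x0)"
    using eventually_linear_progress[OF I.iid_increments_axioms assms(7)] by blast
  have indep_shift: "P.indep_vars (\<lambda>_. count_space UNIV) (\<lambda>i. g (Suc i)) UNIV"
    by (rule P.indep_vars_shift[OF assms(10)])
  have distr_shift: "distr M (count_space UNIV) (g (Suc i)) = measure_pmf \<mu>" for i
    by (rule assms(11)) simp
  have f_nonneg: "0 \<le> f h" for h unfolding f_def by simp
  have "0 \<le> (\<integral>h. f h \<partial>measure_pmf \<mu>)"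
    by (rule Bochner_Integration.integral_nonneg) (rule f_nonneg)
  \<comment> \<open>Adding 1 to the mean keeps the level positive even if the mean displacement is
    zero.\<close>
  then have upper: "AE \<omega> in M. \<forall>\<^sub>F n in sequentially. (\<Sum>i<n. f (g (Suc i) \<omega>)) \<le> 4 * ((\<integral>h. f h \<partial>measure_pmf \<mu>) + 1) * real n"
    by (intro P.iid_sum_upper_bound[OF indep_shift distr_shift f_nonneg int_f]) auto
  have cont: "AE \<omega> in M. \<forall>\<epsilon>>0. \<exists>\<eta>>0. \<forall>\<^sub>F n in sequentially. \<forall>i\<le>n. real (n - i) \<le> \<eta> * real n \<longrightarrow>
      (\<Sum>l<n. f (g (Suc l) \<omega>)) - (\<Sum>l<i. f (g (Suc l) \<omega>)) \<le> \<epsilon> * real n"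
    by (rule P.iid_sum_increments[OF indep_shift distr_shift f_nonneg int_f])
  from prog upper cont Y_eq AE_space show ?thesis
  proof eventually_elim
    case (elim \<omega>)
    define x where "x n = \<phi> (walk G (\<lambda>i. g i \<omega>) n) x0" for n
    have gs: "g l \<omega> \<in> set_pmf \<mu>" if "1 \<le> l" for l
      using elim(4,5) I.Y_in_support[OF that, of \<omega>] that by auto
    then have gc: "g l \<omega> \<in> carrier G" if "1 \<le> l" for l using assms(6) that by blast
    have walk_Y: "walk G (\<lambda>l. Y l \<omega>) n = walk G (\<lambda>l. g l \<omega>) n" for n
      using elim(4) by (intro walk_cong) auto
    have step: "dist (x i) (x (Suc i)) = f (g (Suc i) \<omega>)" for i
      using act_walk_dist[where f = "\<lambda>l. g l \<omega>" and i = i and n = 1, OF gc] gc[of "Suc i"]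
      unfolding x_def f_def by simp
    have x_0: "x 0 = x0" unfolding x_def by (simp add: act_one)
    obtain \<gamma> where \<gamma>: "quasigeodesic_ray \<gamma>" "(\<lambda>n. infdist (x n) (\<gamma> ` {0..}) / real n) \<longlonglongrightarrow> 0"
      "\<And>B. (\<And>i. dist (x i) (x (Suc i)) \<le> B) \<Longrightarrow>
        \<exists>A. \<forall>\<^sub>F n in sequentially. infdist (x n) (\<gamma> ` {0..}) \<le> A * ln (real n)"
    proof (rule quasigeodesic_tracking[where x = x, OF x_0 c K])
      show "\<forall>\<^sub>F j in sequentially. \<forall>i<j. K * ln (real j) \<le> real (j - i) \<longrightarrow> c * real (j - i) \<le> dist (x i) (x j)"
        using elim(1) unfolding walk_Y x_def .
      show "\<forall>\<^sub>F n in sequentially. (\<Sum>i<n. dist (x i) (x (Suc i))) \<le> 4 * ((\<integral>h. f h \<partial>measure_pmf \<mu>) + 1) * real n"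
        using elim(2) unfolding step .
      show "\<exists>\<eta>>0. \<forall>\<^sub>F n in sequentially. \<forall>i\<le>n. real (n - i) \<le> \<eta> * real n \<longrightarrow>
        (\<Sum>i<n. dist (x i) (x (Suc i))) - (\<Sum>i<i. dist (x i) (x (Suc i))) \<le> \<epsilon> * real n" if "0 < \<epsilon>" for \<epsilon>
        using elim(3) that unfolding step by blast
    qed blast
    have "limsup (\<lambda>n. ereal (infdist (x n) (\<gamma> ` {0..}) / ln (real n))) < \<infinity>"
      if bdd: "bounded ((\<lambda>h. \<phi> h x0) ` set_pmf \<mu>)"
    proof -
      obtain B where B: "\<And>h. h \<in> set_pmf \<mu> \<Longrightarrow> dist x0 (\<phi> h x0) \<le> B"
        using bdd unfolding bounded_any_center[where a = x0] by auto
      have "dist (x i) (x (Suc i)) \<le> B" for i unfolding step f_def by (intro B gs) simp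
      then obtain A where A: "\<forall>\<^sub>F n in sequentially. infdist (x n) (\<gamma> ` {0..}) \<le> A * ln (real n)"
        using \<gamma>(3) by blast
      have "\<forall>\<^sub>F n in sequentially. ereal (infdist (x n) (\<gamma> ` {0..}) / ln (real n)) \<le> ereal A"
        using A eventually_gt_at_top[of 1]
      proof eventually_elim
        case (elim n)
        then have "0 < ln (real n)" by simp
        then show ?case using elim by (simp add: pos_divide_le_eq)
      qed
      then have "limsup (\<lambda>n. ereal (infdist (x n) (\<gamma> ` {0..}) / ln (real n))) \<le> ereal A"
        by (rule Limsup_bounded)
      then show ?thesis by (rule le_less_trans) simp
    qed
    with \<gamma>(1,2) show ?case unfolding x_def by blast
  qed
qed

end
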